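(* Let $f\in C^1_b(\mathbb{R})\cap C^2(\mathbb{R})$ with $f'\ge0$, and let $(u,m)\in C^{2,\alpha}(\mathbb{T}^d)\times C^{2,\alpha}(\mathbb{T}^d)$ be a stable solution of the MFG system. Then there exists a neighborhood $\mathcal{O}$ of $(u,m)$ in $C^{2,\alpha}(\mathbb{T}^d)\times C^{2,\alpha}(\mathbb{T}^d)$ such that, if $(u^0,m^0)\in\mathcal{O}$, the sequence $(u^k,m^k)$ generated by Newton's method $(u^{k+1},m^{k+1}) + T\big(G(u^k,m^k)+dG[u^k,m^k](u^{k+1}-u^k,m^{k+1}-m^k)\big)=0$ converges superlinearly to $(u,m)$ in $C^{2,\alpha}(\mathbb{T}^d)\times C^{2,\alpha}(\mathbb{T}^d)$. If moreover $f\in C^{2,1}_{\mathrm{loc}}(\mathbb{R})$, the convergence is quadratic.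
   Context: $\mathbb{T}^d$ is the flat torus, $\lambda>0$, $\alpha\in(0,1)$, $m_0\in C^{0,\alpha}(\mathbb{T}^d)$ a probability density. $C^1_b(\mathbb{R})$: $C^1$ functions with $f,f'$ bounded; $C^{2,1}_{\mathrm{loc}}(\mathbb{R})$: $C^2$ functions with $f''$ Lipschitz on bounded sets. The MFG system is $-\Delta u + \tfrac12|Du|^2 + \lambda u = f(m)$, $-\Delta m - \operatorname{div}(m Du) + \lambda m = \lambda m_0$ in $\mathbb{T}^d$ (classical solution: $C^2$ pair satisfying it pointwise). A classical solution $(u,m)$ is stable if $(0,0)$ is the unique classical solution of $-\Delta v + Du\cdot Dv + \lambda v = f'(m)\rho$, $-\Delta\rho - \operatorname{div}(\rho Du) + \lambda\rho = \operatorname{div}(m Dv)$. $T$ maps $(\xi,\zeta)\in C^{0,\alpha}\times C^{0,\alpha}(\mathbb{T}^d)$ to the solution $(v,\rho)$ of $-\Delta v+\lambda v=\xi$, $-\Delta\rho+\lambda\rho=\zeta$. $G(v,\rho)=(\tfrac12|Dv|^2-f(\rho),-\operatorname{div}(\rho Dv)-\lambda m_0)$, $dG[v,\rho](w,\mu)=(Dv\cdot Dw-f'(\rho)\mu,-\operatorname{div}(\mu Dv)-\operatorname{div}(\rho Dw))$. (The Newton initial guess is denoted $(u^0,m^0)$, distinct from the datum $m_0$.) *)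

theory Defs
  imports "HOL-Analysis.Analysis"
begin

text \<open>Functions on the flat torus T^d are represented as Z^d-periodic functions on real^'d.\<close>

definition periodic :: "(real^'d \<Rightarrow> real) \<Rightarrow> bool" where
  "periodic u \<longleftrightarrow> (\<forall>x z. (\<forall>i. z $ i \<in> \<int>) \<longrightarrow> u (x + z) = u x)"

definition pd :: "'d::finite \<Rightarrow> (real^'d \<Rightarrow> real) \<Rightarrow> real^'d \<Rightarrow> real" where
  "pd i u x = deriv (\<lambda>t. u (x + t *\<^sub>R axis i 1)) 0"

definition C1_fun :: "(real^'d::finite \<Rightarrow> real) \<Rightarrow> bool" where
  "C1_fun u \<longleftrightarrow> continuous_on UNIV u \<and>
     (\<forall>i x. ((\<lambda>t. u (x + t *\<^sub>R axis i 1)) has_real_derivative pd i u x) (at 0)) \<and>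
     (\<forall>i. continuous_on UNIV (pd i u))"

definition C2_fun :: "(real^'d::finite \<Rightarrow> real) \<Rightarrow> bool" where
  "C2_fun u \<longleftrightarrow> C1_fun u \<and> (\<forall>i. C1_fun (pd i u))"

definition torus_C2 :: "(real^'d::finite \<Rightarrow> real) \<Rightarrow> bool" where
  "torus_C2 u \<longleftrightarrow> periodic u \<and> C2_fun u"

definition holder_cont :: "real \<Rightarrow> (real^'d \<Rightarrow> real) \<Rightarrow> bool" where
  "holder_cont \<alpha> g \<longleftrightarrow> (\<exists>C. \<forall>x y. \<bar>g x - g y\<bar> \<le> C * dist x y powr \<alpha>)"

definition holder_semi :: "real \<Rightarrow> (real^'d \<Rightarrow> real) \<Rightarrow> real" where
  "holder_semi \<alpha> g = Sup {\<bar>g x - g y\<bar> / dist x y powr \<alpha> | x y. x \<noteq> y}"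

definition C0a :: "real \<Rightarrow> (real^'d \<Rightarrow> real) \<Rightarrow> bool" where
  "C0a \<alpha> u \<longleftrightarrow> periodic u \<and> continuous_on UNIV u \<and> holder_cont \<alpha> u"

definition C2a :: "real \<Rightarrow> (real^'d::finite \<Rightarrow> real) \<Rightarrow> bool" where
  "C2a \<alpha> u \<longleftrightarrow> torus_C2 u \<and> (\<forall>i j. holder_cont \<alpha> (pd j (pd i u)))"

definition sup_norm :: "(real^'d \<Rightarrow> real) \<Rightarrow> real" where
  "sup_norm g = Sup (range (\<lambda>x. \<bar>g x\<bar>))"

definition norm2a :: "real \<Rightarrow> (real^'d::finite \<Rightarrow> real) \<Rightarrow> real" where
  "norm2a \<alpha> u = sup_norm u + (\<Sum>i\<in>UNIV. sup_norm (pd i u))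
     + (\<Sum>i\<in>UNIV. \<Sum>j\<in>UNIV. sup_norm (pd j (pd i u)) + holder_semi \<alpha> (pd j (pd i u)))"

definition dist2a :: "real \<Rightarrow> (real^'d::finite \<Rightarrow> real) \<times> (real^'d \<Rightarrow> real)
    \<Rightarrow> (real^'d \<Rightarrow> real) \<times> (real^'d \<Rightarrow> real) \<Rightarrow> real" where
  "dist2a \<alpha> p q = norm2a \<alpha> (\<lambda>x. fst p x - fst q x) + norm2a \<alpha> (\<lambda>x. snd p x - snd q x)"

definition lap :: "(real^'d::finite \<Rightarrow> real) \<Rightarrow> real^'d \<Rightarrow> real" where
  "lap u x = (\<Sum>i\<in>UNIV. pd i (pd i u) x)"

definition grad_dot :: "(real^'d::finite \<Rightarrow> real) \<Rightarrow> (real^'d \<Rightarrow> real) \<Rightarrow> real^'d \<Rightarrow> real" where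
  "grad_dot u v x = (\<Sum>i\<in>UNIV. pd i u x * pd i v x)"

definition divg :: "(real^'d::finite \<Rightarrow> real) \<Rightarrow> (real^'d \<Rightarrow> real) \<Rightarrow> real^'d \<Rightarrow> real" where
  "divg m u x = (\<Sum>i\<in>UNIV. pd i (\<lambda>y. m y * pd i u y) x)"

definition Tsolve :: "real \<Rightarrow> (real^'d::finite \<Rightarrow> real) \<Rightarrow> (real^'d \<Rightarrow> real)" where
  "Tsolve lam \<xi> = (THE v. torus_C2 v \<and> (\<forall>x. - lap v x + lam * v x = \<xi> x))"

definition Top :: "real \<Rightarrow> (real^'d::finite \<Rightarrow> real) \<times> (real^'d \<Rightarrow> real)
    \<Rightarrow> (real^'d \<Rightarrow> real) \<times> (real^'d \<Rightarrow> real)" where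
  "Top lam p = (Tsolve lam (fst p), Tsolve lam (snd p))"

definition Gmap :: "real \<Rightarrow> (real^'d::finite \<Rightarrow> real) \<Rightarrow> (real \<Rightarrow> real)
    \<Rightarrow> (real^'d \<Rightarrow> real) \<times> (real^'d \<Rightarrow> real) \<Rightarrow> (real^'d \<Rightarrow> real) \<times> (real^'d \<Rightarrow> real)" where
  "Gmap lam m0 f p = (\<lambda>x. (1/2) * grad_dot (fst p) (fst p) x - f (snd p x),
                      \<lambda>x. - divg (snd p) (fst p) x - lam * m0 x)"

definition dGmap :: "(real \<Rightarrow> real) \<Rightarrow> (real^'d::finite \<Rightarrow> real) \<times> (real^'d \<Rightarrow> real)
    \<Rightarrow> (real^'d \<Rightarrow> real) \<times> (real^'d \<Rightarrow> real) \<Rightarrow> (real^'d \<Rightarrow> real) \<times> (real^'d \<Rightarrow> real)" where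
  "dGmap f p q = (\<lambda>x. grad_dot (fst p) (fst q) x - deriv f (snd p x) * snd q x,
                  \<lambda>x. - divg (snd q) (fst p) x - divg (snd p) (fst q) x)"

definition newton_rel :: "real \<Rightarrow> (real^'d::finite \<Rightarrow> real) \<Rightarrow> (real \<Rightarrow> real)
    \<Rightarrow> (real^'d \<Rightarrow> real) \<times> (real^'d \<Rightarrow> real) \<Rightarrow> (real^'d \<Rightarrow> real) \<times> (real^'d \<Rightarrow> real) \<Rightarrow> bool" where
  "newton_rel lam m0 f pk p1 \<longleftrightarrow>
     (let g = Gmap lam m0 f pk;
          h = dGmap f pk (\<lambda>x. fst p1 x - fst pk x, \<lambda>x. snd p1 x - snd pk x);
          t = Top lam (\<lambda>x. fst g x + fst h x, \<lambda>x. snd g x + snd h x)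
      in (\<forall>x. fst p1 x + fst t x = 0) \<and> (\<forall>x. snd p1 x + snd t x = 0))"

definition mfg_sol :: "real \<Rightarrow> (real^'d::finite \<Rightarrow> real) \<Rightarrow> (real \<Rightarrow> real)
    \<Rightarrow> (real^'d \<Rightarrow> real) \<Rightarrow> (real^'d \<Rightarrow> real) \<Rightarrow> bool" where
  "mfg_sol lam m0 f u m \<longleftrightarrow> torus_C2 u \<and> torus_C2 m \<and>
     (\<forall>x. - lap u x + (1/2) * grad_dot u u x + lam * u x = f (m x)) \<and>
     (\<forall>x. - lap m x - divg m u x + lam * m x = lam * m0 x)"

definition stable_sol :: "real \<Rightarrow> (real^'d::finite \<Rightarrow> real) \<Rightarrow> (real \<Rightarrow> real)
    \<Rightarrow> (real^'d \<Rightarrow> real) \<Rightarrow> (real^'d \<Rightarrow> real) \<Rightarrow> bool" where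
  "stable_sol lam m0 f u m \<longleftrightarrow> mfg_sol lam m0 f u m \<and>
     (\<forall>v \<rho>. torus_C2 v \<and> torus_C2 \<rho> \<and>
        (\<forall>x. - lap v x + grad_dot u v x + lam * v x = deriv f (m x) * \<rho> x) \<and>
        (\<forall>x. - lap \<rho> x - divg \<rho> u x + lam * \<rho> x = divg m v x)
      \<longrightarrow> v = (\<lambda>_. 0) \<and> \<rho> = (\<lambda>_. 0))"

definition C1b_C2 :: "(real \<Rightarrow> real) \<Rightarrow> bool" where
  "C1b_C2 f \<longleftrightarrow> (\<forall>x. (f has_real_derivative deriv f x) (at x)) \<and>
     (\<forall>x. (deriv f has_real_derivative deriv (deriv f) x) (at x)) \<and>
     continuous_on UNIV (deriv (deriv f)) \<and>
     bounded (range f) \<and> bounded (range (deriv f))"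

definition C21loc :: "(real \<Rightarrow> real) \<Rightarrow> bool" where
  "C21loc f \<longleftrightarrow> (\<forall>x. (f has_real_derivative deriv f x) (at x)) \<and>
     (\<forall>x. (deriv f has_real_derivative deriv (deriv f) x) (at x)) \<and>
     (\<forall>B. bounded B \<longrightarrow> (\<exists>L. L-lipschitz_on B (deriv (deriv f))))"

definition newton_seq :: "real \<Rightarrow> real \<Rightarrow> (real^'d::finite \<Rightarrow> real) \<Rightarrow> (real \<Rightarrow> real)
    \<Rightarrow> (nat \<Rightarrow> real^'d \<Rightarrow> real) \<Rightarrow> (nat \<Rightarrow> real^'d \<Rightarrow> real) \<Rightarrow> bool" where
  "newton_seq \<alpha> lam m0 f U M \<longleftrightarrow>
     (\<forall>k. C2a \<alpha> (U k) \<and> C2a \<alpha> (M k) \<and> newton_rel lam m0 f (U k, M k) (U (Suc k), M (Suc k)))"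

definition superlinear_conv :: "(nat \<Rightarrow> real) \<Rightarrow> bool" where
  "superlinear_conv e \<longleftrightarrow> e \<longlonglongrightarrow> 0 \<and>
     (\<exists>\<epsilon>. \<epsilon> \<longlonglongrightarrow> 0 \<and> (\<forall>k. e (Suc k) \<le> \<epsilon> k * e k))"

definition quadratic_conv :: "(nat \<Rightarrow> real) \<Rightarrow> bool" where
  "quadratic_conv e \<longleftrightarrow> e \<longlonglongrightarrow> 0 \<and> (\<exists>C. \<forall>k. e (Suc k) \<le> C * (e k)\<^sup>2)"

end

theory Submission
  imports Defs "HOL-Complex_Analysis.Great_Picard" "HOL-Library.Function_Algebras"
begin

text \<open>
  The Newton error satisfies a linear system: if $(U', M')$ is the Newton iterate of $(U, M)$, then
  the linearization at $(U, M)$ maps $(U' - u, M' - m)$ to a remainder that is quadratic in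
  $(U - u, M - m)$, up to the Taylor remainder of $f$. So everything rests on a bounded inverse of the
  linearization in $C^{2,\alpha}$, uniformly near $(u, m)$.

  At $(u, m)$ the term $m \Delta w$ of the second equation is eliminated by means of the first one. This
  leaves a first-order perturbation of $-\Delta + \lambda$, that is, the identity plus a compact operator on
  $C^{2,\alpha}$, which is injective by stability and hence bijective by Riesz' theorem. Nearby
  linearizations are inverted by a contraction argument.

  The Schauder estimate for $-\Delta + \lambda$ is proved for the finite-difference Laplacian, uniformly
  in the mesh size, with the maximum principle as the only tool, and transferred to the limit by the
  theorem of Arzela and Ascoli.
\<close>

section \<open>The discrete resolvent\<close>

text \<open>The product \<open>m \<Delta> w\<close> has the same order as the principal part
  \<open>\<Delta> \<mu>\<close>: composed with the inverse of -\<Delta> + \<lambda> it gives an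
  operator on C^{2,\<alpha>} that is bounded but need not be compact. The elimination works because
  the principal part is triangular: the only second derivatives of unknowns in the first equation
  are those in \<Delta> w.

  The difference equation is posed on all of R^d instead of a grid. Translates and difference
  quotients of solutions are again solutions, so every estimate reduces to comparing a bounded
  solution with a barrier. Hoelder regularity comes from scaling: the solution for parameter \<mu>
  resolves its data at the length \<mu>^(-1/2), and solutions for different parameters are played
  off against each other.

  In the Newton part f'' is merely continuous. Let \<eta> bound its oscillation at the scale of the
  current error e. The next error is at most a constant times (\<eta> + e) e. Continuity lets \<eta>
  tend to 0 with e, a Lipschitz bound makes it proportional to e, and both rates follow from this
  single inequality.\<close>

definition dlap :: "real \<Rightarrow> (real^'d::finite \<Rightarrow> real) \<Rightarrow> real^'d \<Rightarrow> real" where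
  "dlap h w x = (\<Sum>i\<in>UNIV. w (x + h *\<^sub>R axis i 1) + w (x - h *\<^sub>R axis i 1) - 2 * w x) / h\<^sup>2"

text \<open>The parameter \<open>\<mu>\<close> is not tied to \<open>lam\<close>, since the
  estimates compare solutions for many parameters. Boundedness is the substitute for boundary
  conditions and makes solutions unique for \<open>\<mu> > 0\<close>.\<close>

definition dsol :: "real \<Rightarrow> real \<Rightarrow> (real^'d::finite \<Rightarrow> real) \<Rightarrow> (real^'d \<Rightarrow> real) \<Rightarrow> bool" where
  "dsol h \<mu> w g \<longleftrightarrow> bounded (range w) \<and> (\<forall>x. \<mu> * w x - dlap h w x = g x)"

definition fdq :: "real \<Rightarrow> 'd::finite \<Rightarrow> (real^'d \<Rightarrow> real) \<Rightarrow> real^'d \<Rightarrow> real" where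
  "fdq h i w x = (w (x + h *\<^sub>R axis i 1) - w x) / h"

lemma bounded_range_realE:
  fixes w :: "'a \<Rightarrow> real"
  assumes "bounded (range w)"
  obtains B where "\<And>x. \<bar>w x\<bar> \<le> B"
  using assms unfolding bounded_iff by auto

lemma bounded_range_realI:
  fixes w :: "'a \<Rightarrow> real"
  assumes "\<And>x. \<bar>w x\<bar> \<le> B"
  shows "bounded (range w)"
  using assms unfolding bounded_iff by auto

text \<open>A maximum principle without a maximum point: the supremum \<open>S\<close> of the
  positive part satisfies \<open>S \<le> c / (\<mu> + c) * S\<close> and hence vanishes. Suprema
  need not be attained, as the index set will be R^d or, after doubling of variables, pairs of a
  point and a natural number. The premise \<open>F p > 0\<close> in \<open>step\<close> is what
  exploits oddness of the doubled function at the boundary index.\<close>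

lemma nonpos_if_contracting:
  fixes F :: "'i \<Rightarrow> real"
  assumes "\<mu> > 0" "c \<ge> 0" and bd: "\<And>p. F p \<le> B"
    and step: "\<And>S p. S \<ge> 0 \<Longrightarrow> (\<And>q. F q \<le> S) \<Longrightarrow> F p > 0 \<Longrightarrow> (\<mu> + c) * F p \<le> c * S"
  shows "F p \<le> 0"
proof -
  define S where "S = (SUP q. max (F q) 0)"
  have bdd: "bdd_above (range (\<lambda>q. max (F q) 0))"
    using bd by (intro bdd_aboveI[of _ "max B 0"]) (auto simp: max.coboundedI1)
  have le: "max (F q) 0 \<le> S" for q
    unfolding S_def by (rule cSUP_upper[OF _ bdd]) simp
  have S0: "S \<ge> 0" using le[of p] by simp
  have "max (F q) 0 \<le> c / (\<mu> + c) * S" for q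
  proof (cases "F q > 0")
    case True
    then have "(\<mu> + c) * F q \<le> c * S" using step[OF S0] le by force
    then show ?thesis using assms True by (simp add: field_simps)
  next
    case False
    then show ?thesis using assms S0 by simp
  qed
  then have "S \<le> c / (\<mu> + c) * S" unfolding S_def[symmetric]
    by (subst (1) S_def) (rule cSUP_least, auto)
  then have "S * \<mu> \<le> 0" using assms by (simp add: field_simps)
  then have "S \<le> 0" using assms by (simp add: mult_le_0_iff)
  then show ?thesis using le[of p] by simp
qed

lemma dlap_split:
  "dlap h w x = (\<Sum>i\<in>UNIV. w (x + h *\<^sub>R axis i 1) + w (x - h *\<^sub>R axis i 1)) / h\<^sup>2
      - 2 * real CARD('d) / h\<^sup>2 * w (x::real^'d::finite)"
  by (simp add: dlap_def sum_subtractf diff_divide_distrib)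

lemma dsol_mean_value:
  fixes w :: "real^'d::finite \<Rightarrow> real"
  assumes "dsol h \<mu> w g"
  shows "(\<mu> + 2 * real CARD('d) / h\<^sup>2) * w x
      = g x + (\<Sum>i\<in>UNIV. w (x + h *\<^sub>R axis i 1) + w (x - h *\<^sub>R axis i 1)) / h\<^sup>2"
proof -
  have "\<mu> * w x - dlap h w x = g x" using assms by (simp add: dsol_def)
  then show ?thesis unfolding dlap_split by (simp add: algebra_simps)
qed

text \<open>The constant \<open>M / \<mu>\<close> is a supersolution. The weight \<open>c\<close> is
  the coefficient of the centre value in the difference Laplacian, which is also the total weight of
  the neighbours.\<close>

lemma dsol_le:
  fixes w :: "real^'d::finite \<Rightarrow> real"
  assumes w: "dsol h \<mu> w g" and "\<mu> > 0" "h > 0" and g: "\<And>x. g x \<le> M"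
  shows "w x \<le> M / \<mu>"
proof -
  obtain B where B: "\<And>x. \<bar>w x\<bar> \<le> B" using w bounded_range_realE unfolding dsol_def by blast
  define c where "c = 2 * real CARD('d) / h\<^sup>2"
  have "w x - M / \<mu> \<le> 0"
  proof (rule nonpos_if_contracting[where \<mu> = \<mu> and c = c and B = "B - M / \<mu>"
        and F = "\<lambda>x. w x - M / \<mu>" and p = x])
    show "c \<ge> 0" "\<mu> > 0" using assms by (auto simp: c_def)
    show "w p - M / \<mu> \<le> B - M / \<mu>" for p using B[of p] by simp
    fix S p assume S: "S \<ge> 0" "\<And>q. w q - M / \<mu> \<le> S"
    have "(\<Sum>i\<in>UNIV. w (p + h *\<^sub>R axis i 1) + w (p - h *\<^sub>R axis i 1)) 
        \<le> (\<Sum>i\<in>(UNIV::'d set). 2 * (S + M / \<mu>))"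
      by (rule sum_mono) (smt (verit, best) S(2))
    then have "(\<Sum>i\<in>UNIV. w (p + h *\<^sub>R axis i 1) + w (p - h *\<^sub>R axis i 1)) / h\<^sup>2
        \<le> c * (S + M / \<mu>)"
      using \<open>h > 0\<close> unfolding c_def by (simp add: field_simps)
    then have "(\<mu> + c) * w p \<le> M + c * (S + M / \<mu>)"
      using dsol_mean_value[OF w, of p] g[of p] unfolding c_def by simp
    moreover have "(\<mu> + c) * (w p - M / \<mu>) = (\<mu> + c) * w p - M - c * (M / \<mu>)"
      using \<open>\<mu> > 0\<close> by (simp add: field_simps)
    ultimately show "(\<mu> + c) * (w p - M / \<mu>) \<le> c * S"
      by (simp add: distrib_left)
  qed
  then show ?thesis by simp
qed

lemma dsol_lincomb:
  assumes "dsol h \<mu> w g" "dsol h \<mu> w' g'"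
  shows "dsol h \<mu> (\<lambda>x. a * w x + b * w' x) (\<lambda>x. a * g x + b * g' x)"
proof -
  obtain B B' where B: "\<And>x. \<bar>w x\<bar> \<le> B" "\<And>x. \<bar>w' x\<bar> \<le> B'"
    using assms bounded_range_realE unfolding dsol_def by metis
  have "\<bar>a * w x + b * w' x\<bar> \<le> \<bar>a\<bar> * B + \<bar>b\<bar> * B'" for x
  proof -
    have "\<bar>a * w x + b * w' x\<bar> \<le> \<bar>a\<bar> * \<bar>w x\<bar> + \<bar>b\<bar> * \<bar>w' x\<bar>"
      by (metis abs_mult abs_triangle_ineq)
    also have "\<dots> \<le> \<bar>a\<bar> * B + \<bar>b\<bar> * B'"
      by (intro add_mono mult_left_mono B) auto
    finally show ?thesis .
  qed
  then have b: "bounded (range (\<lambda>x. a * w x + b * w' x))" by (rule bounded_range_realI)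
  have dl: "dlap h (\<lambda>x. a * w x + b * w' x) x = a * dlap h w x + b * dlap h w' x" for x
  proof -
    have "a * dlap h w x + b * dlap h w' x =
      (a * (\<Sum>i\<in>UNIV. w (x + h *\<^sub>R axis i 1) + w (x - h *\<^sub>R axis i 1) - 2 * w x) +
      b * (\<Sum>i\<in>UNIV. w' (x + h *\<^sub>R axis i 1) + w' (x - h *\<^sub>R axis i 1) - 2 * w' x)) / h\<^sup>2"
      unfolding dlap_def by (simp add: add_divide_distrib)
    also have "a * (\<Sum>i\<in>UNIV. w (x + h *\<^sub>R axis i 1) + w (x - h *\<^sub>R axis i 1) - 2 * w x) +
      b * (\<Sum>i\<in>UNIV. w' (x + h *\<^sub>R axis i 1) + w' (x - h *\<^sub>R axis i 1) - 2 * w' x) =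
      (\<Sum>i\<in>UNIV. (a * w (x + h *\<^sub>R axis i 1) + b * w' (x + h *\<^sub>R axis i 1)) +
         (a * w (x - h *\<^sub>R axis i 1) + b * w' (x - h *\<^sub>R axis i 1)) - 2 * (a * w x + b * w' x))"
      unfolding sum_distrib_left sum.distrib[symmetric] by (rule sum.cong) (auto simp: algebra_simps)
    finally show ?thesis unfolding dlap_def by simp
  qed
  then have "\<mu> * (a * w x + b * w' x) - dlap h (\<lambda>x. a * w x + b * w' x) x = a * g x + b * g' x" for x
  proof -
    have "g x = \<mu> * w x - dlap h w x" "g' x = \<mu> * w' x - dlap h w' x"
      using assms by (auto simp: dsol_def)
    then show ?thesis unfolding dl by (simp only:) (simp add: algebra_simps)
  qed
  then show ?thesis using b by (simp add: dsol_def)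
qed

lemma dsol_diff:
  assumes "dsol h \<mu> w g" "dsol h \<mu> w' g'"
  shows "dsol h \<mu> (\<lambda>x. w x - w' x) (\<lambda>x. g x - g' x)"
  using dsol_lincomb[OF assms, of 1 "-1"] by simp

lemma dsol_abs_le:
  fixes w :: "real^'d::finite \<Rightarrow> real"
  assumes w: "dsol h \<mu> w g" and "\<mu> > 0" "h > 0" and g: "\<And>x. \<bar>g x\<bar> \<le> M"
  shows "\<bar>w x\<bar> \<le> M / \<mu>"
proof -
  have "w x \<le> M / \<mu>" using dsol_le[OF w, of M] assms by (simp add: abs_le_iff)
  moreover have "dsol h \<mu> (\<lambda>x. - w x) (\<lambda>x. - g x)" using dsol_lincomb[OF w w, of "-1" 0] by simp
  from dsol_le[OF this, of M] have "- w x \<le> M / \<mu>" using assms by (simp add: abs_le_iff)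
  ultimately show ?thesis by simp
qed

lemma dsol_shift:
  assumes "dsol h \<mu> w g"
  shows "dsol h \<mu> (\<lambda>x. w (x + y)) (\<lambda>x. g (x + y))"
proof -
  obtain B where B: "\<And>x. \<bar>w x\<bar> \<le> B" using assms bounded_range_realE unfolding dsol_def by blast
  have "dlap h (\<lambda>x. w (x + y)) x = dlap h w (x + y)" for x
    unfolding dlap_def by (simp add: algebra_simps)
  then show ?thesis using assms B unfolding dsol_def by (auto intro!: bounded_range_realI[of _ B])
qed

text \<open>The equation has constant coefficients, so difference quotients of solutions solve it
  again; this replaces differentiation of the equation.\<close>

lemma dsol_fdq:
  assumes "dsol h \<mu> w g"
  shows "dsol h \<mu> (fdq h i w) (fdq h i g)"
  using dsol_lincomb[OF dsol_shift[OF assms, of "h *\<^sub>R axis i 1"] assms, of "1/h" "-1/h"]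
  by (simp add: fdq_def[abs_def] diff_divide_distrib)

text \<open>A translate by an arbitrary vector is compared with \<open>w\<close> itself. Hence every
  increment bound for the data, off the lattice as well, passes to \<open>w\<close> with the factor
  \<open>1 / \<mu>\<close>.\<close>

lemma dsol_modulus:
  fixes w :: "real^'d::finite \<Rightarrow> real"
  assumes w: "dsol h \<mu> w g" and "\<mu> > 0" "h > 0" and "\<And>x. \<bar>g (x + y) - g x\<bar> \<le> M"
  shows "\<bar>w (x + y) - w x\<bar> \<le> M / \<mu>"
  using dsol_abs_le[OF dsol_diff[OF dsol_shift[OF w] w]] assms by blast

lemma dsol_periodic:
  fixes w :: "real^'d::finite \<Rightarrow> real"
  assumes w: "dsol h \<mu> w g" and "\<mu> > 0" "h > 0" and g: "periodic g"
  shows "periodic w"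
  unfolding periodic_def
proof safe
  fix x z :: "real^'d" assume z: "\<forall>i. z $ i \<in> \<int>"
  have "\<bar>w (x + z) - w x\<bar> \<le> 0 / \<mu>"
    by (rule dsol_modulus[OF w]) (use assms z in \<open>auto simp: periodic_def\<close>)
  then show "w (x + z) = w x" by simp
qed

text \<open>The resolvent identity in disguise: subtracting solutions with equal data for two
  parameters leaves an equation whose right-hand side is a multiple of one of these
  solutions.\<close>

lemma dsol_change_param:
  assumes "dsol h \<mu> w g"
  shows "dsol h \<nu> w (\<lambda>x. g x + (\<nu> - \<mu>) * w x)"
  using assms unfolding dsol_def by (auto simp: algebra_simps)

text \<open>Solving the equation for the centre value gives a fixed-point problem with contraction
  factor \<open>n / (\<mu> + n)\<close>, where \<open>n\<close> is the total weight of the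
  neighbours. The iteration takes place in the bounded continuous functions, whence the continuity
  of \<open>g\<close>.\<close>

lemma dsol_exists:
  fixes g :: "real^'d::finite \<Rightarrow> real"
  assumes "\<mu> > 0" "h > 0" and gc: "continuous_on UNIV g" and gb: "bounded (range g)"
  obtains w where "dsol h \<mu> w g"
proof -
  define n where "n = 2 * real CARD('d) / h\<^sup>2"
  have n: "n > 0" using assms by (simp add: n_def)
  define P where "P w x = (g x + (\<Sum>i\<in>UNIV. w (x + h *\<^sub>R axis i 1) + w (x - h *\<^sub>R axis i 1)) / h\<^sup>2) / (\<mu> + n)"
    for w x
  obtain G where G: "\<And>x. \<bar>g x\<bar> \<le> G" using gb bounded_range_realE by blast
  define Q :: "((real^'d) \<Rightarrow>\<^sub>C real) \<Rightarrow> ((real^'d) \<Rightarrow>\<^sub>C real)" where "Q w = Bcontfun (P (apply_bcontfun w))" for w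
  have PQ: "apply_bcontfun (Q w) = P (apply_bcontfun w)" for w
  proof -
    have c: "continuous_on UNIV (P (apply_bcontfun w))"
    proof -
      have cw: "continuous_on UNIV (apply_bcontfun w)" by (rule continuous_on_apply_bcontfun)
      have "continuous_on UNIV (\<lambda>x. w (x + y))" for y
        by (rule continuous_on_compose2[OF cw, of UNIV "\<lambda>x. x + y"]) (auto intro: continuous_intros)
      moreover have "continuous_on UNIV (\<lambda>x. w (x - y))" for y
        by (rule continuous_on_compose2[OF cw, of UNIV "\<lambda>x. x - y"]) (auto intro: continuous_intros)
      ultimately show ?thesis unfolding P_def using assms n
        by (intro continuous_on_divide continuous_on_add gc continuous_on_sum continuous_on_const) auto
    qed
    have "\<bar>P (apply_bcontfun w) x\<bar> \<le> (G + (\<Sum>i\<in>(UNIV::'d set). norm w + norm w) / h\<^sup>2) / (\<mu> + n)" for x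
    proof -
      have nb: "\<bar>w y\<bar> \<le> norm w" for y using norm_bounded[of w y] by simp
      have "\<bar>w y + w z\<bar> \<le> norm w + norm w" for y z using nb[of y] nb[of z] by linarith
      then have "\<bar>\<Sum>i\<in>UNIV. w (x + h *\<^sub>R axis i 1) + w (x - h *\<^sub>R axis i 1)\<bar> \<le> (\<Sum>i\<in>(UNIV::'d set). norm w + norm w)"
        by (intro order_trans[OF sum_abs] sum_mono)
      then have "\<bar>(\<Sum>i\<in>UNIV. w (x + h *\<^sub>R axis i 1) + w (x - h *\<^sub>R axis i 1)) / h\<^sup>2\<bar> 
          \<le> (\<Sum>i\<in>(UNIV::'d set). norm w + norm w) / h\<^sup>2"
        unfolding abs_divide by (simp add: divide_right_mono)
      then have "\<bar>g x + (\<Sum>i\<in>UNIV. w (x + h *\<^sub>R axis i 1) + w (x - h *\<^sub>R axis i 1)) / h\<^sup>2\<bar>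
          \<le> G + (\<Sum>i\<in>(UNIV::'d set). norm w + norm w) / h\<^sup>2"
        using G[of x] by linarith
      then show ?thesis unfolding P_def abs_divide using n assms
        by (simp add: divide_right_mono)
    qed
    then have "P (apply_bcontfun w) \<in> bcontfun"
      unfolding bcontfun_def using c bounded_range_realI by blast
    then show ?thesis unfolding Q_def by (simp add: Bcontfun_inverse)
  qed
  have "\<exists>!w. Q w = w"
  proof (rule banach_fix_type[of "n / (\<mu> + n)"])
    show "0 \<le> n / (\<mu> + n)" "n / (\<mu> + n) < 1" using n assms by auto
    show "\<forall>w v. dist (Q w) (Q v) \<le> n / (\<mu> + n) * dist w v"
    proof safe
      fix w v :: "(real^'d) \<Rightarrow>\<^sub>C real"
      show "dist (Q w) (Q v) \<le> n / (\<mu> + n) * dist w v"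
      proof (rule dist_bound)
        fix x
        have d: "\<bar>w y - v y\<bar> \<le> dist w v" for y
          using dist_bounded[of w y v] by (simp add: dist_real_def)
        have "P (apply_bcontfun w) x - P (apply_bcontfun v) x = 
          ((\<Sum>i\<in>UNIV. (w (x + h *\<^sub>R axis i 1) - v (x + h *\<^sub>R axis i 1)) + (w (x - h *\<^sub>R axis i 1) - v (x - h *\<^sub>R axis i 1))) / h\<^sup>2) / (\<mu> + n)"
          unfolding P_def by (simp add: sum_subtractf sum.distrib diff_divide_distrib add_divide_distrib)
        moreover have "\<bar>(w y - v y) + (w z - v z)\<bar> \<le> dist w v + dist w v" for y z
          using d[of y] d[of z] by linarith
        then have "\<bar>\<Sum>i\<in>UNIV. (w (x + h *\<^sub>R axis i 1) - v (x + h *\<^sub>R axis i 1)) + (w (x - h *\<^sub>R axis i 1) - v (x - h *\<^sub>R axis i 1))\<bar>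
          \<le> (\<Sum>i\<in>(UNIV::'d set). dist w v + dist w v)"
          by (intro order_trans[OF sum_abs] sum_mono)
        ultimately show "dist (Q w x) (Q v x) \<le> n / (\<mu> + n) * dist w v"
          using n assms unfolding PQ dist_real_def
          by (simp add: abs_divide n_def divide_right_mono field_simps)
      qed
    qed
  qed
  then obtain w where w: "Q w = w" by blast
  then have e: "apply_bcontfun w x = P (apply_bcontfun w) x" for x using PQ by metis
  have "dsol h \<mu> (apply_bcontfun w) g"
    unfolding dsol_def
  proof safe
    show "bounded (range (apply_bcontfun w))" by (rule bounded_apply_bcontfun)
    fix x
    have "(\<mu> + n) * w x = g x + (\<Sum>i\<in>UNIV. w (x + h *\<^sub>R axis i 1) + w (x - h *\<^sub>R axis i 1)) / h\<^sup>2"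
    proof -
      have "\<mu> + n \<noteq> 0" using n assms by simp
      then show ?thesis by (subst e[of x]) (simp add: P_def)
    qed
    then show "\<mu> * w x - dlap h (apply_bcontfun w) x = g x"
      unfolding dlap_split n_def by (simp add: algebra_simps)
  qed
  then show ?thesis using that by blast
qed

text \<open>
  Doubling of variables: $w(x + (k+1) h e_i) - w(x - k h e_i)$ solves the discrete equation in the
  remaining coordinates of $x$ and in $k$, is odd under $k \mapsto -1-k$, and is compared with the barrier
  $(b/\mu)(2k+1)h + (a/\mu)(1 - q^{k+1})$, where $q$ is chosen such that $(1-q)^2 \ge \mu h^2 q$.
\<close>

lemma dsol_gradient_upper:
  fixes w :: "real^'d::finite \<Rightarrow> real"
  assumes w: "dsol h \<mu> w g" and "\<mu> > 0" "h > 0" "a \<ge> 0" "b \<ge> 0"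
    and g: "\<And>x m. \<bar>g (x + (real m * h) *\<^sub>R axis i 1) - g x\<bar> \<le> a + b * (real m * h)"
  shows "w (x + h *\<^sub>R axis i 1) - w x \<le> h * (2 * a / sqrt \<mu> + b / \<mu>)"
proof -
  define e where "e = axis i (1::real)"
  define n where "n = real CARD('d)"
  obtain B where B: "\<And>x. \<bar>w x\<bar> \<le> B" using w bounded_range_realE unfolding dsol_def by blast
  define c where "c = sqrt \<mu> * h"
  have c: "c > 0" "c\<^sup>2 = \<mu> * h\<^sup>2" using assms by (auto simp: c_def power_mult_distrib)
  \<comment> \<open>\<open>q ^ k\<close> imitates the exponential
    \<open>exp (- sqrt \<mu> * k * h)\<close>. With \<open>q = 1 / (1 + t)\<close> the requirement
    on \<open>q\<close> reads \<open>t\<^sup>2 \<ge> c\<^sup>2 * (1 + t)\<close>; this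
    \<open>t\<close> is an explicit near-solution with surplus \<open>c * c\<^sup>2\<close>.\<close>
  define t where "t = c + c\<^sup>2"
  define q where "q = 1 / (1 + t)"
  have t: "t > 0" using c(1) by (simp add: t_def add_pos_nonneg)
  have q: "0 < q" "q < 1" "1 - q = t * q" using t by (auto simp: q_def field_simps)
  have "c\<^sup>2 * (1 + t) \<le> t\<^sup>2"
  proof -
    have "t\<^sup>2 - c\<^sup>2 * (1 + t) = c * c\<^sup>2"
      by (simp add: t_def power2_eq_square algebra_simps)
    then show ?thesis using c by (smt (verit) mult_nonneg_nonneg zero_le_power2)
  qed
  moreover have "1 = (1 + t) * q" using t by (simp add: q_def)
  ultimately have "c\<^sup>2 * (1 + t) * (q * q) \<le> t\<^sup>2 * (q * q)"
    using q by (intro mult_right_mono) auto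
  moreover have "c\<^sup>2 * (1 + t) * (q * q) = c\<^sup>2 * q"
    using \<open>1 = (1 + t) * q\<close> by (metis mult.assoc mult.right_neutral mult.commute)
  moreover have "(1 - q)\<^sup>2 = t\<^sup>2 * (q * q)"
    unfolding q(3) by (simp add: power_mult_distrib power2_eq_square)
  ultimately have q2: "\<mu> * h\<^sup>2 * q \<le> (1 - q)\<^sup>2"
    using c(2) by metis
  define ps where "ps k = (b / \<mu>) * ((2 * real k + 1) * h) + (a / \<mu>) * (1 - q ^ (k + 1))" for k :: nat
  \<comment> \<open>\<open>pm k\<close> is the barrier at index \<open>k - 1\<close>; it is a
    separate function because for \<open>k = 0\<close> that index is not a natural number.\<close>
  define pm where "pm k = (b / \<mu>) * ((2 * real k - 1) * h) + (a / \<mu>) * (1 - q ^ k)" for k :: nat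
  have ps0: "ps k \<ge> 0" for k unfolding ps_def using assms q by (auto simp: power_le_one mult_le_one)
  have pm_Suc: "pm (Suc k) = ps k" for k by (simp add: pm_def ps_def algebra_simps)
  have barrier: "a + b * ((2 * real k + 1) * h) + (ps (Suc k) + pm k - 2 * ps k) / h\<^sup>2 \<le> \<mu> * ps k" for k
  proof -
    have "ps (Suc k) + pm k - 2 * ps k = - (a / \<mu>) * (q ^ k * (1 - q)\<^sup>2)"
      unfolding ps_def pm_def by (simp add: power2_eq_square algebra_simps)
    also have "\<dots> \<le> - (a / \<mu>) * (q ^ k * (\<mu> * h\<^sup>2 * q))"
    proof -
      have "(a / \<mu>) * (q ^ k * (\<mu> * h\<^sup>2 * q)) \<le> (a / \<mu>) * (q ^ k * (1 - q)\<^sup>2)"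
        using q assms by (intro mult_left_mono q2) auto
      then show ?thesis by simp
    qed
    also have "\<dots> = - (a * q ^ (k + 1)) * h\<^sup>2" using assms by simp
    finally have "(ps (Suc k) + pm k - 2 * ps k) / h\<^sup>2 \<le> - (a * q ^ (k + 1))"
      using assms by (simp add: field_simps)
    moreover have "\<mu> * ps k = b * ((2 * real k + 1) * h) + a - a * q ^ (k + 1)"
      unfolding ps_def using assms by (simp add: field_simps)
    ultimately show ?thesis by simp
  qed
  define Ph where "Ph x k = w (x + (real (k + 1) * h) *\<^sub>R e) - w (x - (real k * h) *\<^sub>R e)" for x and k :: nat
  define F where "F p = Ph (fst p) (snd p) - ps (snd p)" for p
  have "F (x, 0) \<le> 0"
  proof (rule nonpos_if_contracting[where \<mu> = \<mu> and c = "2 * n / h\<^sup>2" and B = "2 * B"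
        and F = F and p = "(x, 0)"])
    show "\<mu> > 0" "0 \<le> 2 * n / h\<^sup>2" using assms by (auto simp: n_def)
    show "F p \<le> 2 * B" for p
    proof -
      have "F p \<le> Ph (fst p) (snd p)" using ps0[of "snd p"] by (simp add: F_def)
      also have "\<dots> \<le> 2 * B" unfolding Ph_def
        using B[of "fst p + (real (snd p + 1) * h) *\<^sub>R e"] B[of "fst p - (real (snd p) * h) *\<^sub>R e"] by linarith
      finally show ?thesis .
    qed
    fix S and p :: "(real^'d) \<times> nat"
    assume S: "S \<ge> 0" "\<And>q. F q \<le> S" and Fp: "F p > 0"
    obtain x k where p: "p = (x, k)" by (cases p)
    have PhS: "Ph y l \<le> S + ps l" for y l using S(2)[of "(y, l)"] by (simp add: F_def)
    define X where "X = x + (real (k + 1) * h) *\<^sub>R e"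
    define Y where "Y = x - (real k * h) *\<^sub>R e"
    have lap: "(\<Sum>j\<in>UNIV. (w (X + h *\<^sub>R axis j 1) + w (X - h *\<^sub>R axis j 1)) -
          (w (Y + h *\<^sub>R axis j 1) + w (Y - h *\<^sub>R axis j 1)))
        \<le> 2 * n * S + 2 * n * ps k + (ps (Suc k) + pm k - 2 * ps k)"
    proof -
      have oth: "(w (X + h *\<^sub>R axis j 1) + w (X - h *\<^sub>R axis j 1)) -
          (w (Y + h *\<^sub>R axis j 1) + w (Y - h *\<^sub>R axis j 1)) \<le> 2 * (S + ps k)" for j
        using PhS[of "x + h *\<^sub>R axis j 1" k] PhS[of "x - h *\<^sub>R axis j 1" k]
        unfolding Ph_def X_def Y_def by (simp add: algebra_simps)
      \<comment> \<open>In direction \<open>i\<close> the neighbours are paired crosswise: moving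
        both points outward raises \<open>k\<close> by one, moving them inward lowers it by one. In
        the other directions both points move in parallel and \<open>k\<close> is unchanged.\<close>
      have same: "(w (X + h *\<^sub>R axis i 1) + w (X - h *\<^sub>R axis i 1)) -
          (w (Y + h *\<^sub>R axis i 1) + w (Y - h *\<^sub>R axis i 1)) \<le> 2 * S + ps (Suc k) + pm k"
      proof -
        have "real (Suc k + 1) * h = real (k + 1) * h + h" "real (Suc k) * h = real k * h + h"
          by (simp_all add: algebra_simps)
        then have "w (X + h *\<^sub>R e) - w (Y - h *\<^sub>R e) = Ph x (Suc k)"
          unfolding Ph_def X_def Y_def by (simp only: scaleR_left_distrib add.assoc diff_diff_eq)
        then have 1: "w (X + h *\<^sub>R e) - w (Y - h *\<^sub>R e) \<le> S + ps (Suc k)" using PhS by metis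
        have 2: "w (X - h *\<^sub>R e) - w (Y + h *\<^sub>R e) \<le> S + pm k"
        proof (cases k)
          \<comment> \<open>For \<open>k = 0\<close> moving inward exchanges the two points, which
            only changes the sign of the increment; positivity of \<open>F p\<close> and
            \<open>ps 0 \<ge> - pm 0\<close> give the bound.\<close>
          case 0
          have "w (X - h *\<^sub>R e) - w (Y + h *\<^sub>R e) = - Ph x 0"
            unfolding Ph_def X_def Y_def 0 by simp
          moreover have "Ph x 0 > ps 0" using Fp p 0 by (simp add: F_def)
          moreover have "ps 0 \<ge> - pm 0"
            unfolding ps_def pm_def using assms q by simp
          ultimately show ?thesis using S 0 by simp
        next
          case (Suc l)
          have "real (Suc l + 1) * h = real (l + 1) * h + h" "real (Suc l) * h = real l * h + h"
            by (simp_all add: algebra_simps)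
          then have "X - h *\<^sub>R e = x + (real (l + 1) * h) *\<^sub>R e" "Y + h *\<^sub>R e = x - (real l * h) *\<^sub>R e"
            unfolding X_def Y_def Suc by (simp_all only: scaleR_left_distrib) simp_all
          then have "w (X - h *\<^sub>R e) - w (Y + h *\<^sub>R e) = Ph x l"
            unfolding Ph_def by simp
          then show ?thesis using PhS[of x l] pm_Suc[of l] Suc by simp
        qed
        show ?thesis using 1 2 by (simp add: e_def)
      qed
      define T where "T j = (w (X + h *\<^sub>R axis j 1) + w (X - h *\<^sub>R axis j 1)) -
          (w (Y + h *\<^sub>R axis j 1) + w (Y - h *\<^sub>R axis j 1))" for j
      have "sum T UNIV = T i + sum T (UNIV - {i})" by (simp add: sum.remove)
      also have "\<dots> \<le> (2 * S + ps (Suc k) + pm k) + (\<Sum>j\<in>UNIV - {i}. 2 * (S + ps k))"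
        using same oth unfolding T_def by (intro add_mono sum_mono) auto
      also have "(\<Sum>j\<in>UNIV - {i}. 2 * (S + ps k)) = (n - 1) * (2 * (S + ps k))"
        by (simp add: n_def card_Diff_singleton of_nat_diff Suc_leI)
      finally show ?thesis unfolding T_def by (simp add: algebra_simps)
    qed
    have gXY: "g X - g Y \<le> a + b * ((2 * real k + 1) * h)"
    proof -
      have "X = Y + (real (2 * k + 1) * h) *\<^sub>R axis i 1"
      proof -
        have "real (2 * k + 1) * h = real (k + 1) * h + real k * h" by (simp add: algebra_simps)
        then show ?thesis unfolding X_def Y_def e_def by (simp only: scaleR_left_distrib) simp
      qed
      then show ?thesis using g[of Y "2 * k + 1"] by (simp add: abs_le_iff add.commute)
    qed
    have "(\<mu> + 2 * n / h\<^sup>2) * Ph x k = (\<mu> + 2 * n / h\<^sup>2) * w X - (\<mu> + 2 * n / h\<^sup>2) * w Y"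
      unfolding Ph_def X_def Y_def by (simp add: right_diff_distrib)
    also have "\<dots> = g X - g Y + (\<Sum>j\<in>UNIV. (w (X + h *\<^sub>R axis j 1) + w (X - h *\<^sub>R axis j 1)) -
          (w (Y + h *\<^sub>R axis j 1) + w (Y - h *\<^sub>R axis j 1))) / h\<^sup>2"
      using dsol_mean_value[OF w, of X] dsol_mean_value[OF w, of Y]
      unfolding n_def sum_subtractf by (simp add: diff_divide_distrib)
    also have "\<dots> \<le> a + b * ((2 * real k + 1) * h) + 
        (2 * n * S + 2 * n * ps k + (ps (Suc k) + pm k - 2 * ps k)) / h\<^sup>2"
      by (intro add_mono gXY divide_right_mono lap) simp
    also have "\<dots> \<le> \<mu> * ps k + 2 * n / h\<^sup>2 * ps k + 2 * n / h\<^sup>2 * S"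
      using barrier[of k] by (simp add: add_divide_distrib)
    finally have "(\<mu> + 2 * n / h\<^sup>2) * (Ph x k - ps k) \<le> 2 * n / h\<^sup>2 * S"
      unfolding right_diff_distrib distrib_right by linarith
    then show "(\<mu> + 2 * n / h\<^sup>2) * F p \<le> 2 * n / h\<^sup>2 * S" by (simp add: F_def p)
  qed
  then have "w (x + h *\<^sub>R axis i 1) - w x \<le> ps 0"
    by (simp add: F_def Ph_def e_def)
  also have "ps 0 \<le> h * (2 * a / sqrt \<mu> + b / \<mu>)"
  proof -
    have "(a / \<mu>) * (1 - q) \<le> h * (2 * a / sqrt \<mu>)"
    proof -
      \<comment> \<open>For \<open>c > 1\<close> this is trivial since \<open>q > 0\<close>;
        otherwise it follows from \<open>t \<le> 2 * c\<close>. Here the factor 2 in front of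
        \<open>a / sqrt \<mu>\<close> originates.\<close>
      have "1 - q \<le> 2 * c"
      proof (cases "c \<le> 1")
        case True
        have "1 - q = t * q" by (rule q)
        also have "\<dots> \<le> t * 1" using q t by (intro mult_left_mono) auto
        also have "\<dots> \<le> 2 * c" using True c(1) unfolding t_def
          by (simp add: power2_eq_square mult_left_le_one_le)
        finally show ?thesis .
      qed (use q in simp)
      then have "(a / \<mu>) * (1 - q) \<le> (a / \<mu>) * (2 * c)" using assms by (intro mult_left_mono) auto
      also have "\<dots> = h * (2 * a / sqrt \<mu>)"
        using assms unfolding c_def by (simp add: field_simps)
      finally show ?thesis .
    qed
    then show ?thesis unfolding ps_def using assms by (simp add: algebra_simps)
  qed
  finally show ?thesis .
qed

lemma dsol_gradient:
  fixes w :: "real^'d::finite \<Rightarrow> real"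
  assumes w: "dsol h \<mu> w g" and "\<mu> > 0" "h > 0" "a \<ge> 0" "b \<ge> 0"
    and g: "\<And>x m. \<bar>g (x + (real m * h) *\<^sub>R axis i 1) - g x\<bar> \<le> a + b * (real m * h)"
  shows "\<bar>fdq h i w x\<bar> \<le> 2 * a / sqrt \<mu> + b / \<mu>"
proof -
  have "dsol h \<mu> (\<lambda>x. - w x) (\<lambda>x. - g x)" using dsol_lincomb[OF w w, of "-1" 0] by simp
  from dsol_gradient_upper[OF this, of a b i x] dsol_gradient_upper[OF w, of a b i x]
  have "\<bar>w (x + h *\<^sub>R axis i 1) - w x\<bar> \<le> h * (2 * a / sqrt \<mu> + b / \<mu>)"
    using assms by (simp add: abs_minus_commute abs_le_iff)
  then show ?thesis using \<open>h > 0\<close> unfolding fdq_def abs_divide by (simp add: pos_divide_le_eq mult.commute)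
qed

text \<open>The difference equation couples only the points of one translated lattice, and the
  gradient estimate asks for increments along a single axis; nothing more is required of the
  data.\<close>

definition lhol :: "real \<Rightarrow> 'd::finite \<Rightarrow> real \<Rightarrow> real \<Rightarrow> (real^'d \<Rightarrow> real) \<Rightarrow> bool" where
  "lhol h i \<alpha> C g \<longleftrightarrow> (\<forall>x m. \<bar>g (x + (real m * h) *\<^sub>R axis i 1) - g x\<bar> \<le> C * (real m * h) powr \<alpha>)"

lemma dsol_gradient_bounded:
  fixes w :: "real^'d::finite \<Rightarrow> real"
  assumes w: "dsol h \<mu> w g" and "\<mu> > 0" "h > 0" and g: "\<And>x. \<bar>g x\<bar> \<le> M"
  shows "\<bar>fdq h i w x\<bar> \<le> 4 * M / sqrt \<mu>"
proof -
  have "M \<ge> 0" using g[of x] by linarith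
  moreover have "\<bar>g y - g z\<bar> \<le> 2 * M" for y z using g[of y] g[of z] by linarith
  ultimately show ?thesis using dsol_gradient[OF w, of "2 * M" 0 i x] assms by simp
qed

section \<open>Hoelder continuous data: gradients and second differences of discrete
  solutions\<close>

lemma powr_le_affine:
  fixes t T :: real
  assumes "t \<ge> 0" "T > 0" "0 < \<alpha>" "\<alpha> \<le> 1"
  shows "t powr \<alpha> \<le> T powr \<alpha> + T powr (\<alpha> - 1) * t"
proof (cases "t \<le> T")
  case True
  then have "t powr \<alpha> \<le> T powr \<alpha>" using assms by (intro powr_mono2) auto
  then show ?thesis using assms by (simp add: add_increasing2)
next
  case False
  then have "t powr \<alpha> = t powr (\<alpha> - 1) * t" using assms by (simp add: powr_diff)
  also have "\<dots> \<le> T powr (\<alpha> - 1) * t" using False assms by (intro mult_right_mono powr_mono2') auto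
  finally show ?thesis by (simp add: add_increasing)
qed

lemma dsol_gradient_lhol:
  fixes w :: "real^'d::finite \<Rightarrow> real"
  assumes w: "dsol h \<mu> w g" and "\<mu> > 0" "h > 0" "0 < \<alpha>" "\<alpha> \<le> 1" "C \<ge> 0" and g: "lhol h i \<alpha> C g"
  shows "\<bar>fdq h i w x\<bar> \<le> 3 * C * \<mu> powr (- (1 + \<alpha>) / 2)"
proof -
  \<comment> \<open>\<open>T\<close> is the length scale of the resolvent. At this \<open>T\<close>
    the affine majorant of the Hoelder modulus contributes the same power of \<open>\<mu>\<close>
    through \<open>a\<close> and through \<open>b\<close>, with weights 2 and 1.\<close>
  define T where "T = \<mu> powr (- 1/2)"
  have T: "T > 0" using assms by (simp add: T_def)
  have "\<bar>g (x + (real m * h) *\<^sub>R axis i 1) - g x\<bar> \<le> C * T powr \<alpha> + C * T powr (\<alpha> - 1) * (real m * h)" for x m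
  proof -
    have "\<bar>g (x + (real m * h) *\<^sub>R axis i 1) - g x\<bar> \<le> C * (real m * h) powr \<alpha>" using g by (simp add: lhol_def)
    also have "\<dots> \<le> C * (T powr \<alpha> + T powr (\<alpha> - 1) * (real m * h))"
      using assms T by (intro mult_left_mono powr_le_affine) auto
    finally show ?thesis by (simp add: algebra_simps)
  qed
  from dsol_gradient[OF w _ _ _ _ this, of x] have
    "\<bar>fdq h i w x\<bar> \<le> 2 * (C * T powr \<alpha>) / sqrt \<mu> + C * T powr (\<alpha> - 1) / \<mu>"
    using assms by simp
  also have "\<dots> = 2 * C * (T powr \<alpha> / sqrt \<mu>) + C * (T powr (\<alpha> - 1) / \<mu>)" by simp
  also have "T powr \<alpha> / sqrt \<mu> = \<mu> powr (- (1 + \<alpha>) / 2)"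
  proof -
    have "T powr \<alpha> / sqrt \<mu> = \<mu> powr (- 1/2 * \<alpha>) / \<mu> powr (1/2)"
      using assms unfolding T_def by (simp add: powr_powr powr_half_sqrt)
    also have "\<dots> = \<mu> powr (- 1/2 * \<alpha> - 1/2)" by (simp only: powr_diff[symmetric])
    also have "- 1/2 * \<alpha> - 1/2 = - (1 + \<alpha>) / 2" by (simp add: field_simps)
    finally show ?thesis .
  qed
  also have "T powr (\<alpha> - 1) / \<mu> = \<mu> powr (- (1 + \<alpha>) / 2)"
  proof -
    have "T powr (\<alpha> - 1) / \<mu> = \<mu> powr (- 1/2 * (\<alpha> - 1)) / \<mu> powr 1"
      using assms unfolding T_def by (simp add: powr_powr)
    also have "\<dots> = \<mu> powr (- 1/2 * (\<alpha> - 1) - 1)" by (simp only: powr_diff[symmetric])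
    also have "- 1/2 * (\<alpha> - 1) - 1 = - (1 + \<alpha>) / 2" by (simp add: field_simps)
    finally show ?thesis .
  qed
  finally show ?thesis by (simp add: algebra_simps)
qed

lemma fdq_diff: "fdq h i (\<lambda>x. w x - v x) x = fdq h i w x - fdq h i v x"
  by (simp add: fdq_def diff_divide_distrib)

lemma fdq_fdq_diff:
  "fdq h i (fdq h j (\<lambda>x. w x - v x)) x = fdq h i (fdq h j w) x - fdq h i (fdq h j v) x"
  by (simp add: fdq_def diff_divide_distrib)

lemma fdq_cmult: "fdq h i (\<lambda>x. c * w x) x = c * fdq h i w x"
  by (simp add: fdq_def algebra_simps)

lemma fdq_abs_le:
  assumes "h > 0" "\<And>x. \<bar>w x\<bar> \<le> M"
  shows "\<bar>fdq h i w x\<bar> \<le> 2 * M / h"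
proof -
  have "\<bar>w (x + h *\<^sub>R axis i 1) - w x\<bar> \<le> 2 * M"
    using assms(2)[of x] assms(2)[of "x + h *\<^sub>R axis i 1"] by linarith
  then show ?thesis using assms(1) unfolding fdq_def abs_divide by (simp add: divide_right_mono)
qed

text \<open>Counting powers: \<open>3 * \<mu>\<close> from the change of parameter,
  \<mu>^(-(1+\<alpha>)/2) from the gradient of \<open>v\<close> with Hoelder data, \<mu>^(-1/2) from
  the gradient estimate with bounded data. The product is of order \<mu>^(-\<alpha>/2), which decays
  as the parameter grows, so that consecutive steps can be summed.\<close>

lemma dsol_second_difference_step:
  fixes w :: "real^'d::finite \<Rightarrow> real"
  assumes w: "dsol h \<mu> w \<xi>" and v: "dsol h (4 * \<mu>) v \<xi>"
    and "\<mu> > 0" "h > 0" "0 < \<alpha>" "\<alpha> \<le> 1" "C \<ge> 0" and xi: "\<And>i. lhol h i \<alpha> C \<xi>"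
  shows "\<bar>fdq h i (fdq h j w) x - fdq h i (fdq h j v) x\<bar> \<le> 18 * C * \<mu> powr (- \<alpha> / 2)"
proof -
  have "dsol h \<mu> v (\<lambda>x. \<xi> x + (\<mu> - 4 * \<mu>) * v x)" by (rule dsol_change_param[OF v])
  from dsol_diff[OF w this] have "dsol h \<mu> (\<lambda>x. w x - v x) (\<lambda>x. 3 * \<mu> * v x)"
    by (simp add: algebra_simps)
  from dsol_fdq[OF this, of j] have d: "dsol h \<mu> (fdq h j (\<lambda>x. w x - v x)) (\<lambda>x. 3 * \<mu> * fdq h j v x)"
    by (simp add: fdq_cmult[abs_def])
  define P where "P = \<mu> powr (- (1 + \<alpha>) / 2)"
  have "(4 * \<mu>) powr (- (1 + \<alpha>) / 2) = 4 powr (- (1 + \<alpha>) / 2) * P"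
    unfolding P_def using assms by (simp add: powr_mult)
  also have "(4::real) powr (- (1 + \<alpha>) / 2) \<le> 4 powr (- 1/2)" using assms by (intro powr_mono) auto
  also have "(4::real) powr (- 1/2) = 1/2" by (simp add: powr_minus powr_half_sqrt)
  finally have P4: "(4 * \<mu>) powr (- (1 + \<alpha>) / 2) \<le> P / 2"
    by (simp add: P_def mult_right_mono)
  have "\<bar>3 * \<mu> * fdq h j v x\<bar> \<le> 3 * \<mu> * (3 * C * (P / 2))" for x
  proof -
    have "\<bar>fdq h j v x\<bar> \<le> 3 * C * (4 * \<mu>) powr (- (1 + \<alpha>) / 2)"
      by (rule dsol_gradient_lhol[OF v]) (use assms in auto)
    also have "\<dots> \<le> 3 * C * (P / 2)" using P4 assms by (intro mult_left_mono) auto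
    finally show ?thesis using assms by (simp add: abs_mult)
  qed
  from dsol_gradient_bounded[OF d \<open>\<mu> > 0\<close> \<open>h > 0\<close> this, of i x]
  have "\<bar>fdq h i (fdq h j (\<lambda>x. w x - v x)) x\<bar> \<le> 4 * (3 * \<mu> * (3 * C * (P / 2))) / sqrt \<mu>" .
  also have "\<dots> = 18 * C * (P * \<mu> / sqrt \<mu>)" by simp
  also have "P * \<mu> / sqrt \<mu> = \<mu> powr (- \<alpha> / 2)"
  proof -
    have "P * \<mu> / sqrt \<mu> = \<mu> powr (- (1 + \<alpha>) / 2) * \<mu> powr 1 / \<mu> powr (1/2)"
      using assms by (simp add: P_def powr_half_sqrt)
    also have "\<dots> = \<mu> powr (- (1 + \<alpha>) / 2 + 1 - 1/2)" by (simp only: powr_diff powr_add)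
    also have "- (1 + \<alpha>) / 2 + 1 - 1/2 = - \<alpha> / 2" by (simp add: field_simps)
    finally show ?thesis .
  qed
  finally show ?thesis unfolding fdq_fdq_diff .
qed

text \<open>One telescoping step costs 18. The parameter is multiplied by 4 each time, which gives a
  geometric series of ratio 4^(-\<alpha>/2) = 2^(-\<alpha>).\<close>

definition schauder_const :: "real \<Rightarrow> real" where
  "schauder_const \<alpha> = 18 / (1 - 2 powr (- \<alpha>))"

lemma schauder_const_pos: "\<alpha> > 0 \<Longrightarrow> schauder_const \<alpha> > 0"
  using powr_less_mono[of "-\<alpha>" 0 2] by (simp add: schauder_const_def)

text \<open>
  Telescoping along $\mu, 4\mu, 16\mu, \dots$: by the resolvent identity the difference of two consecutive
  solutions solves the equation with right-hand side $3 \cdot 4^n \mu$ times the second one, so that two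
  gradient estimates suffice and the contributions decay geometrically.
\<close>

lemma dsol_second_difference_bound:
  fixes w :: "real^'d::finite \<Rightarrow> real"
  assumes w: "dsol h \<mu> w \<xi>" and "\<mu> > 0" "h > 0" "0 < \<alpha>" "\<alpha> \<le> 1" "C \<ge> 0"
    and xi: "\<And>i. lhol h i \<alpha> C \<xi>" and xc: "continuous_on UNIV \<xi>" and xb: "bounded (range \<xi>)"
  shows "\<bar>fdq h i (fdq h j w) x\<bar> \<le> schauder_const \<alpha> * C * \<mu> powr (- \<alpha> / 2)"
proof -
  obtain G where G: "\<And>x. \<bar>\<xi> x\<bar> \<le> G" using xb bounded_range_realE by blast
  define Q where "Q = 18 * C * \<mu> powr (- \<alpha> / 2)"
  define q where "q = (2::real) powr (- \<alpha>)"
  have q: "0 < q" "q < 1" unfolding q_def using assms powr_less_mono[of "-\<alpha>" 0 2] by auto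
  have Q: "Q \<ge> 0" using assms by (simp add: Q_def)
  have "\<exists>v. dsol h (4 ^ n * \<mu>) v \<xi> \<and>
      \<bar>fdq h i (fdq h j w) x\<bar> \<le> \<bar>fdq h i (fdq h j v) x\<bar> + Q * (\<Sum>k<n. q ^ k)" for n
  proof (induction n)
    case 0
    then show ?case using w by auto
  next
    case (Suc n)
    then obtain v where v: "dsol h (4 ^ n * \<mu>) v \<xi>"
      "\<bar>fdq h i (fdq h j w) x\<bar> \<le> \<bar>fdq h i (fdq h j v) x\<bar> + Q * (\<Sum>k<n. q ^ k)" by blast
    obtain v' where v': "dsol h (4 * (4 ^ n * \<mu>)) v' \<xi>"
      using dsol_exists[of "4 * (4 ^ n * \<mu>)" h \<xi>] assms by auto
    have "\<bar>fdq h i (fdq h j v) x - fdq h i (fdq h j v') x\<bar> \<le> 18 * C * (4 ^ n * \<mu>) powr (- \<alpha> / 2)"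
      by (rule dsol_second_difference_step[OF v(1) v']) (use assms in auto)
    also have "(4 ^ n * \<mu>) powr (- \<alpha> / 2) = q ^ n * \<mu> powr (- \<alpha> / 2)"
    proof -
      have "(4 ^ n * \<mu>) powr (- \<alpha> / 2) = (4 ^ n) powr (- \<alpha> / 2) * \<mu> powr (- \<alpha> / 2)"
        using assms by (simp add: powr_mult)
      also have "((4::real) ^ n) powr (- \<alpha> / 2) = ((2::real) powr (2 * real n)) powr (- \<alpha> / 2)"
      proof -
        have "(4::real) ^ n = (2\<^sup>2) ^ n" by simp
        also have "\<dots> = 2 ^ (2 * n)" by (simp only: power_mult)
        also have "\<dots> = 2 powr real (2 * n)" by (rule powr_realpow[symmetric]) simp
        finally show ?thesis by simp
      qed
      also have "\<dots> = q ^ n" unfolding q_def powr_powr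
        by (simp add: powr_realpow[symmetric] powr_powr algebra_simps)
      finally show ?thesis .
    qed
    finally have "\<bar>fdq h i (fdq h j v) x - fdq h i (fdq h j v') x\<bar> \<le> Q * q ^ n"
      by (simp add: Q_def algebra_simps)
    then have "\<bar>fdq h i (fdq h j w) x\<bar> \<le> \<bar>fdq h i (fdq h j v') x\<bar> + Q * (\<Sum>k<Suc n. q ^ k)"
      using v(2) by (simp add: distrib_left)
    then show ?case using v' by (auto simp: mult.assoc)
  qed
  then have bd: "\<bar>fdq h i (fdq h j w) x\<bar> \<le> (4 * G / (\<mu> * h\<^sup>2)) * (1/4) ^ n + Q / (1 - q)" for n
  proof -
    obtain v where v: "dsol h (4 ^ n * \<mu>) v \<xi>"
      "\<bar>fdq h i (fdq h j w) x\<bar> \<le> \<bar>fdq h i (fdq h j v) x\<bar> + Q * (\<Sum>k<n. q ^ k)"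
      using \<open>\<And>n. \<exists>v. _ n v\<close> by blast
    \<comment> \<open>The remainder after \<open>n\<close> steps: differencing twice costs
      \<open>4 / h\<^sup>2\<close>, which is harmless because \<open>h\<close> is fixed while the
      parameter \<open>4 ^ n * \<mu>\<close> in the denominator grows.\<close>
    have "\<bar>v y\<bar> \<le> G / (4 ^ n * \<mu>)" for y
      by (rule dsol_abs_le[OF v(1)]) (use assms G in auto)
    from fdq_abs_le[OF \<open>h > 0\<close> fdq_abs_le[OF \<open>h > 0\<close> this]]
    have "\<bar>fdq h i (fdq h j v) x\<bar> \<le> 2 * (2 * (G / (4 ^ n * \<mu>)) / h) / h" .
    also have "\<dots> = (4 * G / (\<mu> * h\<^sup>2)) * (1/4) ^ n"
      by (simp add: power2_eq_square power_divide)
    finally have 1: "\<bar>fdq h i (fdq h j v) x\<bar> \<le> (4 * G / (\<mu> * h\<^sup>2)) * (1/4) ^ n" .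
    have "(\<Sum>k<n. q ^ k) \<le> 1 / (1 - q)"
      using q by (simp add: sum_gp_strict divide_right_mono)
    then have "Q * (\<Sum>k<n. q ^ k) \<le> Q / (1 - q)" using Q mult_left_mono by fastforce
    then show ?thesis using 1 v(2) by linarith
  qed
  have "(\<lambda>n. (4 * G / (\<mu> * h\<^sup>2)) * (1/4) ^ n + Q / (1 - q)) \<longlonglongrightarrow> (4 * G / (\<mu> * h\<^sup>2)) * 0 + Q / (1 - q)"
    by (intro tendsto_intros LIMSEQ_power_zero) auto
  then have "\<bar>fdq h i (fdq h j w) x\<bar> \<le> Q / (1 - q)"
    using LIMSEQ_le_const[of _ "Q / (1 - q)"] bd by auto
  then show ?thesis by (simp add: Q_def schauder_const_def q_def)
qed

lemma fdq_lattice_increment: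
  assumes "h > 0" "\<And>x. \<bar>fdq h k U x\<bar> \<le> B"
  shows "\<bar>U (x + (real m * h) *\<^sub>R axis k 1) - U x\<bar> \<le> real m * h * B"
proof (induction m)
  case 0
  then show ?case by simp
next
  case (Suc m)
  define y where "y = x + (real m * h) *\<^sub>R axis k 1"
  have "\<bar>U (y + h *\<^sub>R axis k 1) - U y\<bar> \<le> h * B"
    using assms(2)[of y] assms(1) unfolding fdq_def abs_divide by (simp add: pos_divide_le_eq mult.commute)
  moreover have "x + (real (Suc m) * h) *\<^sub>R axis k 1 = y + h *\<^sub>R axis k 1"
    by (simp add: y_def algebra_simps)
  ultimately show ?case using Suc by (simp add: y_def algebra_simps)
qed

text \<open>
  For an increment $r$ compare with the solution for the parameter $\nu = (N r)^{-2}$: its second differences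
  are of size $(N r)^\alpha$, and the difference of both solutions has a gradient controlled by the
  unknown Hoelder constant $H$ itself, with the small factor $N^{\alpha - 1}$. Iterating removes $H$.
\<close>

lemma dsol_second_difference_lhol_improve:
  fixes w :: "real^'d::finite \<Rightarrow> real"
  assumes w: "dsol h \<mu> w \<xi>" and "\<mu> > 0" "h > 0" "0 < \<alpha>" "\<alpha> \<le> 1" "C \<ge> 0"
    and xi: "\<And>i. lhol h i \<alpha> C \<xi>" and xc: "continuous_on UNIV \<xi>" and xb: "bounded (range \<xi>)"
    and N: "N > 0" "3 * N powr (\<alpha> - 1) \<le> 1/2"
    and H: "H \<ge> 0" "lhol h k \<alpha> H (fdq h i (fdq h j w))"
  shows "lhol h k \<alpha> (2 * schauder_const \<alpha> * C * N powr \<alpha> + H / 2) (fdq h i (fdq h j w))"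
  unfolding lhol_def
proof safe
  fix x :: "real^'d" and m :: nat
  define W where "W = fdq h i (fdq h j w)"
  define K where "K = schauder_const \<alpha> * C"
  have K: "K \<ge> 0" using assms schauder_const_pos[of \<alpha>] by (simp add: K_def)
  define r where "r = real m * h"
  have "\<bar>W (x + r *\<^sub>R axis k 1) - W x\<bar> \<le> (2 * K * N powr \<alpha> + H / 2) * r powr \<alpha>"
  proof (cases "m = 0")
    case True
    then show ?thesis by (simp add: r_def)
  next
    case False
    then have r: "r > 0" using assms by (simp add: r_def)
    define \<nu> where "\<nu> = (N * r) powr (- 2)"
    have nu: "\<nu> > 0" using r N by (simp add: \<nu>_def)
    have nua: "\<nu> powr (- \<alpha> / 2) = N powr \<alpha> * r powr \<alpha>"
      using r N unfolding \<nu>_def by (simp add: powr_powr powr_mult)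
    show ?thesis
    \<comment> \<open>If \<open>\<nu> \<le> \<mu>\<close>, then \<open>N * r\<close> is at least the
      length scale \<mu>^(-1/2) of \<open>w\<close>, and the supremum bound on \<open>W\<close> at
      both endpoints suffices without a comparison function.\<close>
    proof (cases "\<nu> \<le> \<mu>")
      case True
      have "\<bar>W y\<bar> \<le> K * \<nu> powr (- \<alpha> / 2)" for y
      proof -
        have "\<bar>W y\<bar> \<le> K * \<mu> powr (- \<alpha> / 2)"
          unfolding W_def K_def by (rule dsol_second_difference_bound[OF w]) (use assms in auto)
        also have "\<dots> \<le> K * \<nu> powr (- \<alpha> / 2)"
          using True nu assms K by (intro mult_left_mono powr_mono2') auto
        finally show ?thesis .
      qed
      from this[of x] this[of "x + r *\<^sub>R axis k 1"]
      have "\<bar>W (x + r *\<^sub>R axis k 1) - W x\<bar> \<le> 2 * K * N powr \<alpha> * r powr \<alpha>"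
        unfolding nua by (simp add: algebra_simps)
      then show ?thesis using H by (simp add: distrib_right add_increasing2)
    next
      case False
      obtain v where v: "dsol h \<nu> v \<xi>" using dsol_exists[of \<nu> h \<xi>] assms nu by auto
      define V where "V = fdq h i (fdq h j v)"
      have Vb: "\<bar>V y\<bar> \<le> K * (N powr \<alpha> * r powr \<alpha>)" for y
        unfolding V_def K_def nua[symmetric]
        by (rule dsol_second_difference_bound[OF v]) (use assms nu in auto)
      define U where "U = (\<lambda>x. W x - V x)"
      have "dsol h \<nu> w (\<lambda>x. \<xi> x + (\<nu> - \<mu>) * w x)" by (rule dsol_change_param[OF w])
      from dsol_diff[OF this v] have "dsol h \<nu> (\<lambda>x. w x - v x) (\<lambda>x. (\<nu> - \<mu>) * w x)" by simp
      from dsol_fdq[OF dsol_fdq[OF this, of j], of i]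
      have U: "dsol h \<nu> U (\<lambda>x. (\<nu> - \<mu>) * W x)"
        by (simp add: U_def W_def V_def fdq_cmult[abs_def] fdq_fdq_diff[abs_def])
      have "lhol h k \<alpha> (\<nu> * H) (\<lambda>x. (\<nu> - \<mu>) * W x)"
        unfolding lhol_def
      proof safe
        fix x m
        have "\<bar>(\<nu> - \<mu>) * W (x + (real m * h) *\<^sub>R axis k 1) - (\<nu> - \<mu>) * W x\<bar> =
            (\<nu> - \<mu>) * \<bar>W (x + (real m * h) *\<^sub>R axis k 1) - W x\<bar>"
          using False by (simp add: right_diff_distrib[symmetric] abs_mult)
        also have "\<dots> \<le> \<nu> * (H * (real m * h) powr \<alpha>)"
          using False H assms unfolding lhol_def W_def[symmetric] by (intro mult_mono) auto
        finally show "\<bar>(\<nu> - \<mu>) * W (x + (real m * h) *\<^sub>R axis k 1) - (\<nu> - \<mu>) * W x\<bar> \<le> \<nu> * H * (real m * h) powr \<alpha>"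
          by simp
      qed
      then have "\<bar>fdq h k U y\<bar> \<le> 3 * (\<nu> * H) * \<nu> powr (- (1 + \<alpha>) / 2)" for y
        by (intro dsol_gradient_lhol[OF U]) (use assms nu in auto)
      from fdq_lattice_increment[OF \<open>h > 0\<close> this, of x m]
      have "\<bar>U (x + r *\<^sub>R axis k 1) - U x\<bar> \<le> r * (3 * (\<nu> * H) * \<nu> powr (- (1 + \<alpha>) / 2))"
        by (simp add: r_def)
      also have "\<dots> = 3 * H * (r * (\<nu> * \<nu> powr (- (1 + \<alpha>) / 2)))" by simp
      \<comment> \<open>The source term contributes \<open>\<nu>\<close> and the gradient estimate a
        negative power of it; together they give (N r)^(\<alpha>-1). The length \<open>r\<close> of
        the path restores \<open>r powr \<alpha>\<close> and leaves N^(\<alpha>-1), which is small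
        for large \<open>N\<close>.\<close>
      also have "\<nu> * \<nu> powr (- (1 + \<alpha>) / 2) = N powr (\<alpha> - 1) * r powr (\<alpha> - 1)"
      proof -
        have "\<nu> * \<nu> powr (- (1 + \<alpha>) / 2) = \<nu> powr (1 + - (1 + \<alpha>) / 2)"
          unfolding powr_add using nu by simp
        also have "\<dots> = (N * r) powr (\<alpha> - 1)"
        proof -
          have "- 2 * (1 + - (1 + \<alpha>) / 2) = \<alpha> - 1" by (simp add: field_simps)
          then show ?thesis unfolding \<nu>_def powr_powr by simp
        qed
        finally show ?thesis using r N by (simp add: powr_mult)
      qed
      also have "r * (N powr (\<alpha> - 1) * r powr (\<alpha> - 1)) = N powr (\<alpha> - 1) * r powr \<alpha>"
        using r by (simp add: powr_diff)
      also have "3 * H * (N powr (\<alpha> - 1) * r powr \<alpha>) = (3 * N powr (\<alpha> - 1)) * (H * r powr \<alpha>)" by simp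
      also have "\<dots> \<le> 1/2 * (H * r powr \<alpha>)" using N H by (intro mult_right_mono) auto
      finally have "\<bar>U (x + r *\<^sub>R axis k 1) - U x\<bar> \<le> H / 2 * r powr \<alpha>" by simp
      moreover have "\<bar>V (x + r *\<^sub>R axis k 1) - V x\<bar> \<le> 2 * K * N powr \<alpha> * r powr \<alpha>"
        using Vb[of x] Vb[of "x + r *\<^sub>R axis k 1"] by linarith
      moreover have "W (x + r *\<^sub>R axis k 1) - W x = (U (x + r *\<^sub>R axis k 1) - U x) + (V (x + r *\<^sub>R axis k 1) - V x)"
        by (simp add: U_def)
      ultimately show ?thesis unfolding distrib_right by linarith
    qed
  qed
  then show "\<bar>fdq h i (fdq h j w) (x + (real m * h) *\<^sub>R axis k 1) - fdq h i (fdq h j w) x\<bar>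
      \<le> (2 * schauder_const \<alpha> * C * N powr \<alpha> + H / 2) * (real m * h) powr \<alpha>"
    unfolding W_def K_def r_def by (simp add: algebra_simps)
qed

text \<open>At fixed \<open>h\<close> some Hoelder constant exists for trivial reasons:
  \<open>w\<close> inherits the increments of \<open>\<xi>\<close>, and differencing twice costs
  \<open>4 / h\<^sup>2\<close>. Replacing \<open>H\<close> by \<open>A + H / 2\<close> again and
  again forgets this mesh-dependent start and leaves \<open>2 * A\<close>.\<close>

lemma dsol_second_difference_lhol:
  fixes w :: "real^'d::finite \<Rightarrow> real"
  assumes w: "dsol h \<mu> w \<xi>" and "\<mu> > 0" "h > 0" "0 < \<alpha>" "\<alpha> \<le> 1" "C \<ge> 0"
    and xi: "\<And>i. lhol h i \<alpha> C \<xi>" and xc: "continuous_on UNIV \<xi>" and xb: "bounded (range \<xi>)"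
    and N: "N > 0" "3 * N powr (\<alpha> - 1) \<le> 1/2"
  shows "lhol h k \<alpha> (4 * schauder_const \<alpha> * C * N powr \<alpha>) (fdq h i (fdq h j w))"
proof -
  define W where "W = fdq h i (fdq h j w)"
  define A where "A = 2 * schauder_const \<alpha> * C * N powr \<alpha>"
  have A: "A \<ge> 0" using assms schauder_const_pos[of \<alpha>] by (simp add: A_def)
  define H where "H = 4 * C / (\<mu> * h\<^sup>2)"
  have H: "H \<ge> 0" using assms by (simp add: H_def)
  have "lhol h k \<alpha> (2 * A + H * (1/2) ^ n) W" for n
  proof (induction n)
    case 0
    have "\<bar>W (x + (real m * h) *\<^sub>R axis k 1) - W x\<bar> \<le> H * (real m * h) powr \<alpha>" for x m
    proof -
      define z where "z = (real m * h) *\<^sub>R (axis k 1 :: real^'d)"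
      have "\<bar>w (y + z) - w y\<bar> \<le> C * (real m * h) powr \<alpha> / \<mu>" for y
        by (rule dsol_modulus[OF w]) (use assms in \<open>auto simp: lhol_def z_def\<close>)
      then have "\<bar>fdq h j (\<lambda>y. w (y + z) - w y) y\<bar> \<le> 2 * (C * (real m * h) powr \<alpha> / \<mu>) / h" for y
        by (rule fdq_abs_le[OF \<open>h > 0\<close>])
      then have "\<bar>fdq h i (fdq h j (\<lambda>y. w (y + z) - w y)) x\<bar> \<le> 2 * (2 * (C * (real m * h) powr \<alpha> / \<mu>) / h) / h"
        by (rule fdq_abs_le[OF \<open>h > 0\<close>])
      then have "\<bar>fdq h i (fdq h j (\<lambda>y. w (y + z) - w y)) x\<bar> \<le> H * (real m * h) powr \<alpha>"
        by (simp add: H_def power2_eq_square)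
      moreover have "fdq h i (fdq h j (\<lambda>y. w (y + z) - w y)) x = W (x + z) - W x"
        unfolding fdq_fdq_diff W_def by (simp add: fdq_def add_ac)
      ultimately show ?thesis by (simp add: z_def)
    qed
    moreover have "H * (real m * h) powr \<alpha> \<le> (2 * A + H * (1/2) ^ 0) * (real m * h) powr \<alpha>" for m
      using A by (simp add: distrib_right)
    ultimately show ?case unfolding lhol_def using order_trans by blast
  next
    case (Suc n)
    have "lhol h k \<alpha> (2 * schauder_const \<alpha> * C * N powr \<alpha> + (2 * A + H * (1/2) ^ n) / 2) W"
      unfolding W_def by (rule dsol_second_difference_lhol_improve[OF w]) (use assms A H Suc W_def in auto)
    then show ?case by (simp add: A_def[symmetric] add_divide_distrib)
  qed
  then have "\<bar>W (x + (real m * h) *\<^sub>R axis k 1) - W x\<bar> \<le> (2 * A + H * (1/2) ^ n) * (real m * h) powr \<alpha>" for n x m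
    by (simp add: lhol_def)
  moreover have "(\<lambda>n. (2 * A + H * (1/2) ^ n) * (real m * h) powr \<alpha>) \<longlonglongrightarrow> (2 * A + H * 0) * (real m * h) powr \<alpha>" for m
    by (intro tendsto_intros LIMSEQ_power_zero) auto
  ultimately have "\<bar>W (x + (real m * h) *\<^sub>R axis k 1) - W x\<bar> \<le> (2 * A + H * 0) * (real m * h) powr \<alpha>" for x m
    using LIMSEQ_le_const by blast
  then show ?thesis unfolding lhol_def W_def[symmetric] by (simp add: A_def mult.assoc)
qed

section \<open>Compact perturbations of the identity\<close>

text \<open>A Banach space given as a carrier set with a norm function: C^{2,\<alpha>} depends on
  the real number \<alpha>, so it appears as a subset of a function space and not as a type of its
  own.\<close>

locale complete_norm_on =
  fixes V :: "'a::real_vector set" and N :: "'a \<Rightarrow> real"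
  assumes sub: "subspace V"
    and N_eq0: "x \<in> V \<Longrightarrow> N x = 0 \<Longrightarrow> x = 0"
    and N_scale: "x \<in> V \<Longrightarrow> N (c *\<^sub>R x) = \<bar>c\<bar> * N x"
    and N_triangle: "x \<in> V \<Longrightarrow> y \<in> V \<Longrightarrow> N (x + y) \<le> N x + N y"
    and N_complete: "(\<And>n. X n \<in> V) \<Longrightarrow> (\<And>e. e > 0 \<Longrightarrow> \<exists>M. \<forall>m\<ge>M. \<forall>n\<ge>M. N (X m - X n) < e)
        \<Longrightarrow> \<exists>l\<in>V. (\<lambda>n. N (X n - l)) \<longlonglongrightarrow> 0"
begin

lemma V_intros: "0 \<in> V" "x \<in> V \<Longrightarrow> y \<in> V \<Longrightarrow> x + y \<in> V" "x \<in> V \<Longrightarrow> y \<in> V \<Longrightarrow> x - y \<in> V"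
  "x \<in> V \<Longrightarrow> c *\<^sub>R x \<in> V" "x \<in> V \<Longrightarrow> - x \<in> V"
  using sub by (auto simp: subspace_0 subspace_add subspace_diff subspace_scale subspace_neg)

lemma N_zero: "N 0 = 0"
  using N_scale[OF V_intros(1), of 0] by simp

lemma N_minus: "x \<in> V \<Longrightarrow> N (- x) = N x"
  using N_scale[of x "-1"] by simp

lemma N_minus_commute: "x \<in> V \<Longrightarrow> y \<in> V \<Longrightarrow> N (x - y) = N (y - x)"
  using N_minus[of "x - y"] V_intros by simp

lemma N_nonneg: "x \<in> V \<Longrightarrow> N x \<ge> 0"
  using N_triangle[of x "- x"] N_minus[of x] N_zero V_intros by simp

lemma N_triangle_diff: "x \<in> V \<Longrightarrow> y \<in> V \<Longrightarrow> N (x - y) \<le> N x + N y"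
  using N_triangle[of x "- y"] N_minus[of y] V_intros by simp

lemma N_triangle_via: "x \<in> V \<Longrightarrow> y \<in> V \<Longrightarrow> z \<in> V \<Longrightarrow> N (x - z) \<le> N (x - y) + N (y - z)"
  using N_triangle[of "x - y" "y - z"] V_intros by simp


text \<open>Banach's theorem on the carrier. It will solve the linearized equations at base points
  near the solution.\<close>

lemma contraction_fixpoint:
  assumes F: "\<And>x. x \<in> V \<Longrightarrow> F x \<in> V" and "0 \<le> k" "k < 1"
    and con: "\<And>x y. x \<in> V \<Longrightarrow> y \<in> V \<Longrightarrow> N (F x - F y) \<le> k * N (x - y)"
  shows "\<exists>x\<in>V. F x = x"
proof -
  define X where "X n = (F ^^ n) 0" for n
  have XV: "X n \<in> V" for n by (induction n) (auto simp: X_def V_intros F)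
  have step: "N (X (Suc n) - X n) \<le> k ^ n * N (X 1 - X 0)" for n
  proof (induction n)
    case 0 then show ?case by simp
  next
    case (Suc n)
    have "N (X (Suc (Suc n)) - X (Suc n)) \<le> k * N (X (Suc n) - X n)"
      using con[OF XV[of "Suc n"] XV[of n]] by (simp add: X_def)
    also have "\<dots> \<le> k * (k ^ n * N (X 1 - X 0))" using Suc assms by (intro mult_left_mono) auto
    finally show ?case by simp
  qed
  define A where "A = N (X 1 - X 0)"
  have A: "A \<ge> 0" unfolding A_def by (rule N_nonneg[OF V_intros(3)[OF XV XV]])
  have far: "N (X (n + m) - X n) \<le> k ^ n * (A / (1 - k))" for n m
  proof -
    have "N (X (n + m) - X n) \<le> (\<Sum>j<m. k ^ (n + j) * A)"
    proof (induction m)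
      case 0 then show ?case by (simp add: N_zero)
    next
      case (Suc m)
      have "N (X (n + Suc m) - X n) \<le> N (X (Suc (n + m)) - X (n + m)) + N (X (n + m) - X n)"
        using N_triangle_via XV by simp
      then show ?case using Suc step[of "n + m"] by (simp add: A_def)
    qed
    also have "\<dots> = k ^ n * A * (\<Sum>j<m. k ^ j)"
      by (simp add: power_add sum_distrib_left algebra_simps)
    also have "\<dots> \<le> k ^ n * A * (1 / (1 - k))"
      using assms A by (intro mult_left_mono) (auto simp: sum_gp_strict divide_right_mono)
    finally show ?thesis by simp
  qed
  have "\<exists>M. \<forall>m\<ge>M. \<forall>n\<ge>M. N (X m - X n) < e" if "e > 0" for e
  proof -
    have "(\<lambda>n. k ^ n * (A / (1 - k))) \<longlonglongrightarrow> 0 * (A / (1 - k))"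
      using assms by (intro tendsto_intros LIMSEQ_power_zero) auto
    then have "\<forall>\<^sub>F n in sequentially. k ^ n * (A / (1 - k)) < e"
      using \<open>e > 0\<close> by (simp add: order_tendstoD(2))
    then obtain M where M: "\<And>n. n \<ge> M \<Longrightarrow> k ^ n * (A / (1 - k)) < e" by (auto simp: eventually_sequentially)
    have *: "N (X m - X n) < e" if "n \<ge> M" "m \<ge> n" for m n
      using far[of n "m - n"] M[of n] that by simp
    have "N (X m - X n) < e" if "n \<ge> M" "m \<ge> M" for m n
    proof (cases "m \<ge> n")
      case False
      then show ?thesis using *[of m n] that N_minus_commute[OF XV XV] by simp
    qed (use * that in auto)
    then show ?thesis by blast
  qed
  then obtain l where l: "l \<in> V" "(\<lambda>n. N (X n - l)) \<longlonglongrightarrow> 0" using N_complete[of X] XV by blast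
  have "N (F l - l) \<le> k * N (X n - l) + N (X (Suc n) - l)" for n
  proof -
    have "N (F l - l) \<le> N (F l - X (Suc n)) + N (X (Suc n) - l)"
      using N_triangle_via l XV F by blast
    moreover have "N (F l - X (Suc n)) \<le> k * N (X n - l)"
      using con[OF l(1) XV[of n]] N_minus_commute[OF l(1) XV[of n]] by (simp add: X_def)
    ultimately show ?thesis by simp
  qed
  moreover have "(\<lambda>n. k * N (X n - l) + N (X (Suc n) - l)) \<longlonglongrightarrow> k * 0 + 0"
    by (intro tendsto_intros l(2) LIMSEQ_Suc[OF l(2)])
  ultimately have "N (F l - l) \<le> 0"
    using LIMSEQ_le_const[of _ "0" "N (F l - l)"] by auto
  then have "F l - l = 0" using N_eq0[of "F l - l"] N_nonneg[of "F l - l"] V_intros(3)[OF F[OF l(1)] l(1)] by simp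
  then show ?thesis using l(1) by auto
qed

end

section \<open>Riesz theory for an injective operator of the form identity plus compact\<close>

locale compact_perturbation = complete_norm_on V N
  for V :: "'a::real_vector set" and N :: "'a \<Rightarrow> real" +
  fixes K :: "'a \<Rightarrow> 'a" and CK :: real
  assumes K_V: "x \<in> V \<Longrightarrow> K x \<in> V"
    and K_add: "x \<in> V \<Longrightarrow> y \<in> V \<Longrightarrow> K (x + y) = K x + K y"
    and K_scale: "x \<in> V \<Longrightarrow> K (c *\<^sub>R x) = c *\<^sub>R K x"
    and K_bd: "x \<in> V \<Longrightarrow> N (K x) \<le> CK * N x"
    and K_compact: "(\<And>n. X n \<in> V) \<Longrightarrow> (\<And>n. N (X n) \<le> B) \<Longrightarrow>
        \<exists>r. strict_mono (r :: nat \<Rightarrow> nat) \<and> (\<exists>l\<in>V. (\<lambda>n. N (K (X (r n)) - l)) \<longlonglongrightarrow> 0)"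
    and inj: "x \<in> V \<Longrightarrow> x + K x = 0 \<Longrightarrow> x = 0"
begin

definition S :: "'a \<Rightarrow> 'a" where "S x = x + K x"

lemma S_V: "x \<in> V \<Longrightarrow> S x \<in> V"
  by (simp add: S_def V_intros K_V)

lemma K_diff: "x \<in> V \<Longrightarrow> y \<in> V \<Longrightarrow> K (x - y) = K x - K y"
  using K_add[of x "-1 *\<^sub>R y"] K_scale[of y "-1"] V_intros by simp

lemma S_diff: "x \<in> V \<Longrightarrow> y \<in> V \<Longrightarrow> S (x - y) = S x - S y"
  by (simp add: S_def K_diff)

lemma S_add: "x \<in> V \<Longrightarrow> y \<in> V \<Longrightarrow> S (x + y) = S x + S y"
  by (simp add: S_def K_add)

lemma S_scale: "x \<in> V \<Longrightarrow> S (c *\<^sub>R x) = c *\<^sub>R S x"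
  by (simp add: S_def K_scale scaleR_add_right)

text \<open>Otherwise there are unit vectors \<open>x n\<close> with \<open>S (x n)\<close> tending
  to 0. Along a subsequence \<open>K (x n)\<close> converges to some \<open>l\<close>, hence
  \<open>x n = S (x n) - K (x n)\<close> converges to \<open>- l\<close>, which would be a unit
  vector in the kernel of \<open>S\<close>.\<close>

lemma bounded_below: "\<exists>C>0. \<forall>x\<in>V. N x \<le> C * N (S x)"
proof (rule ccontr)
  assume "\<not> ?thesis"
  then have "\<forall>n::nat. \<exists>x\<in>V. N x > real (Suc n) * N (S x)"
    by (metis not_le of_nat_0_less_iff zero_less_Suc)
  then obtain y where y: "\<And>n. y n \<in> V" "\<And>n. N (y n) > real (Suc n) * N (S (y n))" by metis
  have ypos: "N (y n) > 0" for n
    using y(2)[of n] N_nonneg[OF S_V[OF y(1)[of n]]] by (smt (verit) mult_nonneg_nonneg of_nat_0_le_iff)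
  define x where "x n = (1 / N (y n)) *\<^sub>R y n" for n
  have xV: "x n \<in> V" for n by (simp add: x_def V_intros y)
  have x1: "N (x n) = 1" for n using N_scale[OF y(1)] ypos[of n] by (simp add: x_def)
  have Sx: "N (S (x n)) \<le> 1 / real (Suc n)" for n
  proof -
    have "N (S (x n)) = (1 / N (y n)) * N (S (y n))"
      using N_scale[OF S_V[OF y(1)]] ypos[of n] by (simp add: x_def S_scale y)
    moreover have "N (S (y n)) / N (y n) \<le> 1 / real (Suc n)"
      using y(2)[of n] ypos[of n] by (simp add: field_simps)
    ultimately show ?thesis by simp
  qed
  obtain r l where r: "strict_mono (r :: nat \<Rightarrow> nat)" and l: "l \<in> V" "(\<lambda>n. N (K (x (r n)) - l)) \<longlonglongrightarrow> 0"
    using K_compact[of x 1] xV x1 by fastforce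
  have S0: "(\<lambda>n. N (S (x (r n)))) \<longlonglongrightarrow> 0"
  proof (rule tendsto_sandwich[OF _ _ tendsto_const])
    show "\<forall>\<^sub>F n in sequentially. N (S (x (r n))) \<le> 1 / real (Suc n)"
    proof (intro always_eventually allI)
      fix n
      have "1 / real (Suc (r n)) \<le> 1 / real (Suc n)"
        using seq_suble[OF r, of n] by (intro divide_left_mono) auto
      then show "N (S (x (r n))) \<le> 1 / real (Suc n)" using Sx[of "r n"] by linarith
    qed
    show "(\<lambda>n. 1 / real (Suc n)) \<longlonglongrightarrow> 0" using LIMSEQ_inverse_real_of_nat by (simp add: inverse_eq_divide)
  qed (simp add: N_nonneg S_V xV)
  have lim: "(\<lambda>n. N (x (r n) - (- l))) \<longlonglongrightarrow> 0"
  proof (rule tendsto_sandwich[OF _ _ tendsto_const])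
    show "\<forall>\<^sub>F n in sequentially. N (x (r n) - (- l)) \<le> N (S (x (r n))) + N (K (x (r n)) - l)"
    proof (intro always_eventually allI)
      fix n
      have "x (r n) - (- l) = S (x (r n)) - (K (x (r n)) - l)" by (simp add: S_def)
      then show "N (x (r n) - (- l)) \<le> N (S (x (r n))) + N (K (x (r n)) - l)"
        using N_triangle_diff[of "S (x (r n))" "K (x (r n)) - l"] S_V xV K_V V_intros l(1) by metis
    qed
    show "(\<lambda>n. N (S (x (r n))) + N (K (x (r n)) - l)) \<longlonglongrightarrow> 0"
      using tendsto_add[OF S0 l(2)] by simp
  qed (use N_nonneg V_intros xV l(1) in \<open>auto simp del: diff_minus_eq_add\<close>)
  define z where "z = - l"
  have z: "z \<in> V" "(\<lambda>n. N (x (r n) - z)) \<longlonglongrightarrow> 0" using l V_intros lim by (auto simp: z_def)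
  have "N (S z) \<le> N (S (x (r n))) + (N (x (r n) - z) + CK * N (x (r n) - z))" for n
  proof -
    have "S z = S (x (r n)) - S (x (r n) - z)" using S_diff[OF xV z(1)] by simp
    then have "N (S z) \<le> N (S (x (r n))) + N (S (x (r n) - z))"
      using N_triangle_diff S_V xV z V_intros by metis
    moreover have "N (S (x (r n) - z)) \<le> N (x (r n) - z) + N (K (x (r n) - z))"
      unfolding S_def using N_triangle K_V xV z V_intros by metis
    ultimately show ?thesis using K_bd[OF V_intros(3)[OF xV z(1)], of "r n"] by simp
  qed
  moreover have "(\<lambda>n. N (S (x (r n))) + (N (x (r n) - z) + CK * N (x (r n) - z))) \<longlonglongrightarrow> 0 + (0 + CK * 0)"
    by (intro tendsto_intros S0 z)
  ultimately have "N (S z) \<le> 0" using LIMSEQ_le_const[of _ 0 "N (S z)"] by auto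
  then have "S z = 0" using N_eq0[of "S z"] N_nonneg[of "S z"] S_V[OF z(1)] by simp
  then have "z = 0" using inj z(1) by (simp add: S_def)
  then have "(\<lambda>n. N (x (r n))) \<longlonglongrightarrow> 0" using z(2) by simp
  then show False using x1 by (simp add: LIMSEQ_const_iff)
qed

text \<open>By \<open>bounded_below\<close> the preimages of a convergent sequence form a Cauchy
  sequence. The claim concerns images of closed subsets \<open>W\<close> because it is iterated
  along the ranges of the powers of \<open>S\<close>.\<close>

lemma range_closed:
  assumes "W \<subseteq> V" and Wclosed: "\<And>X l. (\<And>n. X n \<in> W) \<Longrightarrow> l \<in> V \<Longrightarrow> (\<lambda>n. N (X n - l)) \<longlonglongrightarrow> 0 \<Longrightarrow> l \<in> W"
    and X: "\<And>n. X n \<in> S ` W" and l: "l \<in> V" "(\<lambda>n. N (X n - l)) \<longlonglongrightarrow> 0"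
  shows "l \<in> S ` W"
proof -
  obtain C where C: "C > 0" "\<And>x. x \<in> V \<Longrightarrow> N x \<le> C * N (S x)" using bounded_below by blast
  have "\<forall>n. \<exists>y. y \<in> W \<and> X n = S y" using X by blast
  then obtain Y where Y: "\<And>n. Y n \<in> W" "\<And>n. X n = S (Y n)" by metis
  have YV: "Y n \<in> V" for n using Y(1)[of n] assms(1) by auto
  have XV: "X n \<in> V" for n using Y YV S_V by simp
  have "\<exists>M. \<forall>m\<ge>M. \<forall>n\<ge>M. N (Y m - Y n) < e" if "e > 0" for e
  proof -
    obtain M where M: "\<And>n. n \<ge> M \<Longrightarrow> \<bar>N (X n - l)\<bar> < e / (2 * C)"
      using LIMSEQ_D[OF l(2), of "e / (2 * C)"] \<open>e > 0\<close> C by auto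
    have "N (Y m - Y n) < e" if "m \<ge> M" "n \<ge> M" for m n
    proof -
      have "N (Y m - Y n) \<le> C * N (X m - X n)"
        using C(2)[of "Y m - Y n"] YV V_intros S_diff Y by simp
      also have "N (X m - X n) \<le> N (X m - l) + N (X n - l)"
        using N_triangle_via[OF XV l(1) XV, of m n] N_minus_commute[OF l(1) XV, of n] by simp
      also have "\<dots> < e / C" using M[of m] M[of n] that by simp
      finally show ?thesis using C by (simp add: field_simps)
    qed
    then show ?thesis by blast
  qed
  then obtain y where y: "y \<in> V" "(\<lambda>n. N (Y n - y)) \<longlonglongrightarrow> 0" using N_complete[of Y] YV by blast
  have yW: "y \<in> W" using Wclosed[OF Y(1) y] .
  have "N (l - S y) \<le> N (X n - l) + (N (Y n - y) + CK * N (Y n - y))" for n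
  proof -
    have "N (l - S y) \<le> N (l - X n) + N (X n - S y)"
      using N_triangle_via l(1) XV S_V y by metis
    moreover have "X n - S y = (Y n - y) + K (Y n - y)"
      using S_diff[OF YV y(1)] Y(2) by (simp add: S_def)
    then have "N (X n - S y) \<le> N (Y n - y) + CK * N (Y n - y)"
      using N_triangle[of "Y n - y" "K (Y n - y)"] K_bd[of "Y n - y"] K_V[of "Y n - y"] V_intros(3)[OF YV y(1), of n] by simp
    ultimately show ?thesis using N_minus_commute[OF l(1) XV, of n] by simp
  qed
  moreover have "(\<lambda>n. N (X n - l) + (N (Y n - y) + CK * N (Y n - y))) \<longlonglongrightarrow> 0 + (0 + CK * 0)"
    by (intro tendsto_intros l y)
  ultimately have "N (l - S y) \<le> 0" using LIMSEQ_le_const[of _ 0 "N (l - S y)"] by auto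
  then have "l - S y = 0" using N_eq0[of "l - S y"] N_nonneg[of "l - S y"] V_intros(3)[OF l(1) S_V[OF y(1)]] by simp
  then show ?thesis using yW by auto
qed

text \<open>If every unit vector of \<open>W\<close> had a point of \<open>W'\<close> at distance
  below 1/2, scaling would give every \<open>b\<close> in \<open>W\<close> an approximation with
  error at most half its norm. Applied to the successive errors of \<open>a\<close>, this yields
  approximations with error \<open>(1/2) ^ n * N a\<close>, so \<open>a\<close> would be a limit of
  points of \<open>W'\<close>. The distance from \<open>a\<close> to \<open>W'\<close> never has to
  be formed.\<close>

lemma riesz_lemma:
  assumes "W' \<subseteq> W" "W \<subseteq> V" "subspace W" "subspace W'" "a \<in> W" "a \<notin> W'"
    and closed: "\<And>X l. (\<And>n. X n \<in> W') \<Longrightarrow> l \<in> V \<Longrightarrow> (\<lambda>n. N (X n - l)) \<longlonglongrightarrow> 0 \<Longrightarrow> l \<in> W'"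
  shows "\<exists>e\<in>W. N e = 1 \<and> (\<forall>z\<in>W'. 1/2 \<le> N (e - z))"
proof (rule ccontr)
  assume neg: "\<not> ?thesis"
  have half: "\<exists>z\<in>W'. N (b - z) \<le> 1/2 * N b" if "b \<in> W" for b
  proof (cases "N b = 0")
    case True
    then have "b = 0" using N_eq0 that assms by auto
    then show ?thesis using N_zero subspace_0[OF \<open>subspace W'\<close>] by force
  next
    case False
    have bV: "b \<in> V" using that assms by auto
    then have pos: "N b > 0" using N_nonneg[of b] False by simp
    define e where "e = (1 / N b) *\<^sub>R b"
    have "e \<in> W" using that assms by (simp add: e_def subspace_scale)
    moreover have "N e = 1" using N_scale[OF bV] pos by (simp add: e_def)
    ultimately obtain z where z: "z \<in> W'" "N (e - z) < 1/2" using neg by force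
    have zV: "z \<in> V" using z assms by auto
    have "b - N b *\<^sub>R z = N b *\<^sub>R (e - z)" using pos by (simp add: e_def scaleR_diff_right)
    then have "N (b - N b *\<^sub>R z) = N b * N (e - z)"
      using N_scale[of "e - z" "N b"] pos V_intros zV \<open>e \<in> W\<close> assms by auto
    also have "\<dots> \<le> N b * (1/2)" using z pos by (intro mult_left_mono) auto
    finally show ?thesis using z subspace_scale[OF \<open>subspace W'\<close>] by auto
  qed
  have "\<exists>z\<in>W'. N (a - z) \<le> (1/2) ^ n * N a" for n
  proof (induction n)
    case 0
    then show ?case using subspace_0[OF \<open>subspace W'\<close>] by force
  next
    case (Suc n)
    then obtain z where z: "z \<in> W'" "N (a - z) \<le> (1/2) ^ n * N a" by blast
    have "a - z \<in> W" using z assms by (auto simp: subspace_diff)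
    then obtain z' where z': "z' \<in> W'" "N (a - z - z') \<le> 1/2 * N (a - z)" using half by blast
    have "N (a - (z + z')) \<le> (1/2) ^ Suc n * N a" using z z' by (simp add: diff_diff_eq)
    then show ?case using z z' subspace_add[OF \<open>subspace W'\<close>] by blast
  qed
  then obtain z where z: "\<And>n. z n \<in> W'" "\<And>n. N (a - z n) \<le> (1/2) ^ n * N a" by metis
  have aV: "a \<in> V" and zV: "z n \<in> V" for n using assms(1,2,5) z(1)[of n] by auto
  have "(\<lambda>n. N (z n - a)) \<longlonglongrightarrow> 0"
  proof (rule tendsto_sandwich[OF _ _ tendsto_const])
    show "\<forall>\<^sub>F n in sequentially. N (z n - a) \<le> (1/2) ^ n * N a"
      using z(2) N_minus_commute[OF aV zV] by simp
    have "(\<lambda>n. (1/2) ^ n * N a) \<longlonglongrightarrow> 0 * N a"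
      by (intro tendsto_intros LIMSEQ_power_zero) auto
    then show "(\<lambda>n. (1/2) ^ n * N a) \<longlonglongrightarrow> 0" by simp
  qed (use N_nonneg V_intros aV zV in simp)
  then show False using closed[of z a] z(1) aV \<open>a \<notin> W'\<close> by simp
qed

text \<open>If \<open>y\<close> is missed, injectivity makes the ranges \<open>R n\<close> of the
  powers of \<open>S\<close> strictly decreasing, witnessed by \<open>(S ^^ n) y\<close>. Riesz'
  lemma picks unit vectors \<open>e n\<close> of \<open>R n\<close> far from
  \<open>R (Suc n)\<close>; their images under \<open>K\<close> stay apart, against
  compactness.\<close>

lemma surjective:
  assumes "y \<in> V"
  shows "\<exists>x\<in>V. S x = y"
proof (rule ccontr)
  assume no: "\<not> ?thesis"
  define R where "R n = (S ^^ n) ` V" for n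
  have R_Suc: "R (Suc n) = S ` R n" for n by (auto simp: R_def)
  have R_V: "R n \<subseteq> V" for n by (induction n) (auto simp: R_Suc S_V, simp add: R_def)
  have R_sub: "subspace (R n)" for n
  proof (induction n)
    case 0
    then show ?case using sub by (simp add: R_def)
  next
    case (Suc n)
    have in1: "x \<in> V" if "x \<in> R n" for x using that R_V by auto
    show ?case unfolding subspace_def R_Suc
    proof (intro conjI ballI allI)
      show "0 \<in> S ` R n" using S_scale[OF V_intros(1), of 0] subspace_0[OF Suc] by (metis image_eqI scale_zero_left)
      fix x y c assume "x \<in> S ` R n"
      then obtain a where a: "a \<in> R n" "x = S a" by auto
      show "c *\<^sub>R x \<in> S ` R n" using a S_scale[of a c] in1 subspace_scale[OF Suc, of a c] by (metis image_eqI)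
      assume "y \<in> S ` R n"
      then obtain b where b: "b \<in> R n" "y = S b" by auto
      show "x + y \<in> S ` R n" using a b S_add[of a b] in1 subspace_add[OF Suc, of a b] by (metis image_eqI)
    qed
  qed
  have R_closed: "l \<in> R n" if "\<And>k. X k \<in> R n" "l \<in> V" "(\<lambda>k. N (X k - l)) \<longlonglongrightarrow> 0" for X l n
    using that
  proof (induction n arbitrary: X l)
    case 0
    then show ?case by (simp add: R_def)
  next
    case (Suc n)
    show ?case unfolding R_Suc
      by (rule range_closed[OF R_V, of n X l]) (use Suc R_Suc in blast)+
  qed
  have R_dec1: "R (Suc n) \<subseteq> R n" for n
    unfolding R_def by (auto simp: funpow_swap1 S_V)
  have R_dec: "R q \<subseteq> R p" if "p \<le> q" for p q
    using lift_Suc_antimono_le[of R, OF R_dec1 that] .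
  have S_inj: "x = z" if "x \<in> V" "z \<in> V" "S x = S z" for x z
  proof -
    have "S (x - z) = 0" using S_diff[of x z] that by simp
    then have "x - z = 0" using inj[of "x - z"] that V_intros by (simp add: S_def)
    then show ?thesis by simp
  qed
  have SnV: "(S ^^ n) x \<in> V" if "x \<in> V" for n x using R_V that by (auto simp: R_def)
  have Sn_inj: "x = z" if "x \<in> V" "z \<in> V" "(S ^^ n) x = (S ^^ n) z" for n x z
    using that by (induction n) (auto dest!: S_inj[rotated 2] simp: SnV)
  have "(S ^^ n) y \<notin> R (Suc n)" for n
  proof
    assume "(S ^^ n) y \<in> R (Suc n)"
    then obtain v where v: "v \<in> V" "(S ^^ n) y = (S ^^ n) (S v)" by (auto simp: R_def funpow_swap1)
    then have "y = S v" using Sn_inj assms S_V by blast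
    then show False using no v by auto
  qed
  then have "\<exists>e\<in>R n. N e = 1 \<and> (\<forall>z\<in>R (Suc n). 1/2 \<le> N (e - z))" for n
  proof -
    assume *: "\<And>n. (S ^^ n) y \<notin> R (Suc n)"
    have "(S ^^ n) y \<in> R n" using assms by (simp add: R_def)
    show ?thesis
    proof (rule riesz_lemma[OF R_dec1 R_V R_sub R_sub \<open>(S ^^ n) y \<in> R n\<close> *])
      fix X l assume "\<And>k. X k \<in> R (Suc n)" "l \<in> V" "(\<lambda>k. N (X k - l)) \<longlonglongrightarrow> 0"
      then show "l \<in> R (Suc n)" by (rule R_closed)
    qed
  qed
  then obtain e where e: "\<And>n. e n \<in> R n" "\<And>n. N (e n) = 1" "\<And>n z. z \<in> R (Suc n) \<Longrightarrow> 1/2 \<le> N (e n - z)"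
    by metis
  have eV: "e n \<in> V" for n using e(1)[of n] R_V[of n] by auto
  \<comment> \<open>Up to sign, \<open>K (e p) - K (e q)\<close> is \<open>e p\<close> minus an
    element of the smaller range \<open>R (Suc p)\<close>, because \<open>K\<close> is
    \<open>S\<close> minus the identity and \<open>q > p\<close>.\<close>
  have sep: "1/2 \<le> N (K (e p) - K (e q))" if "p < q" for p q
  proof -
    have "S (e p) \<in> R (Suc p)" "S (e q) \<in> R (Suc p)" "e q \<in> R (Suc p)"
      using e(1) R_Suc R_dec[of "Suc p" q] R_dec[of "Suc p" "Suc q"] that by auto
    then have "S (e p) - S (e q) + e q \<in> R (Suc p)"
      using R_sub by (meson subspace_add subspace_diff)
    from e(3)[OF this] have "1/2 \<le> N (e p - (S (e p) - S (e q) + e q))" .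
    also have "e p - (S (e p) - S (e q) + e q) = K (e q) - K (e p)" by (simp add: S_def)
    finally show ?thesis using N_minus_commute[of "K (e q)" "K (e p)"] K_V eV by simp
  qed
  obtain r l where r: "strict_mono (r :: nat \<Rightarrow> nat)" and l: "l \<in> V" "(\<lambda>n. N (K (e (r n)) - l)) \<longlonglongrightarrow> 0"
    using K_compact[of e 1] eV e(2) by fastforce
  obtain M where M: "\<And>n. n \<ge> M \<Longrightarrow> \<bar>N (K (e (r n)) - l)\<bar> < 1/4"
    using LIMSEQ_D[OF l(2), of "1/4"] by auto
  have "N (K (e (r M)) - K (e (r (Suc M)))) \<le> N (K (e (r M)) - l) + N (K (e (r (Suc M))) - l)"
    using N_triangle_via[of "K (e (r M))" l "K (e (r (Suc M)))"] N_minus_commute[of l "K (e (r (Suc M)))"] K_V eV l(1) by simp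
  then show False using sep[of "r M" "r (Suc M)"] r M[of M] M[of "Suc M"] by (simp add: strict_mono_Suc_iff)
qed

end

section \<open>Schauder theory on the torus\<close>

text \<open>The segment is replaced by a path that changes one coordinate at a time;
  \<open>p A\<close> has the coordinates in \<open>A\<close> already moved. This carries axis-wise
  estimates over to arbitrary pairs of points.\<close>

lemma axis_path_bound:
  fixes g :: "real^'d::finite \<Rightarrow> real"
  assumes "\<And>k x t. \<bar>g (x + t *\<^sub>R axis k 1) - g x\<bar> \<le> \<phi> k \<bar>t\<bar>"
  shows "\<bar>g y - g x\<bar> \<le> (\<Sum>k\<in>UNIV. \<phi> k \<bar>y $ k - x $ k\<bar>)"
proof -
  define p where "p A = (\<chi> k. if k \<in> A then y $ k else x $ k)" for A
  have "\<bar>g (p A) - g x\<bar> \<le> (\<Sum>k\<in>A. \<phi> k \<bar>y $ k - x $ k\<bar>)" if "finite A" for A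
    using that
  proof induction
    case empty
    have "p {} = x" by (simp add: p_def vec_eq_iff)
    then show ?case by simp
  next
    case (insert k A)
    have "p (insert k A) = p A + (y $ k - x $ k) *\<^sub>R axis k 1"
      using insert by (auto simp: p_def vec_eq_iff axis_def)
    then have "\<bar>g (p (insert k A)) - g (p A)\<bar> \<le> \<phi> k \<bar>y $ k - x $ k\<bar>" using assms by simp
    then show ?case using insert by simp
  qed
  moreover have "p UNIV = y" by (simp add: p_def vec_eq_iff)
  ultimately show ?thesis by (metis finite_class.finite_UNIV)
qed

text \<open>\<open>z\<close> depends on \<open>x\<close> alone and serves all periodic functions at
  once, so a whole family can be reduced to the cube at the same point.\<close>

lemma periodic_reduce:
  fixes x :: "real^'d::finite"
  obtains z where "\<And>u. periodic u \<Longrightarrow> u x = u z" "z \<in> cbox 0 1"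
proof
  define z where "z = (\<chi> i. frac (x $ i))"
  show "z \<in> cbox 0 1" unfolding z_def mem_box_cart using frac_lt_1 less_imp_le by (auto simp: frac_ge_0)
  fix u :: "real^'d \<Rightarrow> real" assume "periodic u"
  then have "u (z + (\<chi> i. of_int \<lfloor>x $ i\<rfloor>)) = u z" unfolding periodic_def by simp
  moreover have "z + (\<chi> i. of_int \<lfloor>x $ i\<rfloor>) = x" by (simp add: z_def vec_eq_iff frac_def)
  ultimately show "u x = u z" by simp
qed

text \<open>The finitely many functions become the coordinates of one vector-valued function on the
  unit cube, so that one subsequence serves all of them. Each index carries its own exponent because
  second differences will have a weaker modulus than the rest.\<close>

lemma arzela_ascoli_periodic:
  fixes F :: "nat \<Rightarrow> 'p::finite \<Rightarrow> real^'d::finite \<Rightarrow> real"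
  assumes per: "\<And>n p. periodic (F n p)" and bd: "\<And>n p x. \<bar>F n p x\<bar> \<le> B"
    and hol: "\<And>n p x y. \<bar>F n p x - F n p y\<bar> \<le> C p * dist x y powr \<gamma> p" and "\<And>p. \<gamma> p > 0"
  obtains g r where "strict_mono (r :: nat \<Rightarrow> nat)"
    "\<And>e. e > 0 \<Longrightarrow> \<exists>M. \<forall>n\<ge>M. \<forall>p x. \<bar>F (r n) p x - g p x\<bar> < e"
proof -
  define Fv where "Fv n x = (\<chi> p. F n p x)" for n x
  have "norm (Fv n x) \<le> real CARD('p) * B" for n x
  proof -
    have "norm (Fv n x) \<le> (\<Sum>p\<in>UNIV. \<bar>Fv n x $ p\<bar>)" by (rule norm_le_l1_cart)
    also have "\<dots> \<le> (\<Sum>p\<in>(UNIV::'p set). B)" by (intro sum_mono) (simp add: Fv_def bd)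
    finally show ?thesis by simp
  qed
  moreover have "\<exists>d>0. \<forall>n y. y \<in> cbox 0 1 \<and> norm (x - y) < d \<longrightarrow> norm (Fv n x - Fv n y) < e"
    if "e > 0" for x e
  proof -
    have "((\<lambda>s. \<Sum>p\<in>UNIV. C p * s powr \<gamma> p) \<longlongrightarrow> (\<Sum>p\<in>UNIV. C p * 0 powr \<gamma> p)) (at_right 0)"
    proof -
      have ev: "\<forall>\<^sub>F s in at_right (0::real). 0 \<le> s"
        using eventually_at_right_less[of "0::real"] by (rule eventually_mono) simp
      show ?thesis by (intro tendsto_intros tendsto_powr') (use assms ev in auto)
    qed
    then have "((\<lambda>s. \<Sum>p\<in>UNIV. C p * s powr \<gamma> p) \<longlongrightarrow> 0) (at_right 0)" by simp
    then have "\<forall>\<^sub>F s in at_right 0. (\<Sum>p\<in>UNIV. C p * s powr \<gamma> p) < e"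
      using \<open>e > 0\<close> by (simp add: order_tendstoD(2))
    then obtain d where d: "d > 0" "\<And>s. 0 < s \<Longrightarrow> s < d \<Longrightarrow> (\<Sum>p\<in>UNIV. C p * s powr \<gamma> p) < e"
      unfolding eventually_at_right_field by auto
    have "norm (Fv n x - Fv n y) < e" if "norm (x - y) < d" for n y
    proof (cases "x = y")
      case False
      have "norm (Fv n x - Fv n y) \<le> (\<Sum>p\<in>UNIV. \<bar>(Fv n x - Fv n y) $ p\<bar>)" by (rule norm_le_l1_cart)
      also have "\<dots> \<le> (\<Sum>p\<in>UNIV. C p * norm (x - y) powr \<gamma> p)"
        by (intro sum_mono) (use hol in \<open>auto simp: Fv_def dist_norm\<close>)
      also have "\<dots> < e" using d(2)[of "norm (x - y)"] that False by simp
      finally show ?thesis .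
    qed (use \<open>e > 0\<close> in simp)
    then show ?thesis using d(1) by blast
  qed
  ultimately obtain G r where Gr: "strict_mono (r :: nat \<Rightarrow> nat)"
    "\<And>e. 0 < e \<Longrightarrow> \<exists>N. \<forall>n x. n \<ge> N \<and> x \<in> cbox 0 (1::real^'d) \<longrightarrow> norm (Fv (r n) x - G x) < e"
    by (rule Arzela_Ascoli[OF compact_cbox, of 0 "1::real^'d" Fv "real CARD('p) * B"]) blast+
  define fr where "fr x = (SOME z. (\<forall>u. periodic u \<longrightarrow> u x = u z) \<and> z \<in> cbox 0 1)" for x :: "real^'d"
  have fr: "(\<forall>u. periodic u \<longrightarrow> u x = u (fr x)) \<and> fr x \<in> cbox 0 1" for x
    unfolding fr_def by (rule someI_ex) (metis periodic_reduce)
  show ?thesis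
  proof (rule that[OF Gr(1), of "\<lambda>p x. G (fr x) $ p"])
    fix e :: real assume "e > 0"
    then obtain M where M: "\<And>n x. n \<ge> M \<Longrightarrow> x \<in> cbox 0 1 \<Longrightarrow> norm (Fv (r n) x - G x) < e"
      using Gr(2) by blast
    have "\<bar>F (r n) p x - G (fr x) $ p\<bar> < e" if "n \<ge> M" for n p x
    proof -
      have "\<bar>F (r n) p x - G (fr x) $ p\<bar> = \<bar>(Fv (r n) (fr x) - G (fr x)) $ p\<bar>"
        using fr[of x] per[of "r n" p] by (metis Fv_def vec_lambda_beta vector_minus_component)
      also have "\<dots> \<le> norm (Fv (r n) (fr x) - G (fr x))" by (rule component_le_norm_cart)
      finally show ?thesis using M[OF that, of "fr x"] fr[of x] by simp
    qed
    then show "\<exists>M. \<forall>n\<ge>M. \<forall>p x. \<bar>F (r n) p x - G (fr x) $ p\<bar> < e" by blast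
  qed
qed

section \<open>From lattice estimates to the continuum\<close>

lemma equi_hoelder_tendsto:
  fixes a :: "nat \<Rightarrow> real^'d::finite \<Rightarrow> real"
  assumes "(\<lambda>n. a n z) \<longlonglongrightarrow> A" and "\<And>n x y. \<bar>a n x - a n y\<bar> \<le> C * dist x y powr \<gamma>" "\<gamma> > 0" "Z \<longlonglongrightarrow> z"
  shows "(\<lambda>n. a n (Z n)) \<longlonglongrightarrow> A"
proof -
  have "(\<lambda>n. C * dist (Z n) z powr \<gamma>) \<longlonglongrightarrow> C * 0 powr \<gamma>"
  proof -
    have "(\<lambda>n. dist (Z n) z) \<longlonglongrightarrow> 0" by (rule iffD1[OF tendsto_dist_iff \<open>Z \<longlonglongrightarrow> z\<close>])
    then show ?thesis using \<open>\<gamma> > 0\<close> by (intro tendsto_mult tendsto_const tendsto_powr') auto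
  qed
  then have "(\<lambda>n. C * dist (Z n) z powr \<gamma>) \<longlonglongrightarrow> 0" by simp
  then have "(\<lambda>n. a n (Z n) - a n z) \<longlonglongrightarrow> 0"
    by (rule Lim_null_comparison[rotated]) (use assms in auto)
  from tendsto_add[OF this assms(1)] show ?thesis by simp
qed

lemma floor_multiple_tendsto:
  fixes h :: "nat \<Rightarrow> real" and t :: real
  assumes "h \<longlonglongrightarrow> 0" "\<And>n. h n > 0" "t \<ge> 0"
  shows "(\<lambda>n. real (nat \<lfloor>t / h n\<rfloor>) * h n) \<longlonglongrightarrow> t"
proof (rule LIM_zero_cancel, rule Lim_null_comparison[OF _ assms(1)])
  show "\<forall>\<^sub>F n in sequentially. norm (real (nat \<lfloor>t / h n\<rfloor>) * h n - t) \<le> h n"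
  proof (intro always_eventually allI)
    fix n
    have h: "h n > 0" by (rule assms)
    have e: "real (nat \<lfloor>t / h n\<rfloor>) = of_int \<lfloor>t / h n\<rfloor>"
    proof -
      have "t / h n \<ge> 0" using assms(3) h by simp
      then show ?thesis by simp
    qed
    have "of_int \<lfloor>t / h n\<rfloor> * h n \<le> t / h n * h n" using h by (intro mult_right_mono) auto
    then have 1: "of_int \<lfloor>t / h n\<rfloor> * h n \<le> t" using h by simp
    have "t / h n * h n \<le> (of_int \<lfloor>t / h n\<rfloor> + 1) * h n"
      using h by (intro mult_right_mono) linarith+
    then have 2: "t \<le> of_int \<lfloor>t / h n\<rfloor> * h n + h n" using h by (simp add: distrib_right)
    show "norm (real (nat \<lfloor>t / h n\<rfloor>) * h n - t) \<le> h n" unfolding e using 1 2 by simp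
  qed
qed

text \<open>The modulus with exponent \<open>\<gamma>\<close> may be weak: it only permits replacing
  \<open>t\<close> by nearby lattice multiples. The exponent \<open>\<alpha>\<close> of the
  conclusion comes from the lattice estimate alone.\<close>

lemma lhol_limit:
  fixes a :: "nat \<Rightarrow> real^'d::finite \<Rightarrow> real"
  assumes lim: "\<And>x. (\<lambda>n. a n x) \<longlonglongrightarrow> A x" and eq: "\<And>n x y. \<bar>a n x - a n y\<bar> \<le> C * dist x y powr \<gamma>" "\<gamma> > 0"
    and h: "h \<longlonglongrightarrow> 0" "\<And>n. h n > 0" and lh: "\<And>n. lhol (h n) k \<alpha> H (a n)" and "\<alpha> > 0"
  shows "\<bar>A (x + t *\<^sub>R axis k 1) - A x\<bar> \<le> H * \<bar>t\<bar> powr \<alpha>"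
proof -
  have pos: "\<bar>A (x + t *\<^sub>R axis k 1) - A x\<bar> \<le> H * t powr \<alpha>" if t: "t \<ge> 0" for x t
  proof -
    define m where "m n = real (nat \<lfloor>t / h n\<rfloor>) * h n" for n
    have m0: "m n \<ge> 0" for n unfolding m_def using h(2)[of n] by simp
    have m: "m \<longlonglongrightarrow> t" unfolding m_def using floor_multiple_tendsto[OF h t] .
    have "(\<lambda>n. a n (x + m n *\<^sub>R axis k 1)) \<longlonglongrightarrow> A (x + t *\<^sub>R axis k 1)"
      by (rule equi_hoelder_tendsto[OF lim eq]) (intro tendsto_intros m)
    then have "(\<lambda>n. \<bar>a n (x + m n *\<^sub>R axis k 1) - a n x\<bar>) \<longlonglongrightarrow> \<bar>A (x + t *\<^sub>R axis k 1) - A x\<bar>"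
      by (intro tendsto_intros lim)
    moreover have "(\<lambda>n. H * m n powr \<alpha>) \<longlonglongrightarrow> H * t powr \<alpha>"
      using m m0 \<open>\<alpha> > 0\<close> by (intro tendsto_mult tendsto_const tendsto_powr') auto
    ultimately show ?thesis
      by (rule LIMSEQ_le) (use lh in \<open>auto simp: lhol_def m_def\<close>)
  qed
  show ?thesis
  proof (cases "t \<ge> 0")
    case False
    then show ?thesis using pos[of "-t" "x + t *\<^sub>R axis k 1"] by (simp add: abs_minus_commute)
  qed (use pos in simp)
qed

text \<open>Summing \<open>m\<close> difference quotients along the lattice gives a first-order
  expansion with error of order \<open>(m * h n) powr (1 + \<gamma>')\<close>, uniformly in
  \<open>n\<close>. It survives the limit when lattice multiples of \<open>h n\<close> approach
  \<open>t\<close>.\<close>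

lemma has_real_derivative_from_limit:
  fixes a :: "nat \<Rightarrow> real^'d::finite \<Rightarrow> real"
  assumes lima: "\<And>x. (\<lambda>n. a n x) \<longlonglongrightarrow> A x" and eqa: "\<And>n x y. \<bar>a n x - a n y\<bar> \<le> C * dist x y powr \<gamma>" "\<gamma> > 0"
    and limb: "\<And>x. (\<lambda>n. fdq (h n) i (a n) x) \<longlonglongrightarrow> B x"
    and eqb: "\<And>n x y. \<bar>fdq (h n) i (a n) x - fdq (h n) i (a n) y\<bar> \<le> C' * dist x y powr \<gamma>'" "\<gamma>' > 0"
    and h: "h \<longlonglongrightarrow> 0" "\<And>n. h n > 0"
  shows "((\<lambda>t. A (x + t *\<^sub>R axis i 1)) has_real_derivative B x) (at 0)"
proof -
  define e where "e = (axis i 1 :: real^'d)"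
  have e1: "norm e = 1" by (simp add: e_def)
  have C': "C' \<ge> 0" using eqb(1)[of 0 e 0] e1 by (simp add: dist_norm)
  have inc: "\<bar>a n (x + (real m * h n) *\<^sub>R e) - a n x - (real m * h n) * fdq (h n) i (a n) x\<bar>
      \<le> C' * (real m * h n) * (real m * h n) powr \<gamma>'" for n m x
  proof -
    define b where "b = fdq (h n) i (a n)"
    have "a n (x + (real m * h n) *\<^sub>R e) - a n x = (\<Sum>l<m. h n * b (x + (real l * h n) *\<^sub>R e))"
    proof (induction m)
      case (Suc m)
      have "x + (real (Suc m) * h n) *\<^sub>R e = (x + (real m * h n) *\<^sub>R e) + h n *\<^sub>R e"
        by (simp add: distrib_right scaleR_left_distrib)
      moreover have "h n * b (x + (real m * h n) *\<^sub>R e) =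
          a n (x + (real m * h n) *\<^sub>R e + h n *\<^sub>R e) - a n (x + (real m * h n) *\<^sub>R e)"
        unfolding b_def fdq_def e_def using h(2)[of n] by simp
      ultimately show ?case using Suc by (simp add: add.assoc)
    qed simp
    then have "a n (x + (real m * h n) *\<^sub>R e) - a n x - (real m * h n) * b x
       = (\<Sum>l<m. h n * (b (x + (real l * h n) *\<^sub>R e) - b x))"
      by (simp add: right_diff_distrib sum_subtractf)
    also have "\<bar>\<dots>\<bar> \<le> (\<Sum>l<m. h n * (C' * (real m * h n) powr \<gamma>'))"
    proof (rule order_trans[OF sum_abs], rule sum_mono)
      fix l assume "l \<in> {..<m}"
      have "\<bar>b (x + (real l * h n) *\<^sub>R e) - b x\<bar> \<le> C' * (real l * h n) powr \<gamma>'"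
        using eqb(1)[of n "x + (real l * h n) *\<^sub>R e" x] h(2)[of n] e1 unfolding b_def by (simp add: dist_norm)
      also have "\<dots> \<le> C' * (real m * h n) powr \<gamma>'"
        using \<open>l \<in> {..<m}\<close> h(2)[of n] eqb(2) C' by (intro mult_left_mono powr_mono2) (auto intro: mult_right_mono)
      finally show "\<bar>h n * (b (x + (real l * h n) *\<^sub>R e) - b x)\<bar> \<le> h n * (C' * (real m * h n) powr \<gamma>')"
        using h(2)[of n] by (simp add: abs_mult)
    qed
    finally show ?thesis by (simp add: b_def algebra_simps)
  qed
  have pos: "\<bar>A (x + t *\<^sub>R e) - A x - t * B x\<bar> \<le> C' * t * t powr \<gamma>'" if t: "t \<ge> 0" for x t
  proof -
    define m where "m n = real (nat \<lfloor>t / h n\<rfloor>) * h n" for n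
    have m0: "m n \<ge> 0" for n unfolding m_def using h(2)[of n] by simp
    have m: "m \<longlonglongrightarrow> t" unfolding m_def using floor_multiple_tendsto[OF h t] .
    have "(\<lambda>n. a n (x + m n *\<^sub>R e)) \<longlonglongrightarrow> A (x + t *\<^sub>R e)"
      by (rule equi_hoelder_tendsto[OF lima eqa]) (intro tendsto_intros m)
    then have "(\<lambda>n. \<bar>a n (x + m n *\<^sub>R e) - a n x - m n * fdq (h n) i (a n) x\<bar>) \<longlonglongrightarrow> \<bar>A (x + t *\<^sub>R e) - A x - t * B x\<bar>"
      by (intro tendsto_intros lima limb m)
    moreover have "(\<lambda>n. C' * m n * m n powr \<gamma>') \<longlonglongrightarrow> C' * t * t powr \<gamma>'"
      using m m0 eqb(2) by (intro tendsto_mult tendsto_const tendsto_powr') auto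
    ultimately show ?thesis
      by (rule LIMSEQ_le) (use inc in \<open>auto simp: m_def\<close>)
  qed
  have eqB: "\<bar>B y - B z\<bar> \<le> C' * dist y z powr \<gamma>'" for y z
  proof -
    have "(\<lambda>n. \<bar>fdq (h n) i (a n) y - fdq (h n) i (a n) z\<bar>) \<longlonglongrightarrow> \<bar>B y - B z\<bar>"
      by (intro tendsto_intros limb)
    then show ?thesis by (rule LIMSEQ_le_const2) (use eqb in auto)
  qed
  have all: "\<bar>A (x + t *\<^sub>R e) - A x - t * B x\<bar> \<le> \<bar>t\<bar> * (2 * C' * \<bar>t\<bar> powr \<gamma>')" for t
  proof (cases "t \<ge> 0")
    case True
    have "C' * t * t powr \<gamma>' \<ge> 0" using True C' by simp
    then show ?thesis using pos[OF True, of x] True by (simp add: algebra_simps)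
  next
    \<comment> \<open>For negative \<open>t\<close> the expansion is based at the left endpoint
      \<open>y\<close>; moving the derivative from \<open>y\<close> back to \<open>x\<close> costs a
      second error term, hence \<open>2 * C'\<close>.\<close>
    case False
    define s where "s = - t"
    define y where "y = x + t *\<^sub>R e"
    have "\<bar>A x - A y - s * B y\<bar> \<le> C' * s * s powr \<gamma>'"
      using pos[of s y] False by (simp add: s_def y_def)
    moreover have "\<bar>B y - B x\<bar> \<le> C' * s powr \<gamma>'"
      using eqB[of y x] False e1 by (simp add: s_def y_def dist_norm)
    then have "s * \<bar>B y - B x\<bar> \<le> s * (C' * s powr \<gamma>')" using False by (intro mult_left_mono) (auto simp: s_def)
    moreover have "s * \<bar>B y - B x\<bar> = \<bar>s * B y - s * B x\<bar>" using False by (simp add: s_def abs_mult flip: right_diff_distrib)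
    ultimately have "\<bar>A x - A y - s * B x\<bar> \<le> s * (2 * C' * s powr \<gamma>')" by (simp add: algebra_simps)
    then show ?thesis using False by (simp add: s_def y_def abs_le_iff algebra_simps)
  qed
  have "((\<lambda>t. (A (x + t *\<^sub>R e) - A x) / t - B x) \<longlongrightarrow> 0) (at 0)"
  proof (rule Lim_null_comparison)
    show "\<forall>\<^sub>F t in at 0. norm ((A (x + t *\<^sub>R e) - A x) / t - B x) \<le> 2 * C' * \<bar>t\<bar> powr \<gamma>'"
    proof (rule eventually_at_filter[THEN iffD2], intro always_eventually allI impI)
      fix t :: real assume "t \<noteq> 0"
      then have "(A (x + t *\<^sub>R e) - A x) / t - B x = (A (x + t *\<^sub>R e) - A x - t * B x) / t"
        by (simp add: field_simps)
      then show "norm ((A (x + t *\<^sub>R e) - A x) / t - B x) \<le> 2 * C' * \<bar>t\<bar> powr \<gamma>'"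
        using all[of t] \<open>t \<noteq> 0\<close> by (simp add: abs_divide pos_divide_le_eq mult.commute)
    qed
    have "((\<lambda>t. 2 * C' * \<bar>t\<bar> powr \<gamma>') \<longlongrightarrow> 2 * C' * \<bar>0\<bar> powr \<gamma>') (at (0::real))"
      using eqb(2) by (intro tendsto_intros tendsto_powr') auto
    then show "((\<lambda>t. 2 * C' * \<bar>t\<bar> powr \<gamma>') \<longlongrightarrow> 0) (at (0::real))" by simp
  qed
  then have "((\<lambda>t. (A (x + t *\<^sub>R e) - A x) / t) \<longlongrightarrow> B x) (at 0)" by (rule LIM_zero_cancel)
  then show ?thesis unfolding has_field_derivative_iff e_def by simp
qed

lemma pd_eqI:
  assumes "((\<lambda>t. u (x + t *\<^sub>R axis i 1)) has_real_derivative D) (at 0)"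
  shows "pd i u x = D"
  using assms by (simp add: pd_def DERIV_imp_deriv)

lemma continuous_on_hoelder:
  fixes g :: "real^'d \<Rightarrow> real"
  assumes "\<And>x y. \<bar>g x - g y\<bar> \<le> C * dist x y powr \<gamma>" "\<gamma> > 0"
  shows "continuous_on UNIV g"
proof -
  have "g \<midarrow>x\<rightarrow> g x" for x
  proof (rule LIM_zero_cancel, rule Lim_null_comparison)
    show "\<forall>\<^sub>F y in at x. norm (g y - g x) \<le> C * dist y x powr \<gamma>" using assms by simp
    have "(\<lambda>y. dist y x) \<midarrow>x\<rightarrow> 0" using tendsto_dist[OF tendsto_ident_at[of x UNIV] tendsto_const[of x]] by simp
    then have "((\<lambda>y. C * dist y x powr \<gamma>) \<longlongrightarrow> C * 0 powr \<gamma>) (at x)"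
      using assms(2) by (intro tendsto_mult tendsto_const tendsto_powr') auto
    then show "((\<lambda>y. C * dist y x powr \<gamma>) \<longlongrightarrow> 0) (at x)" by simp
  qed
  then show ?thesis by (simp add: continuous_on_def)
qed

text \<open>Orders zero to two are indexed by one finite type, so that compactness applies to all of
  them together. The directions are read from left to right, and every pair starting with
  \<open>None\<close> stands for the function itself.\<close>

fun fdq_jet :: "real \<Rightarrow> (real^'d::finite \<Rightarrow> real) \<Rightarrow> 'd option \<times> 'd option \<Rightarrow> real^'d \<Rightarrow> real" where
  "fdq_jet h w (None, _) = w"
| "fdq_jet h w (Some i, None) = fdq h i w"
| "fdq_jet h w (Some i, Some j) = fdq h j (fdq h i w)"

lemma periodic_fdq: "periodic w \<Longrightarrow> periodic (fdq h i w)"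
  unfolding periodic_def fdq_def by (metis add.assoc add.commute)

lemma fdq_shift: "fdq h i (\<lambda>x. w (x + z)) x = fdq h i w (x + z)"
  by (simp add: fdq_def add_ac)

lemma lhol_if_hoelder:
  assumes "\<And>x y. \<bar>\<xi> x - \<xi> y\<bar> \<le> C * dist x y powr \<alpha>" "h > 0"
  shows "lhol h i \<alpha> C \<xi>"
  unfolding lhol_def
proof safe
  fix x m
  show "\<bar>\<xi> (x + (real m * h) *\<^sub>R axis i 1) - \<xi> x\<bar> \<le> C * (real m * h) powr \<alpha>"
    using assms(1)[of "x + (real m * h) *\<^sub>R axis i 1" x] assms(2) by (simp add: dist_norm)
qed

text \<open>
  The discrete problem decouples into the cosets of the lattice, so the lattice estimate says nothing about
  increments off the lattice. There the bound with exponent $\alpha/2$ is applied to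
  $\xi(\cdot + z) - \xi$, whose $\alpha/2$-seminorm is at most a multiple of $|z|^{\alpha/2}$; this weaker
  modulus is enough for compactness.
\<close>

lemma schauder_existence:
  fixes lam \<alpha> :: real
  assumes "lam > 0" "0 < \<alpha>" "\<alpha> < 1"
  shows "\<exists>K>0. \<forall>(\<xi> :: real^'d::finite \<Rightarrow> real) A. periodic \<xi> \<longrightarrow> (\<forall>x. \<bar>\<xi> x\<bar> \<le> A) \<longrightarrow>
    (\<forall>x y. \<bar>\<xi> x - \<xi> y\<bar> \<le> A * dist x y powr \<alpha>) \<longrightarrow>
    (\<exists>v. torus_C2 v \<and> (\<forall>x. - lap v x + lam * v x = \<xi> x) \<and> (\<forall>x. \<bar>v x\<bar> \<le> K * A) \<and> (\<forall>i x. \<bar>pd i v x\<bar> \<le> K * A) \<and>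
      (\<forall>i j x. \<bar>pd j (pd i v) x\<bar> \<le> K * A) \<and>
      (\<forall>i j x y. \<bar>pd j (pd i v) x - pd j (pd i v) y\<bar> \<le> K * A * dist x y powr \<alpha>))"
proof -
  \<comment> \<open>\<open>N\<close> solves \<open>3 * N powr (\<alpha> - 1) = 1/2\<close>, which is
    possible because \<open>\<alpha> < 1\<close>.\<close>
  define N where "N = (6::real) powr (1 / (1 - \<alpha>))"
  have N: "N > 0" "3 * N powr (\<alpha> - 1) \<le> 1/2"
  proof -
    have "1 / (1 - \<alpha>) * (\<alpha> - 1) = - 1" using assms by (simp add: field_simps)
    then have "N powr (\<alpha> - 1) = (6::real) powr (- 1)" unfolding N_def powr_powr by simp
    then show "3 * N powr (\<alpha> - 1) \<le> 1/2" by (simp add: powr_minus)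
  qed (simp add: N_def)
  define K0 where "K0 = 1 / lam"
  define K1 where "K1 = 4 / sqrt lam"
  define K2 where "K2 = schauder_const \<alpha> * lam powr (- \<alpha> / 2)"
  define K3 where "K3 = real CARD('d) * (4 * schauder_const \<alpha> * N powr \<alpha>)"
  define K4 where "K4 = schauder_const (\<alpha> / 2) * 2 * lam powr (- (\<alpha> / 2) / 2)"
  define K where "K = K0 + K1 + K2 + K3"
  have Ks: "K0 > 0" "K1 > 0" "K2 > 0" "K3 > 0"
    using assms N schauder_const_pos[of \<alpha>] by (auto simp: K0_def K1_def K2_def K3_def)
  have "\<exists>v. torus_C2 v \<and> (\<forall>x. - lap v x + lam * v x = \<xi> x) \<and> (\<forall>x. \<bar>v x\<bar> \<le> K * A) \<and> (\<forall>i x. \<bar>pd i v x\<bar> \<le> K * A) \<and>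
      (\<forall>i j x. \<bar>pd j (pd i v) x\<bar> \<le> K * A) \<and>
      (\<forall>i j x y. \<bar>pd j (pd i v) x - pd j (pd i v) y\<bar> \<le> K * A * dist x y powr \<alpha>)"
    if per: "periodic \<xi>" and bd: "\<And>x. \<bar>\<xi> x\<bar> \<le> A" and hol: "\<And>x y. \<bar>\<xi> x - \<xi> y\<bar> \<le> A * dist x y powr \<alpha>"
    for \<xi> :: "real^'d \<Rightarrow> real" and A
  proof -
    have A: "A \<ge> 0" using bd[of 0] by linarith
    have xc: "continuous_on UNIV \<xi>" by (rule continuous_on_hoelder[OF hol \<open>\<alpha> > 0\<close>])
    have xb: "bounded (range \<xi>)" by (rule bounded_range_realI[OF bd])
    define h where "h n = 1 / real (Suc n)" for n
    have h0: "h n > 0" for n by (simp add: h_def)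
    have hlim: "h \<longlonglongrightarrow> 0" unfolding h_def using LIMSEQ_inverse_real_of_nat by (simp add: inverse_eq_divide)
    have "\<forall>n. \<exists>w. dsol (h n) lam w \<xi>" using dsol_exists[OF \<open>lam > 0\<close> h0 xc xb] by metis
    then obtain w where w: "\<And>n. dsol (h n) lam (w n) \<xi>" by metis
    define z0 where "z0 \<xi>' y = (\<lambda>x. \<xi>' (x + y) - \<xi>' x)" for \<xi>' :: "real^'d \<Rightarrow> real" and y
    have wz: "dsol (h n) lam (z0 (w n) y) (z0 \<xi> y)" for n y
      unfolding z0_def by (rule dsol_diff[OF dsol_shift[OF w] w])
    have zb: "\<bar>z0 \<xi> y x\<bar> \<le> A * norm y powr \<alpha>" for x y
      using hol[of "x + y" x] by (simp add: z0_def dist_norm)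
    have b0: "\<bar>w n x\<bar> \<le> K0 * A" for n x
      using dsol_abs_le[OF w \<open>lam > 0\<close> h0 bd, of n x] by (simp add: K0_def)
    have e0: "\<bar>w n x - w n y\<bar> \<le> K0 * A * dist x y powr \<alpha>" for n x y
      using dsol_abs_le[OF wz \<open>lam > 0\<close> h0 zb, of n "x - y" y] by (simp add: K0_def z0_def dist_norm)
    have b1: "\<bar>fdq (h n) i (w n) x\<bar> \<le> K1 * A" for n i x
      using dsol_gradient_bounded[OF w \<open>lam > 0\<close> h0 bd, of n i x] by (simp add: K1_def)
    have e1: "\<bar>fdq (h n) i (w n) x - fdq (h n) i (w n) y\<bar> \<le> K1 * A * dist x y powr \<alpha>" for n i x y
    proof -
      have "fdq (h n) i (z0 (w n) (x - y)) y = fdq (h n) i (w n) x - fdq (h n) i (w n) y"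
        unfolding z0_def fdq_diff fdq_shift by simp
      then show ?thesis
        using dsol_gradient_bounded[OF wz \<open>lam > 0\<close> h0 zb, of n i "x - y" y] by (simp add: K1_def dist_norm)
    qed
    have b2: "\<bar>fdq (h n) j (fdq (h n) i (w n)) x\<bar> \<le> K2 * A" for n i j x
    proof -
      have "\<bar>fdq (h n) j (fdq (h n) i (w n)) x\<bar> \<le> schauder_const \<alpha> * A * lam powr (- \<alpha> / 2)"
        by (rule dsol_second_difference_bound[OF w]) (use assms h0 A xc xb lhol_if_hoelder[OF hol h0] in auto)
      then show ?thesis by (simp add: K2_def mult_ac)
    qed
    have e2: "\<bar>fdq (h n) j (fdq (h n) i (w n)) x - fdq (h n) j (fdq (h n) i (w n)) y\<bar> \<le> K4 * A * dist x y powr (\<alpha> / 2)" for n i j x y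
    proof -
      define z where "z = x - y"
      have "\<bar>z0 \<xi> z x - z0 \<xi> z y\<bar> \<le> 2 * A * norm z powr (\<alpha> / 2) * dist x y powr (\<alpha> / 2)" for x y
      proof -
        \<comment> \<open>Interpolation: the increment is at most \<open>2 * A\<close> times
          \<open>p * p\<close>, as the translation is short, and at most \<open>2 * A\<close> times
          \<open>q * q\<close>, by the Hoelder bound between the two points. The smaller of the two
          is at most \<open>2 * A * (p * q)\<close>.\<close>
        define p where "p = norm z powr (\<alpha> / 2)"
        define q where "q = dist x y powr (\<alpha> / 2)"
        have pq: "p \<ge> 0" "q \<ge> 0" "norm z powr \<alpha> = p * p" "dist x y powr \<alpha> = q * q"
          by (auto simp: p_def q_def simp flip: powr_add)
        have 1: "\<bar>z0 \<xi> z x - z0 \<xi> z y\<bar> \<le> 2 * A * (p * p)"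
          using zb[of z x] zb[of z y] unfolding pq(3) by linarith
        have 2: "\<bar>z0 \<xi> z x - z0 \<xi> z y\<bar> \<le> 2 * A * (q * q)"
          using hol[of "x + z" "y + z"] hol[of x y] pq by (simp add: z0_def dist_norm)
        show ?thesis
        proof (cases "p \<le> q")
          case True
          then have "2 * A * (p * p) \<le> 2 * A * (p * q)" using pq A by (intro mult_left_mono) auto
          then show ?thesis using 1 by (simp add: p_def q_def mult.assoc)
        next
          case False
          then have "2 * A * (q * q) \<le> 2 * A * (p * q)" using pq A by (intro mult_left_mono mult_right_mono) auto
          then show ?thesis using 2 by (simp add: p_def q_def mult.assoc)
        qed
      qed
      note lh = lhol_if_hoelder[OF this h0]
      have zc: "continuous_on UNIV (z0 \<xi> z)"
        unfolding z0_def by (intro continuous_intros continuous_on_compose2[OF xc] xc) auto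
      have zbd: "bounded (range (z0 \<xi> z))" by (rule bounded_range_realI[OF zb])
      have "\<bar>fdq (h n) j (fdq (h n) i (z0 (w n) z)) y\<bar> \<le> schauder_const (\<alpha> / 2) * (2 * A * norm z powr (\<alpha> / 2)) * lam powr (- (\<alpha> / 2) / 2)"
        by (rule dsol_second_difference_bound[OF wz]) (use assms h0 A zc zbd lh in auto)
      moreover have "fdq (h n) j (fdq (h n) i (z0 (w n) z)) y = fdq (h n) j (fdq (h n) i (w n)) x - fdq (h n) j (fdq (h n) i (w n)) y"
        unfolding z0_def fdq_fdq_diff by (simp add: fdq_shift[abs_def] fdq_shift z_def)
      ultimately show ?thesis by (simp add: K4_def z_def dist_norm mult_ac)
    qed
    define H where "H = 4 * schauder_const \<alpha> * A * N powr \<alpha>"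
    have lh2: "lhol (h n) k \<alpha> H (fdq (h n) j (fdq (h n) i (w n)))" for n i j k
      unfolding H_def by (rule dsol_second_difference_lhol[OF w]) (use assms h0 A N xc xb lhol_if_hoelder[OF hol h0] in auto)
    define F where "F n p = fdq_jet (h n) (w n) p" for n p
    have Fper: "periodic (F n p)" for n p
      unfolding F_def by (cases "(h n, w n, p)" rule: fdq_jet.cases)
        (use dsol_periodic[OF w \<open>lam > 0\<close> h0 per] in \<open>auto intro: periodic_fdq\<close>)
    have Fb: "\<bar>F n p x\<bar> \<le> K0 * A + K1 * A + K2 * A" for n p x
    proof -
      have nn: "K0 * A \<ge> 0" "K1 * A \<ge> 0" "K2 * A \<ge> 0" using Ks A by auto
      show ?thesis unfolding F_def
      proof (cases "(h n, w n, p)" rule: fdq_jet.cases)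
        case (1 _ _ _) then show "\<bar>fdq_jet (h n) (w n) p x\<bar> \<le> K0 * A + K1 * A + K2 * A" using b0[of n x] nn by auto
      next
        case (2 _ _ i) then show "\<bar>fdq_jet (h n) (w n) p x\<bar> \<le> K0 * A + K1 * A + K2 * A" using b1[of n i x] nn by auto
      next
        case (3 _ _ i j) then show "\<bar>fdq_jet (h n) (w n) p x\<bar> \<le> K0 * A + K1 * A + K2 * A" using b2[of n j i x] nn by auto
      qed
    qed
    define Cp where "Cp p = (case p of (None, _) \<Rightarrow> K0 * A | (Some i, None) \<Rightarrow> K1 * A | (Some i, Some j) \<Rightarrow> K4 * A)"
      for p :: "'d option \<times> 'd option"
    define Gp where "Gp p = (case p of (None, _) \<Rightarrow> \<alpha> | (Some i, None) \<Rightarrow> \<alpha> | (Some i, Some j) \<Rightarrow> \<alpha> / 2)"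
      for p :: "'d option \<times> 'd option"
    have Fh: "\<bar>F n p x - F n p y\<bar> \<le> Cp p * dist x y powr Gp p" for n p x y
      unfolding F_def by (cases "(h n, w n, p)" rule: fdq_jet.cases) (use e0 e1 e2 in \<open>auto simp: Cp_def Gp_def\<close>)
    have Gp0: "Gp p > 0" for p using assms by (auto simp: Gp_def split: prod.splits option.splits)
    obtain g r where r: "strict_mono (r :: nat \<Rightarrow> nat)"
      and g: "\<And>e. e > 0 \<Longrightarrow> \<exists>M. \<forall>n\<ge>M. \<forall>p x. \<bar>F (r n) p x - g p x\<bar> < e"
      by (rule arzela_ascoli_periodic[of F, OF Fper Fb Fh Gp0]) (rule that)
    have lim: "(\<lambda>n. F (r n) p x) \<longlonglongrightarrow> g p x" for p x
    proof (rule LIMSEQ_I)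
      fix e :: real assume "e > 0"
      then obtain M where "\<forall>n\<ge>M. \<forall>p x. \<bar>F (r n) p x - g p x\<bar> < e" using g by blast
      then show "\<exists>M. \<forall>n\<ge>M. norm (F (r n) p x - g p x) < e" unfolding real_norm_def by blast
    qed
    have hr: "(\<lambda>n. h (r n)) \<longlonglongrightarrow> 0" using LIMSEQ_subseq_LIMSEQ[OF hlim r] by (simp add: o_def)
    define v where "v = g (None, None)"
    define gi where "gi i = g (Some i, None)" for i
    define gij where "gij i j = g (Some i, Some j)" for i j
    have l0: "(\<lambda>n. w (r n) x) \<longlonglongrightarrow> v x" for x using lim[of "(None, None)" x] by (simp add: F_def v_def)
    have l1: "(\<lambda>n. fdq (h (r n)) i (w (r n)) x) \<longlonglongrightarrow> gi i x" for i x using lim[of "(Some i, None)" x] by (simp add: F_def gi_def)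
    have l2: "(\<lambda>n. fdq (h (r n)) j (fdq (h (r n)) i (w (r n))) x) \<longlonglongrightarrow> gij i j x" for i j x
      using lim[of "(Some i, Some j)" x] by (simp add: F_def gij_def)
    have ghol: "\<bar>g p x - g p y\<bar> \<le> Cp p * dist x y powr Gp p" for p x y
    proof -
      have "(\<lambda>n. \<bar>F (r n) p x - F (r n) p y\<bar>) \<longlonglongrightarrow> \<bar>g p x - g p y\<bar>" by (intro tendsto_intros lim)
      then show ?thesis by (rule LIMSEQ_le_const2) (use Fh in auto)
    qed
    have gcont: "continuous_on UNIV (g p)" for p by (rule continuous_on_hoelder[OF ghol Gp0])
    have d1: "((\<lambda>t. v (x + t *\<^sub>R axis i 1)) has_real_derivative gi i x) (at 0)" for i x
      by (rule has_real_derivative_from_limit[OF l0 e0 _ l1 e1 _ hr h0]) (use assms in auto)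
    have d2: "((\<lambda>t. gi i (x + t *\<^sub>R axis j 1)) has_real_derivative gij i j x) (at 0)" for i j x
      by (rule has_real_derivative_from_limit[OF l1 e1 _ l2 e2 _ hr h0]) (use assms in auto)
    have p1: "pd i v = gi i" for i using pd_eqI[OF d1] by blast
    have p2': "pd j (gi i) = gij i j" for i j using pd_eqI[OF d2] by blast
    have p2: "pd j (pd i v) = gij i j" for i j by (simp add: p1 p2')
    have vper: "periodic v" unfolding periodic_def
    proof safe
      fix x z :: "real^'d" assume "\<forall>i. z $ i \<in> \<int>"
      then have "w n (x + z) = w n x" for n using dsol_periodic[OF w \<open>lam > 0\<close> h0 per, of n] by (simp add: periodic_def)
      then show "v (x + z) = v x" using l0[of "x + z"] l0[of x] LIMSEQ_unique by simp
    qed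
    have "torus_C2 v" unfolding torus_C2_def C2_fun_def C1_fun_def p1 p2'
      using vper d1 d2 gcont by (auto simp: v_def gi_def gij_def)
    moreover have "- lap v x + lam * v x = \<xi> x" for x
    proof -
      \<comment> \<open>The centred second difference is the iterated forward quotient at a point
        shifted back by one mesh width. The shift disappears in the limit by the equicontinuity of
        the second differences.\<close>
      have dl: "dlap (h n) (w n) x = (\<Sum>i\<in>UNIV. fdq (h n) i (fdq (h n) i (w n)) (x - h n *\<^sub>R axis i 1))" for n
        unfolding dlap_def fdq_def sum_divide_distrib by (rule sum.cong) (auto simp: power2_eq_square diff_divide_distrib add_divide_distrib)
      have "(\<lambda>n. fdq (h (r n)) i (fdq (h (r n)) i (w (r n))) (x - h (r n) *\<^sub>R axis i 1)) \<longlonglongrightarrow> gij i i x" for i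
        by (rule equi_hoelder_tendsto[OF l2 e2]) (use assms tendsto_diff[OF tendsto_const tendsto_scaleR[OF hr tendsto_const], of x "axis i 1"] in auto)
      then have "(\<lambda>n. dlap (h (r n)) (w (r n)) x) \<longlonglongrightarrow> (\<Sum>i\<in>UNIV. gij i i x)"
        unfolding dl by (intro tendsto_sum)
      then have "(\<lambda>n. lam * w (r n) x - dlap (h (r n)) (w (r n)) x) \<longlonglongrightarrow> lam * v x - (\<Sum>i\<in>UNIV. gij i i x)"
        by (intro tendsto_intros l0)
      moreover have "lam * w (r n) x - dlap (h (r n)) (w (r n)) x = \<xi> x" for n using w by (simp add: dsol_def)
      ultimately have "\<xi> x = lam * v x - (\<Sum>i\<in>UNIV. gij i i x)" using LIMSEQ_unique[OF tendsto_const] by simp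
      then show ?thesis by (simp add: lap_def p2)
    qed
    moreover have KA: "K0 * A \<le> K * A" "K1 * A \<le> K * A" "K2 * A \<le> K * A" "K3 * A \<le> K * A"
      using Ks A by (auto intro!: mult_right_mono simp: K_def)
    moreover have "\<bar>v x\<bar> \<le> K0 * A" for x
      by (rule LIMSEQ_le_const2[OF tendsto_rabs[OF l0]]) (use b0 in auto)
    then have "\<bar>v x\<bar> \<le> K * A" for x using KA(1) order_trans by blast
    moreover have "\<bar>gi i x\<bar> \<le> K1 * A" for i x
      by (rule LIMSEQ_le_const2[OF tendsto_rabs[OF l1]]) (use b1 in auto)
    then have "\<bar>pd i v x\<bar> \<le> K * A" for i x unfolding p1 using KA(2) order_trans by blast
    moreover have "\<bar>gij i j x\<bar> \<le> K2 * A" for i j x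
      by (rule LIMSEQ_le_const2[OF tendsto_rabs[OF l2]]) (use b2 in auto)
    then have "\<bar>pd j (pd i v) x\<bar> \<le> K * A" for i j x unfolding p2 using KA(3) order_trans by blast
    moreover have "\<bar>gij i j x - gij i j y\<bar> \<le> K3 * A * dist x y powr \<alpha>" for i j x y
    proof -
      \<comment> \<open>The sharp exponent returns here: the lattice estimate passes to the limit
        along each axis, and a coordinate path joins arbitrary points, whence the dimension in
        \<open>K3\<close>.\<close>
      have "\<bar>gij i j (x + t *\<^sub>R axis k 1) - gij i j x\<bar> \<le> H * \<bar>t\<bar> powr \<alpha>" for k x t
        by (rule lhol_limit[OF l2 e2 _ hr h0 lh2]) (use assms in auto)
      from axis_path_bound[where \<phi> = "\<lambda>k t. H * t powr \<alpha>", OF this]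
      have "\<bar>gij i j x - gij i j y\<bar> \<le> (\<Sum>k\<in>UNIV. H * \<bar>x $ k - y $ k\<bar> powr \<alpha>)" .
      also have "\<dots> \<le> (\<Sum>k\<in>(UNIV::'d set). H * dist x y powr \<alpha>)"
      proof (intro sum_mono mult_left_mono powr_mono2)
        show "\<bar>x $ k - y $ k\<bar> \<le> dist x y" for k
          using component_le_norm_cart[of "x - y" k] by (simp add: dist_norm)
        show "0 \<le> H" unfolding H_def using A assms schauder_const_pos[of \<alpha>] by simp
      qed (use assms in auto)
      finally show ?thesis by (simp add: K3_def H_def mult_ac)
    qed
    then have "\<bar>pd j (pd i v) x - pd j (pd i v) y\<bar> \<le> K * A * dist x y powr \<alpha>" for i j x y unfolding p2
      using mult_right_mono[OF KA(4), of "dist x y powr \<alpha>"] order_trans powr_ge_zero by blast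
    ultimately show ?thesis by blast
  qed
  moreover have "K > 0" using Ks by (simp add: K_def)
  ultimately show ?thesis by metis
qed

section \<open>Calculus in the spaces $C^{0,\alpha}$ and $C^{2,\alpha}$\<close>

lemma pd_derivative:
  "C1_fun u \<Longrightarrow> ((\<lambda>t. u (x + t *\<^sub>R axis i 1)) has_real_derivative pd i u x) (at 0)"
  by (simp add: C1_fun_def)

lemma C1_fun_cont: "C1_fun u \<Longrightarrow> continuous_on UNIV u"
  by (simp add: C1_fun_def)

lemma pd_cont: "C1_fun u \<Longrightarrow> continuous_on UNIV (pd i u)"
  by (simp add: C1_fun_def)

lemma pd_derivative_at:
  assumes "C1_fun u"
  shows "((\<lambda>t. u (x + t *\<^sub>R axis i 1)) has_real_derivative pd i u (x + s *\<^sub>R axis i 1)) (at s)"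
proof -
  have "((\<lambda>t. u ((x + s *\<^sub>R axis i 1) + t *\<^sub>R axis i 1)) has_real_derivative pd i u (x + s *\<^sub>R axis i 1)) (at 0)"
    by (rule pd_derivative[OF assms])
  then have "((\<lambda>t. u (x + (s + t) *\<^sub>R axis i 1)) has_real_derivative pd i u (x + s *\<^sub>R axis i 1)) (at 0)"
    by (simp add: scaleR_left_distrib add.assoc)
  then show ?thesis using DERIV_at_within_shift[of "\<lambda>t. u (x + t *\<^sub>R axis i 1)" "pd i u (x + s *\<^sub>R axis i 1)" s 0 UNIV] by simp
qed

lemma C1_funI:
  assumes "continuous_on UNIV u"
    and d: "\<And>i x. ((\<lambda>t. u (x + t *\<^sub>R axis i 1)) has_real_derivative D i x) (at 0)"
    and "\<And>i. continuous_on UNIV (D i)"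
  shows "C1_fun u \<and> (\<forall>i. pd i u = D i)"
proof -
  have "pd i u = D i" for i using pd_eqI[OF d] by blast
  then show ?thesis using assms by (simp add: C1_fun_def)
qed

lemma C1_lincomb:
  assumes u: "C1_fun u" and v: "C1_fun v"
  shows "C1_fun (\<lambda>x. a * u x + b * v x) \<and> (\<forall>i. pd i (\<lambda>x. a * u x + b * v x) = (\<lambda>x. a * pd i u x + b * pd i v x))"
  by (rule C1_funI; intro continuous_intros C1_fun_cont pd_cont u v derivative_intros DERIV_cmult DERIV_add pd_derivative)

lemma C1_mult:
  assumes u: "C1_fun u" and v: "C1_fun v"
  shows "C1_fun (\<lambda>x. u x * v x) \<and> (\<forall>i. pd i (\<lambda>x. u x * v x) = (\<lambda>x. pd i u x * v x + u x * pd i v x))"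
proof (rule C1_funI)
  show "((\<lambda>t. u (x + t *\<^sub>R axis i 1) * v (x + t *\<^sub>R axis i 1)) has_real_derivative pd i u x * v x + u x * pd i v x) (at 0)" for i x
    using DERIV_mult[OF pd_derivative[OF u, of x i] pd_derivative[OF v, of x i]] by (simp add: algebra_simps)
qed (intro continuous_intros C1_fun_cont pd_cont u v)+

lemma C1_compose:
  assumes u: "C1_fun u" and F: "\<And>s. (F has_real_derivative F' s) (at s)" and F': "continuous_on UNIV F'"
  shows "C1_fun (\<lambda>x. F (u x)) \<and> (\<forall>i. pd i (\<lambda>x. F (u x)) = (\<lambda>x. F' (u x) * pd i u x))"
proof (rule C1_funI)
  show "((\<lambda>t. F (u (x + t *\<^sub>R axis i 1))) has_real_derivative F' (u x) * pd i u x) (at 0)" for i x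
    using DERIV_chain2[of F "F' (u x)" "\<lambda>t. u (x + t *\<^sub>R axis i 1)" 0 "pd i u x" UNIV] F pd_derivative[OF u] by simp
  have "continuous_on UNIV F" using F by (meson DERIV_continuous_on has_field_derivative_at_within)
  then show "continuous_on UNIV (\<lambda>x. F (u x))"
    by (rule continuous_on_compose2) (auto intro: C1_fun_cont u)
  have "continuous_on UNIV (\<lambda>x. F' (u x))"
    by (rule continuous_on_compose2[OF F']) (auto intro: C1_fun_cont u)
  then show "continuous_on UNIV (\<lambda>x. F' (u x) * pd i u x)" for i by (intro continuous_intros pd_cont u)
qed

lemma torus_C2_C1: "torus_C2 u \<Longrightarrow> C1_fun u" "torus_C2 u \<Longrightarrow> C1_fun (pd i u)"
  by (auto simp: torus_C2_def C2_fun_def)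

lemma torus_C2_periodic: "torus_C2 u \<Longrightarrow> periodic u"
  by (simp add: torus_C2_def)

lemma periodic_pd:
  fixes u :: "real^'a::finite \<Rightarrow> real"
  assumes p: "periodic u"
  shows "periodic (pd i u)"
proof -
  have "pd i u (x + z) = pd i u x" if z: "\<forall>i. z $ i \<in> \<int>" for x z :: "real^'a"
  proof -
    have "u (x + z + t *\<^sub>R axis i 1) = u (x + t *\<^sub>R axis i 1)" for t
      using p z unfolding periodic_def by (metis add.assoc add.commute)
    then show ?thesis by (simp add: pd_def)
  qed
  then show ?thesis by (simp add: periodic_def)
qed

text \<open>The continuum counterpart of \<open>fdq_jet\<close>: a statement about all derivatives
  up to order two becomes a single quantifier over the index.\<close>

fun pjet :: "(real^'d::finite \<Rightarrow> real) \<Rightarrow> 'd option \<times> 'd option \<Rightarrow> real^'d \<Rightarrow> real" where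
  "pjet u (None, _) = u"
| "pjet u (Some i, None) = pd i u"
| "pjet u (Some i, Some j) = pd j (pd i u)"

lemma periodic_pjet: "periodic u \<Longrightarrow> periodic (pjet u p)"
  by (cases "(u, p)" rule: pjet.cases) (auto intro: periodic_pd)

lemma continuous_pjet: "torus_C2 u \<Longrightarrow> continuous_on UNIV (pjet u p)"
  by (cases "(u, p)" rule: pjet.cases) (auto intro: C1_fun_cont pd_cont torus_C2_C1)

lemma torus_C2_lincomb:
  assumes u: "torus_C2 u" and v: "torus_C2 v"
  shows "torus_C2 (\<lambda>x. a * u x + b * v x)"
    and pjet_lincomb: "pjet (\<lambda>x. a * u x + b * v x) p = (\<lambda>x. a * pjet u p x + b * pjet v p x)"
proof -
  note 1 = C1_lincomb[OF torus_C2_C1(1)[OF u] torus_C2_C1(1)[OF v], of a b]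
  note 2 = C1_lincomb[OF torus_C2_C1(2)[OF u] torus_C2_C1(2)[OF v], where a = a and b = b]
  show "torus_C2 (\<lambda>x. a * u x + b * v x)"
    using 1 2 torus_C2_periodic[OF u] torus_C2_periodic[OF v]
    by (auto simp: torus_C2_def C2_fun_def periodic_def)
  show "pjet (\<lambda>x. a * u x + b * v x) p = (\<lambda>x. a * pjet u p x + b * pjet v p x)"
    by (cases "(u, p)" rule: pjet.cases) (use 1 2 in auto)
qed

lemma torus_C2_diff:
  assumes u: "torus_C2 u" and v: "torus_C2 v"
  shows "torus_C2 (\<lambda>x. u x - v x)" and pjet_diff: "pjet (\<lambda>x. u x - v x) p x = pjet u p x - pjet v p x"
  using torus_C2_lincomb[OF u v, of 1 "-1"] pjet_lincomb[OF u v, of 1 "-1" p] by simp_all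

section \<open>Compactness of the torus, maximum principle and uniqueness for the resolvent
  equation\<close>

lemma periodic_bounded:
  assumes "periodic u" "continuous_on UNIV u"
  shows "\<exists>B. \<forall>x. \<bar>u x\<bar> \<le> B"
proof -
  have "compact (u ` cbox 0 1)" using assms by (meson compact_cbox compact_continuous_image continuous_on_subset subset_UNIV)
  then obtain B where B: "\<And>y. y \<in> u ` cbox 0 1 \<Longrightarrow> \<bar>y\<bar> \<le> B"
    using compact_imp_bounded bounded_iff by (metis real_norm_def)
  have "\<bar>u x\<bar> \<le> B" for x
  proof -
    obtain z where "u x = u z" "z \<in> cbox 0 1" using periodic_reduce[of x] assms by metis
    then show ?thesis using B by simp
  qed
  then show ?thesis by blast
qed

lemma periodic_attains_max:
  fixes u :: "real^'d::finite \<Rightarrow> real"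
  assumes "periodic u" "continuous_on UNIV u"
  shows "\<exists>x0. \<forall>x. u x \<le> u x0"
proof -
  have "cbox 0 (1::real^'d) \<noteq> {}" using periodic_reduce by blast
  then obtain x0 where x0: "\<And>y. y \<in> cbox 0 1 \<Longrightarrow> u y \<le> u x0"
    using continuous_attains_sup[of "cbox 0 (1::real^'d)" u] assms
    by (metis compact_cbox continuous_on_subset subset_UNIV)
  have "u x \<le> u x0" for x
  proof -
    obtain z where "u x = u z" "z \<in> cbox 0 1" using periodic_reduce[of x] assms by metis
    then show ?thesis using x0 by simp
  qed
  then show ?thesis by blast
qed

text \<open>On the axis line through a maximum point the first derivative vanishes. A positive
  second derivative would make it positive just to the right, and the function would exceed its
  maximum.\<close>

lemma second_derivative_at_max:
  assumes u: "torus_C2 u" and max: "\<And>y. u y \<le> u x"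
  shows "pd i (pd i u) x \<le> 0"
proof (rule ccontr)
  assume "\<not> ?thesis"
  then have pos: "pd i (pd i u) x > 0" by simp
  define \<phi> where "\<phi> t = u (x + t *\<^sub>R axis i 1)" for t
  define \<phi>' where "\<phi>' t = pd i u (x + t *\<^sub>R axis i 1)" for t
  have d1: "(\<phi> has_real_derivative \<phi>' t) (at t)" for t
    unfolding \<phi>_def \<phi>'_def by (rule pd_derivative_at[OF torus_C2_C1(1)[OF u]])
  have d2: "(\<phi>' has_real_derivative pd i (pd i u) x) (at 0)"
    unfolding \<phi>'_def by (rule pd_derivative[OF torus_C2_C1(2)[OF u]])
  have "\<phi>' 0 = 0"
    by (rule DERIV_local_max[OF d1[of 0], of 1]) (auto simp: \<phi>_def max)
  then obtain d where d: "d > 0" "\<And>h. 0 < h \<Longrightarrow> h < d \<Longrightarrow> \<phi>' h > 0"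
    using DERIV_pos_inc_right[OF d2 pos] by auto
  obtain z where z: "0 < z" "z < d / 2" "\<phi> (d / 2) - \<phi> 0 = (d / 2 - 0) * \<phi>' z"
    using MVT2[of 0 "d / 2" \<phi> \<phi>'] d1 d by auto
  have "\<phi>' z > 0" using d z by auto
  then have "(d / 2 - 0) * \<phi>' z > 0" using d by simp
  then have "\<phi> (d / 2) > \<phi> 0" using z by linarith
  then show False using max[of "x + (d / 2) *\<^sub>R axis i 1"] by (simp add: \<phi>_def)
qed

lemma resolvent_maximum_principle:
  assumes w: "torus_C2 w" and "lam > 0" and "\<And>x. - lap w x + lam * w x \<le> 0"
  shows "w x \<le> 0"
proof -
  obtain x0 where x0: "\<And>x. w x \<le> w x0"
    using periodic_attains_max[of w] torus_C2_periodic[OF w] C1_fun_cont[OF torus_C2_C1(1)[OF w]] by blast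
  have "lap w x0 \<le> 0" unfolding lap_def by (intro sum_nonpos second_derivative_at_max[OF w x0])
  then have "lam * w x0 \<le> 0" using assms(3)[of x0] by linarith
  then have "w x0 \<le> 0" using \<open>lam > 0\<close> by (simp add: mult_le_0_iff)
  then show ?thesis using x0[of x] by linarith
qed

lemma lap_pjet: "lap u x = (\<Sum>i\<in>UNIV. pjet u (Some i, Some i) x)"
  by (simp add: lap_def)

lemma lap_lincomb:
  assumes "torus_C2 u" "torus_C2 v"
  shows "lap (\<lambda>x. a * u x + b * v x) x = a * lap u x + b * lap v x"
  unfolding lap_pjet pjet_lincomb[OF assms] by (simp add: sum.distrib sum_distrib_left)

lemma lap_diff:
  assumes "torus_C2 u" "torus_C2 v"
  shows "lap (\<lambda>x. u x - v x) x = lap u x - lap v x"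
  using lap_lincomb[OF assms, of 1 "-1"] by simp

text \<open>Together with existence this gives the definite description in \<open>Tsolve\<close> an
  actual value.\<close>

lemma resolvent_unique:
  assumes v: "torus_C2 v" and w: "torus_C2 w" and "lam > 0"
    and "\<And>x. - lap v x + lam * v x = \<xi> x" "\<And>x. - lap w x + lam * w x = \<xi> x"
  shows "v = w"
proof
  fix x
  have "v x - w x \<le> 0"
    by (rule resolvent_maximum_principle[OF torus_C2_diff(1)[OF v w] \<open>lam > 0\<close>])
      (use assms(4,5) in \<open>simp add: lap_diff[OF v w] right_diff_distrib algebra_simps\<close>)
  moreover have "w x - v x \<le> 0"
    by (rule resolvent_maximum_principle[OF torus_C2_diff(1)[OF w v] \<open>lam > 0\<close>])
      (use assms(4,5) in \<open>simp add: lap_diff[OF w v] right_diff_distrib algebra_simps\<close>)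
  ultimately show "v x = w x" by simp
qed

text \<open>
  Estimates are phrased as bounds on all quantities entering a norm: \<open>hbd\<close> for $C^{0,\alpha}$,
  \<open>c2bd\<close> for $C^2$ and \<open>c2abd\<close> for $C^{2,\alpha}$.
\<close>

definition hbd :: "real \<Rightarrow> (real^'d::finite \<Rightarrow> real) \<Rightarrow> real \<Rightarrow> bool" where
  "hbd \<alpha> g A \<longleftrightarrow> periodic g \<and> (\<forall>x. \<bar>g x\<bar> \<le> A) \<and> (\<forall>x y. \<bar>g x - g y\<bar> \<le> A * dist x y powr \<alpha>)"

definition c2bd :: "(real^'d::finite \<Rightarrow> real) \<Rightarrow> real \<Rightarrow> bool" where
  "c2bd u A \<longleftrightarrow> torus_C2 u \<and> (\<forall>p x. \<bar>pjet u p x\<bar> \<le> A)"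

definition c2abd :: "real \<Rightarrow> (real^'d::finite \<Rightarrow> real) \<Rightarrow> real \<Rightarrow> bool" where
  "c2abd \<alpha> u A \<longleftrightarrow> c2bd u A \<and> (\<forall>i j. hbd \<alpha> (pd j (pd i u)) A)"

lemma hbd_nonneg: "hbd \<alpha> g A \<Longrightarrow> A \<ge> 0"
  unfolding hbd_def by (meson abs_ge_zero order_trans)

lemma c2bd_nonneg: "c2bd u A \<Longrightarrow> A \<ge> 0"
  unfolding c2bd_def by (meson abs_ge_zero order_trans)

lemma hbd_abs: "hbd \<alpha> g A \<Longrightarrow> \<bar>g x\<bar> \<le> A"
  by (simp add: hbd_def)

lemma hbd_mono:
  assumes "hbd \<alpha> g A" "A \<le> B" shows "hbd \<alpha> g B"
  using assms unfolding hbd_def by (meson mult_right_mono order_trans powr_ge_zero)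

lemma hbd_add:
  assumes "hbd \<alpha> g A" "hbd \<alpha> k B"
  shows "hbd \<alpha> (\<lambda>x. g x + k x) (A + B)"
  unfolding hbd_def
proof safe
  show "periodic (\<lambda>x. g x + k x)" using assms by (simp add: hbd_def periodic_def)
  show "\<bar>g x + k x\<bar> \<le> A + B" for x using hbd_abs[OF assms(1), of x] hbd_abs[OF assms(2), of x] by linarith
  fix x y
  have "\<bar>g x - g y\<bar> \<le> A * dist x y powr \<alpha>" "\<bar>k x - k y\<bar> \<le> B * dist x y powr \<alpha>" using assms by (auto simp: hbd_def)
  then show "\<bar>g x + k x - (g y + k y)\<bar> \<le> (A + B) * dist x y powr \<alpha>" unfolding distrib_right by linarith
qed

lemma hbd_cmult:
  assumes "hbd \<alpha> g A"
  shows "hbd \<alpha> (\<lambda>x. c * g x) (\<bar>c\<bar> * A)"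
  unfolding hbd_def
proof safe
  show "periodic (\<lambda>x. c * g x)" using assms by (simp add: hbd_def periodic_def)
  show "\<bar>c * g x\<bar> \<le> \<bar>c\<bar> * A" for x using hbd_abs[OF assms, of x] by (simp add: abs_mult mult_left_mono)
  fix x y
  have "\<bar>g x - g y\<bar> \<le> A * dist x y powr \<alpha>" using assms by (auto simp: hbd_def)
  then have "\<bar>c\<bar> * \<bar>g x - g y\<bar> \<le> \<bar>c\<bar> * (A * dist x y powr \<alpha>)" by (intro mult_left_mono) auto
  then show "\<bar>c * g x - c * g y\<bar> \<le> \<bar>c\<bar> * A * dist x y powr \<alpha>"
    by (simp add: abs_mult mult.assoc flip: right_diff_distrib)
qed

lemma hbd_uminus: "hbd \<alpha> g A \<Longrightarrow> hbd \<alpha> (\<lambda>x. - g x) A"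
  using hbd_cmult[of \<alpha> g A "-1"] by simp

lemma hbd_diff: "hbd \<alpha> g A \<Longrightarrow> hbd \<alpha> k B \<Longrightarrow> hbd \<alpha> (\<lambda>x. g x - k x) (A + B)"
  using hbd_add[OF _ hbd_uminus, of \<alpha> g A k B] by simp

lemma hbd_mult:
  fixes g k :: "real^'d::finite \<Rightarrow> real"
  assumes g: "hbd \<alpha> g A" and k: "hbd \<alpha> k B"
  shows "hbd \<alpha> (\<lambda>x. g x * k x) (2 * A * B)"
  unfolding hbd_def
proof safe
  have A: "A \<ge> 0" "B \<ge> 0" using assms hbd_nonneg by auto
  show "periodic (\<lambda>x. g x * k x)" using assms by (simp add: hbd_def periodic_def)
  show "\<bar>g x * k x\<bar> \<le> 2 * A * B" for x
  proof -
    have "\<bar>g x\<bar> * \<bar>k x\<bar> \<le> A * B" using hbd_abs[OF g, of x] hbd_abs[OF k, of x] A by (intro mult_mono) auto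
    moreover have "A * B \<ge> 0" using A by simp
    ultimately show ?thesis unfolding abs_mult by linarith
  qed
  fix x y :: "real^'d"
  define r where "r = dist x y powr \<alpha>"
  have 1: "\<bar>g x - g y\<bar> \<le> A * r" "\<bar>k x - k y\<bar> \<le> B * r" using assms by (auto simp: hbd_def r_def)
  have "\<bar>g x * k x - g y * k y\<bar> \<le> \<bar>g x\<bar> * \<bar>k x - k y\<bar> + \<bar>g x - g y\<bar> * \<bar>k y\<bar>"
  proof -
    have "g x * k x - g y * k y = g x * (k x - k y) + (g x - g y) * k y" by (simp add: algebra_simps)
    then show ?thesis by (metis abs_mult abs_triangle_ineq)
  qed
  also have "\<dots> \<le> A * (B * r) + (A * r) * B"
    using 1 A hbd_abs[OF g, of x] hbd_abs[OF k, of y] by (intro add_mono mult_mono) (auto simp: r_def)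
  finally show "\<bar>g x * k x - g y * k y\<bar> \<le> 2 * A * B * dist x y powr \<alpha>" by (simp add: r_def algebra_simps)
qed

lemma hbd_sum:
  assumes "finite I" "\<And>i. i \<in> I \<Longrightarrow> hbd \<alpha> (g i) (A i)"
  shows "hbd \<alpha> (\<lambda>x. \<Sum>i\<in>I. g i x) (\<Sum>i\<in>I. A i)"
  using assms
proof induction
  case empty
  show ?case by (simp add: hbd_def periodic_def)
next
  case (insert i I)
  then show ?case using hbd_add[of \<alpha> "g i" "A i" "\<lambda>x. \<Sum>i\<in>I. g i x"] by simp
qed

text \<open>At distance at most 1 the Lipschitz bound implies the Hoelder bound, at larger distance
  the supremum bound does. The dimension comes from the coordinate path, the 2 from a difference of
  two values. The factor \<open>real CARD('d) + 2\<close> in later constants originates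
  here.\<close>

lemma hbd_of_C1:
  fixes b :: "real^'d::finite \<Rightarrow> real"
  assumes b: "C1_fun b" "periodic b" and bd: "\<And>x. \<bar>b x\<bar> \<le> A" "\<And>i x. \<bar>pd i b x\<bar> \<le> A" and \<alpha>: "0 < \<alpha>" "\<alpha> < 1"
  shows "hbd \<alpha> b ((real CARD('d) + 2) * A)"
proof -
  have A: "A \<ge> 0" using bd(1)[of 0] by linarith
  have ax: "\<bar>b (x + t *\<^sub>R axis k 1) - b x\<bar> \<le> A * \<bar>t\<bar>" for k x t
    using field_differentiable_bound[of UNIV "\<lambda>t. b (x + t *\<^sub>R axis k 1)" "\<lambda>t. pd k b (x + t *\<^sub>R axis k 1)" A t 0]
      pd_derivative_at[OF b(1)] bd(2) by simp
  have lip: "\<bar>b x - b y\<bar> \<le> real CARD('d) * A * dist x y" for x y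
  proof -
    have "\<bar>b x - b y\<bar> \<le> (\<Sum>k\<in>UNIV. A * \<bar>x $ k - y $ k\<bar>)"
      by (rule axis_path_bound[where \<phi> = "\<lambda>k t. A * t", OF ax])
    also have "\<dots> \<le> (\<Sum>k\<in>(UNIV::'d set). A * dist x y)"
    proof (intro sum_mono mult_left_mono)
      show "\<bar>x $ k - y $ k\<bar> \<le> dist x y" for k
        using component_le_norm_cart[of "x - y" k] by (simp add: dist_norm)
    qed (use A in auto)
    finally show ?thesis by simp
  qed
  have "\<bar>b x - b y\<bar> \<le> (real CARD('d) + 2) * A * dist x y powr \<alpha>" for x y
  proof (cases "dist x y \<le> 1")
    case True
    have "dist x y \<le> dist x y powr \<alpha>"
      using True \<alpha> powr_mono'[of \<alpha> 1 "dist x y"] by (cases "x = y") auto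
    then have "real CARD('d) * A * dist x y \<le> real CARD('d) * A * dist x y powr \<alpha>" using A by (intro mult_left_mono) auto
    also have "\<dots> \<le> (real CARD('d) + 2) * A * dist x y powr \<alpha>" using A by (intro mult_right_mono) auto
    finally show ?thesis using lip[of x y] by linarith
  next
    case False
    have "1 \<le> dist x y powr \<alpha>" using False \<alpha> by (simp add: ge_one_powr_ge_zero)
    then have "2 * A * 1 \<le> (real CARD('d) + 2) * A * dist x y powr \<alpha>" using A by (intro mult_mono) auto
    then show ?thesis using bd(1)[of x] bd(1)[of y] by linarith
  qed
  moreover have "\<bar>b x\<bar> \<le> (real CARD('d) + 2) * A" for x
    using bd(1)[of x] mult_right_mono[OF _ A, of 1 "real CARD('d) + 2"] by simp
  ultimately show ?thesis using b by (simp add: hbd_def)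
qed

lemma c2abd_mono:
  assumes "c2abd \<alpha> u A" "A \<le> B" shows "c2abd \<alpha> u B"
  using assms hbd_mono order_trans unfolding c2abd_def c2bd_def by blast

lemma c2abd_c2bd: "c2abd \<alpha> u A \<Longrightarrow> c2bd u A"
  by (simp add: c2abd_def)

lemma c2bdD:
  fixes w :: "real^'d::finite \<Rightarrow> real"
  assumes "c2bd w A"
  shows "torus_C2 w" "\<bar>w x\<bar> \<le> A" "\<bar>pd i w x\<bar> \<le> A" "\<bar>pd j (pd i w) x\<bar> \<le> A"
proof -
  have *: "\<bar>pjet w p x\<bar> \<le> A" for p using assms unfolding c2bd_def by blast
  show "\<bar>w x\<bar> \<le> A" "\<bar>pd i w x\<bar> \<le> A" "\<bar>pd j (pd i w) x\<bar> \<le> A"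
    using *[of "(None, None)"] *[of "(Some i, None)"] *[of "(Some i, Some j)"] by auto
qed (use assms in \<open>simp add: c2bd_def\<close>)

lemma c2bd_hbd:
  fixes w :: "real^'d::finite \<Rightarrow> real"
  assumes w: "c2bd w A" and \<alpha>: "0 < \<alpha>" "\<alpha> < 1"
  shows "hbd \<alpha> w ((real CARD('d) + 2) * A)" "hbd \<alpha> (pd i w) ((real CARD('d) + 2) * A)"
  by (rule hbd_of_C1; use c2bdD[OF w] \<alpha> torus_C2_C1 torus_C2_periodic periodic_pd in blast)+

lemma c2bd_lincomb:
  assumes u: "c2bd u A" and v: "c2bd v B"
  shows "c2bd (\<lambda>x. a * u x + b * v x) (\<bar>a\<bar> * A + \<bar>b\<bar> * B)"
  unfolding c2bd_def
proof safe
  have tu: "torus_C2 u" and tv: "torus_C2 v" using assms by (auto simp: c2bd_def)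
  show "torus_C2 (\<lambda>x. a * u x + b * v x)" by (rule torus_C2_lincomb(1)[OF tu tv])
  fix p q x
  have 1: "\<bar>pjet u (p, q) x\<bar> \<le> A" "\<bar>pjet v (p, q) x\<bar> \<le> B" using assms unfolding c2bd_def by blast+
  have "\<bar>a * pjet u (p, q) x + b * pjet v (p, q) x\<bar> \<le> \<bar>a\<bar> * \<bar>pjet u (p, q) x\<bar> + \<bar>b\<bar> * \<bar>pjet v (p, q) x\<bar>"
    by (metis abs_mult abs_triangle_ineq)
  also have "\<dots> \<le> \<bar>a\<bar> * A + \<bar>b\<bar> * B" using 1 by (intro add_mono mult_left_mono) auto
  finally show "\<bar>pjet (\<lambda>x. a * u x + b * v x) (p, q) x\<bar> \<le> \<bar>a\<bar> * A + \<bar>b\<bar> * B"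
    unfolding pjet_lincomb[OF tu tv] .
qed

section \<open>Comparison of the bounds with the Hoelder spaces and their norms\<close>

lemma C0a_iff_hbd:
  fixes g :: "real^'d::finite \<Rightarrow> real"
  assumes "0 < \<alpha>"
  shows "C0a \<alpha> g \<longleftrightarrow> (\<exists>A. hbd \<alpha> g A)"
proof
  assume g: "C0a \<alpha> g"
  then obtain C where C: "\<And>x y. \<bar>g x - g y\<bar> \<le> C * dist x y powr \<alpha>" by (auto simp: C0a_def holder_cont_def)
  obtain B where B: "\<And>x. \<bar>g x\<bar> \<le> B" using periodic_bounded g unfolding C0a_def by blast
  have "hbd \<alpha> g (max B C)"
    unfolding hbd_def
  proof safe
    fix x y :: "real^'d"
    have "C * dist x y powr \<alpha> \<le> max B C * dist x y powr \<alpha>" by (intro mult_right_mono) auto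
    then show "\<bar>g x - g y\<bar> \<le> max B C * dist x y powr \<alpha>" using C[of x y] by linarith
  qed (use g B in \<open>auto simp: C0a_def max.coboundedI1\<close>)
  then show "\<exists>A. hbd \<alpha> g A" by blast
next
  assume "\<exists>A. hbd \<alpha> g A"
  then obtain A where A: "hbd \<alpha> g A" by blast
  then have "continuous_on UNIV g" unfolding hbd_def using continuous_on_hoelder assms by blast
  then show "C0a \<alpha> g" using A unfolding C0a_def hbd_def holder_cont_def by blast
qed

lemma c2abd_imp_C2a:
  fixes u :: "real^'d::finite \<Rightarrow> real"
  assumes "c2abd \<alpha> u A"
  shows "C2a \<alpha> u"
  using assms unfolding c2abd_def c2bd_def C2a_def hbd_def holder_cont_def by blast

lemma sup_norm_bound:
  assumes "periodic g" "continuous_on UNIV g"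
  shows "\<bar>g x\<bar> \<le> sup_norm g"
proof -
  obtain B where "\<And>x. \<bar>g x\<bar> \<le> B" using periodic_bounded[OF assms] by blast
  then have "bdd_above (range (\<lambda>x. \<bar>g x\<bar>))" by (intro bdd_aboveI[of _ B]) auto
  then show ?thesis unfolding sup_norm_def by (intro cSup_upper) auto
qed

lemma sup_norm_least: "(\<And>x. \<bar>g x\<bar> \<le> B) \<Longrightarrow> sup_norm g \<le> B"
  unfolding sup_norm_def by (rule cSup_least) auto

lemma holder_semi_bound:
  fixes g :: "real^'d::finite \<Rightarrow> real"
  assumes "holder_cont \<alpha> g"
  shows "\<bar>g x - g y\<bar> \<le> holder_semi \<alpha> g * dist x y powr \<alpha>"
proof (cases "x = y")
  case False
  obtain C where C: "\<And>x y. \<bar>g x - g y\<bar> \<le> C * dist x y powr \<alpha>" using assms by (auto simp: holder_cont_def)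
  have "bdd_above {\<bar>g x - g y\<bar> / dist x y powr \<alpha> | x y. x \<noteq> y}"
    by (rule bdd_aboveI[of _ C]) (use C in \<open>auto simp: pos_divide_le_eq\<close>)
  then have "\<bar>g x - g y\<bar> / dist x y powr \<alpha> \<le> holder_semi \<alpha> g"
    unfolding holder_semi_def using False by (intro cSup_upper) auto
  then show ?thesis using False by (simp add: pos_divide_le_eq)
qed simp

lemma holder_semi_least:
  fixes g :: "real^'d::finite \<Rightarrow> real"
  assumes "\<And>x y. \<bar>g x - g y\<bar> \<le> C * dist x y powr \<alpha>"
  shows "holder_semi \<alpha> g \<le> C"
  unfolding holder_semi_def
proof (rule cSup_least)
  have "(0::real^'d) \<noteq> axis undefined 1" by (metis axis_eq_0_iff zero_neq_one)
  then show "{\<bar>g x - g y\<bar> / dist x y powr \<alpha> | x y. x \<noteq> y} \<noteq> {}" by blast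
qed (use assms in \<open>auto simp: pos_divide_le_eq\<close>)

lemma C2aD:
  assumes "C2a \<alpha> u"
  shows "torus_C2 u" "holder_cont \<alpha> (pd j (pd i u))"
  using assms by (auto simp: C2a_def)

lemma sup_norm_nonneg: "periodic g \<Longrightarrow> continuous_on UNIV g \<Longrightarrow> sup_norm g \<ge> 0"
  using sup_norm_bound[of g 0] by (meson abs_ge_zero order_trans)

lemma holder_semi_nonneg:
  fixes g :: "real^'d::finite \<Rightarrow> real"
  assumes "holder_cont \<alpha> g" shows "holder_semi \<alpha> g \<ge> 0"
proof -
  have "0 \<le> holder_semi \<alpha> g * dist (axis undefined 1 :: real^'d) 0 powr \<alpha>"
    using holder_semi_bound[OF assms, of "axis undefined 1" 0] by (meson abs_ge_zero order_trans)
  then show ?thesis by (simp add: dist_norm)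
qed

lemma norm2a_pjet:
  fixes u :: "real^'d::finite \<Rightarrow> real"
  shows "norm2a \<alpha> u = sup_norm (pjet u (None, None)) + (\<Sum>i\<in>UNIV. sup_norm (pjet u (Some i, None)))
     + (\<Sum>i\<in>UNIV. \<Sum>j\<in>UNIV. sup_norm (pjet u (Some i, Some j)) + holder_semi \<alpha> (pjet u (Some i, Some j)))"
  by (simp add: norm2a_def)

lemma c2abd_norm2a:
  fixes u :: "real^'d::finite \<Rightarrow> real"
  assumes u: "C2a \<alpha> u"
  shows "c2abd \<alpha> u (norm2a \<alpha> u)"
proof -
  have t: "torus_C2 u" and hc: "\<And>i j. holder_cont \<alpha> (pd j (pd i u))" using C2aD[OF u] by auto
  have pc: "periodic (pjet u p)" "continuous_on UNIV (pjet u p)" for p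
    by (rule periodic_pjet[OF torus_C2_periodic[OF t]], rule continuous_pjet[OF t])
  have s: "sup_norm (pjet u p) \<ge> 0" for p using sup_norm_nonneg pc by blast
  have h: "holder_semi \<alpha> (pjet u (Some i, Some j)) \<ge> 0" for i j using holder_semi_nonneg[OF hc, of j i] by simp
  define S0 where "S0 = sup_norm (pjet u (None, None))"
  define S1 where "S1 = (\<Sum>i\<in>UNIV. sup_norm (pjet u (Some i, None)))"
  define T where "T i j = sup_norm (pjet u (Some i, Some j)) + holder_semi \<alpha> (pjet u (Some i, Some j))" for i j
  have T0: "T i j \<ge> 0" for i j unfolding T_def by (intro add_nonneg_nonneg s h)
  have n: "norm2a \<alpha> u = S0 + S1 + (\<Sum>i\<in>UNIV. \<Sum>j\<in>UNIV. T i j)" unfolding norm2a_pjet S0_def S1_def T_def ..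
  have p0: "S0 \<ge> 0" "S1 \<ge> 0" "(\<Sum>i\<in>UNIV. \<Sum>j\<in>UNIV. T i j) \<ge> 0"
    unfolding S0_def S1_def by (intro sum_nonneg s T0)+
  have T2: "T i j \<le> (\<Sum>i\<in>UNIV. \<Sum>j\<in>UNIV. T i j)" for i j
  proof -
    have "T i j \<le> (\<Sum>j\<in>UNIV. T i j)" using T0 by (intro member_le_sum) auto
    also have "\<dots> \<le> (\<Sum>i\<in>UNIV. \<Sum>j\<in>UNIV. T i j)"
      using T0 by (intro member_le_sum[of i UNIV "\<lambda>i. \<Sum>j\<in>UNIV. T i j"]) (auto intro: sum_nonneg)
    finally show ?thesis .
  qed
  have 0: "sup_norm (pjet u (None, q)) \<le> norm2a \<alpha> u" for q using p0 by (simp add: n S0_def)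
  have 1: "sup_norm (pjet u (Some i, None)) \<le> norm2a \<alpha> u" for i
  proof -
    have "sup_norm (pjet u (Some i, None)) \<le> S1" unfolding S1_def by (rule member_le_sum[OF _ s]) auto
    then show ?thesis using p0 n by linarith
  qed
  have 2: "sup_norm (pjet u (Some i, Some j)) \<le> norm2a \<alpha> u" "holder_semi \<alpha> (pjet u (Some i, Some j)) \<le> norm2a \<alpha> u" for i j
    using T2[of i j] p0 n s[of "(Some i, Some j)"] h[of i j] unfolding T_def by linarith+
  have sp: "sup_norm (pjet u p) \<le> norm2a \<alpha> u" for p
    by (cases "(u, p)" rule: pjet.cases) (use 0 1 2 in auto)
  have b: "\<bar>pjet u p x\<bar> \<le> norm2a \<alpha> u" for p x using sup_norm_bound[OF pc, of p x] sp[of p] by linarith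
  have "\<bar>pd j (pd i u) x - pd j (pd i u) y\<bar> \<le> norm2a \<alpha> u * dist x y powr \<alpha>" for i j x y
    using holder_semi_bound[OF hc, of j i x y] mult_right_mono[OF 2(2)[of i j], of "dist x y powr \<alpha>"] by simp
  then show ?thesis unfolding c2abd_def c2bd_def hbd_def
    using t b pc(1)[of "(Some _, Some _)"] b[of "(Some _, Some _)"] by simp
qed

text \<open>The constant counts the summands of the norm: one value, d first derivatives, d^2 second
  derivatives and d^2 seminorms. With \<open>c2abd_norm2a\<close> this makes bounds and norm
  interchangeable up to a factor.\<close>

lemma norm2a_le:
  fixes u :: "real^'d::finite \<Rightarrow> real"
  assumes "c2abd \<alpha> u A"
  shows "norm2a \<alpha> u \<le> (1 + real CARD('d) + 2 * (real CARD('d))\<^sup>2) * A"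
proof -
  have b: "\<bar>pjet u p x\<bar> \<le> A" for p x using assms unfolding c2abd_def c2bd_def by blast
  have s: "sup_norm (pjet u p) \<le> A" for p by (rule sup_norm_least[OF b])
  have h: "holder_semi \<alpha> (pjet u (Some i, Some j)) \<le> A" for i j
    by (rule holder_semi_least) (use assms in \<open>auto simp: c2abd_def hbd_def\<close>)
  have "norm2a \<alpha> u \<le> A + (\<Sum>i\<in>(UNIV::'d set). A) + (\<Sum>i\<in>(UNIV::'d set). \<Sum>j\<in>(UNIV::'d set). A + A)"
    unfolding norm2a_pjet by (intro add_mono sum_mono s h)
  also have "\<dots> = (1 + real CARD('d) + 2 * (real CARD('d))\<^sup>2) * A"
    by (simp add: power2_eq_square algebra_simps)
  finally show ?thesis .
qed

lemma C2a_lincomb: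
  assumes u: "C2a \<alpha> u" and v: "C2a \<alpha> v"
  shows "C2a \<alpha> (\<lambda>x. a * u x + b * v x)"
    and norm2a_lincomb: "norm2a \<alpha> (\<lambda>x. a * u x + b * v x) \<le> \<bar>a\<bar> * norm2a \<alpha> u + \<bar>b\<bar> * norm2a \<alpha> v"
proof -
  have t: "torus_C2 u" "torus_C2 v" using u v by (auto simp: C2a_def)
  note j = pjet_lincomb[OF t, of a b]
  have pc: "periodic (pjet u p)" "continuous_on UNIV (pjet u p)" "periodic (pjet v p)" "continuous_on UNIV (pjet v p)" for p
    using periodic_pjet[of u p] continuous_pjet[of u p] periodic_pjet[of v p] continuous_pjet[of v p] t torus_C2_periodic by blast+
  have tri: "\<bar>a * c + b * d\<bar> \<le> \<bar>a\<bar> * C + \<bar>b\<bar> * D" if "\<bar>c\<bar> \<le> C" "\<bar>d\<bar> \<le> D" for c d C D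
  proof -
    have "\<bar>a * c + b * d\<bar> \<le> \<bar>a\<bar> * \<bar>c\<bar> + \<bar>b\<bar> * \<bar>d\<bar>" by (metis abs_mult abs_triangle_ineq)
    also have "\<dots> \<le> \<bar>a\<bar> * C + \<bar>b\<bar> * D" using that by (intro add_mono mult_left_mono) auto
    finally show ?thesis .
  qed
  have s: "sup_norm (pjet (\<lambda>x. a * u x + b * v x) p) \<le> \<bar>a\<bar> * sup_norm (pjet u p) + \<bar>b\<bar> * sup_norm (pjet v p)" for p
    unfolding j by (intro sup_norm_least tri sup_norm_bound pc)
  have hb: "\<bar>pjet (\<lambda>x. a * u x + b * v x) (Some i, Some k) x - pjet (\<lambda>x. a * u x + b * v x) (Some i, Some k) y\<bar>
      \<le> (\<bar>a\<bar> * holder_semi \<alpha> (pjet u (Some i, Some k)) + \<bar>b\<bar> * holder_semi \<alpha> (pjet v (Some i, Some k))) * dist x y powr \<alpha>" for i k x y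
    using tri[OF holder_semi_bound[OF C2aD(2)[OF u], of k i x y] holder_semi_bound[OF C2aD(2)[OF v], of k i x y]]
    unfolding j by (simp add: algebra_simps)
  have h: "holder_semi \<alpha> (pjet (\<lambda>x. a * u x + b * v x) (Some i, Some k))
      \<le> \<bar>a\<bar> * holder_semi \<alpha> (pjet u (Some i, Some k)) + \<bar>b\<bar> * holder_semi \<alpha> (pjet v (Some i, Some k))" for i k
    by (rule holder_semi_least[OF hb])
  show "C2a \<alpha> (\<lambda>x. a * u x + b * v x)"
    using torus_C2_lincomb(1)[OF t] hb unfolding C2a_def holder_cont_def pjet.simps(3)[symmetric] by blast
  have "norm2a \<alpha> (\<lambda>x. a * u x + b * v x) \<le> 
     (\<bar>a\<bar> * sup_norm (pjet u (None, None)) + \<bar>b\<bar> * sup_norm (pjet v (None, None))) + 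
     (\<Sum>i\<in>UNIV. \<bar>a\<bar> * sup_norm (pjet u (Some i, None)) + \<bar>b\<bar> * sup_norm (pjet v (Some i, None))) +
     (\<Sum>i\<in>UNIV. \<Sum>k\<in>UNIV. (\<bar>a\<bar> * sup_norm (pjet u (Some i, Some k)) + \<bar>b\<bar> * sup_norm (pjet v (Some i, Some k))) +
      (\<bar>a\<bar> * holder_semi \<alpha> (pjet u (Some i, Some k)) + \<bar>b\<bar> * holder_semi \<alpha> (pjet v (Some i, Some k))))"
    unfolding norm2a_pjet by (intro add_mono sum_mono s h)
  also have "\<dots> = \<bar>a\<bar> * norm2a \<alpha> u + \<bar>b\<bar> * norm2a \<alpha> v"
    unfolding norm2a_pjet by (simp only: sum.distrib sum_distrib_left[symmetric] distrib_left add_ac)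
  finally show "norm2a \<alpha> (\<lambda>x. a * u x + b * v x) \<le> \<bar>a\<bar> * norm2a \<alpha> u + \<bar>b\<bar> * norm2a \<alpha> v" .
qed

section \<open>The Banach space of pairs\<close>

text \<open>\<open>complete_norm_on\<close> asks for an ambient real vector space; for pairs of
  functions it is the pointwise one.\<close>

instantiation "fun" :: (type, real_vector) real_vector
begin

definition scaleR_fun :: "real \<Rightarrow> ('a \<Rightarrow> 'b) \<Rightarrow> 'a \<Rightarrow> 'b" where
  "scaleR_fun c f = (\<lambda>x. c *\<^sub>R f x)"

instance
  by standard (simp_all add: fun_eq_iff scaleR_fun_def scaleR_add_right scaleR_add_left)

end

definition XS :: "real \<Rightarrow> ((real^'d::finite \<Rightarrow> real) \<times> (real^'d \<Rightarrow> real)) set" where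
  "XS \<alpha> = {p. C2a \<alpha> (fst p) \<and> C2a \<alpha> (snd p)}"

definition XN :: "real \<Rightarrow> (real^'d::finite \<Rightarrow> real) \<times> (real^'d \<Rightarrow> real) \<Rightarrow> real" where
  "XN \<alpha> p = norm2a \<alpha> (fst p) + norm2a \<alpha> (snd p)"

lemma dist2a_XN: "dist2a \<alpha> p q = XN \<alpha> (p - q)"
  by (simp add: dist2a_def XN_def fun_diff_def)

lemma C2a_zero: "C2a \<alpha> (\<lambda>x::real^'d::finite. 0)"
proof -
  have c: "C1_fun (\<lambda>x::real^'d. 0) \<and> (\<forall>i. pd i (\<lambda>x::real^'d. 0) = (\<lambda>x. 0))"
    by (rule C1_funI[where D = "\<lambda>i x. 0"]) auto
  then show ?thesis by (auto simp: C2a_def torus_C2_def C2_fun_def periodic_def holder_cont_def intro!: exI[of _ 0])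
qed

lemma C2a_cmult: "C2a \<alpha> u \<Longrightarrow> C2a \<alpha> (\<lambda>x. c * u x)"
  using C2a_lincomb(1)[of \<alpha> u u c 0] by simp

lemma C2a_add: "C2a \<alpha> u \<Longrightarrow> C2a \<alpha> v \<Longrightarrow> C2a \<alpha> (\<lambda>x. u x + v x)"
  using C2a_lincomb(1)[of \<alpha> u v 1 1] by simp

lemma C2a_diff: "C2a \<alpha> u \<Longrightarrow> C2a \<alpha> v \<Longrightarrow> C2a \<alpha> (\<lambda>x. u x - v x)"
  using C2a_lincomb(1)[of \<alpha> u v 1 "-1"] by simp

lemma norm2a_nonneg: "C2a \<alpha> u \<Longrightarrow> norm2a \<alpha> u \<ge> 0"
  using c2abd_norm2a c2bd_nonneg unfolding c2abd_def by blast

text \<open>Equality follows from the inequality for the factor \<open>c\<close> and the inequality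
  for the factor \<open>1 / c\<close>.\<close>

lemma norm2a_cmult:
  assumes u: "C2a \<alpha> u"
  shows "norm2a \<alpha> (\<lambda>x. c * u x) = \<bar>c\<bar> * norm2a \<alpha> u"
proof -
  have le: "norm2a \<alpha> (\<lambda>x. c * v x) \<le> \<bar>c\<bar> * norm2a \<alpha> v" if "C2a \<alpha> v" for c and v :: "real^'a \<Rightarrow> real"
    using norm2a_lincomb[OF that that, of c 0] by simp
  show ?thesis
  proof (cases "c = 0")
    case True
    have "norm2a \<alpha> (\<lambda>x. 0 * u x) \<le> 0" using le[OF u, of 0] by simp
    moreover have "norm2a \<alpha> (\<lambda>x. 0 * u x) \<ge> 0" using norm2a_nonneg[OF C2a_cmult[OF u, of 0]] by simp
    ultimately show ?thesis using True by simp
  next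
    case False
    have "norm2a \<alpha> u \<le> \<bar>1 / c\<bar> * norm2a \<alpha> (\<lambda>x. c * u x)"
    proof -
      have "(\<lambda>x. 1 / c * (c * u x)) = u" using False by auto
      then show ?thesis using le[OF C2a_cmult[OF u, of c], of "1 / c"] by (simp only:)
    qed
    then have "\<bar>c\<bar> * norm2a \<alpha> u \<le> \<bar>c\<bar> * (\<bar>1 / c\<bar> * norm2a \<alpha> (\<lambda>x. c * u x))" by (rule mult_left_mono) simp
    then have "\<bar>c\<bar> * norm2a \<alpha> u \<le> norm2a \<alpha> (\<lambda>x. c * u x)" using False by (simp add: abs_divide)
    then show ?thesis using le[OF u, of c] by linarith
  qed
qed

lemma XS_bounds:
  fixes p :: "(real^'d::finite \<Rightarrow> real) \<times> (real^'d \<Rightarrow> real)"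
  assumes "p \<in> XS \<alpha>"
  shows "c2abd \<alpha> (fst p) (XN \<alpha> p)" "c2abd \<alpha> (snd p) (XN \<alpha> p)"
proof -
  have C: "C2a \<alpha> (fst p)" "C2a \<alpha> (snd p)" using assms by (auto simp: XS_def)
  show "c2abd \<alpha> (fst p) (XN \<alpha> p)" "c2abd \<alpha> (snd p) (XN \<alpha> p)"
    using c2abd_mono[OF c2abd_norm2a[OF C(1)], of "XN \<alpha> p"] c2abd_mono[OF c2abd_norm2a[OF C(2)], of "XN \<alpha> p"]
      norm2a_nonneg[OF C(1)] norm2a_nonneg[OF C(2)] by (auto simp: XN_def)
qed

text \<open>Differentiation and limit are exchanged along each axis line, where jets of one order
  are derivatives of jets of the order below and converge uniformly.\<close>

lemma torus_C2_uniform_limit: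
  fixes U :: "nat \<Rightarrow> real^'d::finite \<Rightarrow> real"
  assumes U: "\<And>n. torus_C2 (U n)"
    and lim: "\<And>e. e > 0 \<Longrightarrow> \<exists>M. \<forall>n\<ge>M. \<forall>p x. \<bar>pjet (U n) p x - g p x\<bar> \<le> e"
  shows "torus_C2 (g (None, None))" and "pjet (g (None, None)) p = g p"
proof -
  have pt: "(\<lambda>n. pjet (U n) p x) \<longlonglongrightarrow> g p x" for p x
  proof (rule LIMSEQ_I)
    fix e :: real assume "e > 0"
    then obtain M where "\<forall>n\<ge>M. \<forall>p x. \<bar>pjet (U n) p x - g p x\<bar> \<le> e / 2" using lim[of "e / 2"] by auto
    then have "\<bar>pjet (U n) p x - g p x\<bar> \<le> e / 2" if "n \<ge> M" for n using that by blast
    then have "norm (pjet (U n) p x - g p x) < e" if "n \<ge> M" for n using that \<open>e > 0\<close> by fastforce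
    then show "\<exists>M. \<forall>n\<ge>M. norm (pjet (U n) p x - g p x) < e" by blast
  qed
  have cont: "continuous_on UNIV (g p)" for p
  proof (rule uniform_limit_theorem[where F = sequentially and f = "\<lambda>n. pjet (U n) p"])
    show "uniform_limit UNIV (\<lambda>n. pjet (U n) p) (g p) sequentially"
    proof (rule uniform_limitI)
      fix e :: real assume "e > 0"
      then obtain M where M: "\<forall>n\<ge>M. \<forall>p x. \<bar>pjet (U n) p x - g p x\<bar> \<le> e / 2" using lim[of "e / 2"] by auto
      have "dist (pjet (U n) p x) (g p x) < e" if "n \<ge> M" for n x
      proof -
        have "\<bar>pjet (U n) p x - g p x\<bar> \<le> e / 2" using M that by blast
        then show ?thesis using \<open>e > 0\<close> by (simp add: dist_real_def)
      qed
      then show "\<forall>\<^sub>F n in sequentially. \<forall>x\<in>UNIV. dist (pjet (U n) p x) (g p x) < e"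
        unfolding eventually_sequentially by blast
    qed
  qed (auto intro!: always_eventually continuous_pjet U)
  have der: "((\<lambda>t. g p (x + t *\<^sub>R axis i 1)) has_real_derivative g q x) (at 0)"
    if C1: "\<And>n. C1_fun (pjet (U n) p)" and q: "\<And>n. pjet (U n) q = pd i (pjet (U n) p)" for p q i x
  proof -
    define fn where "fn n t = pjet (U n) p (x + t *\<^sub>R axis i 1)" for n t
    have "\<exists>G. \<forall>t\<in>UNIV. (\<lambda>n. fn n t) \<longlonglongrightarrow> G t \<and> (G has_derivative (\<lambda>h. h * g q (x + t *\<^sub>R axis i 1))) (at t within UNIV)"
    proof (rule has_derivative_sequence[where f = fn and ?x0.0 = 0 and l = "g p x" and f' = "\<lambda>n t h. h * pjet (U n) q (x + t *\<^sub>R axis i 1)"])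
      show "(fn n has_derivative (\<lambda>h. h * pjet (U n) q (x + t *\<^sub>R axis i 1))) (at t within UNIV)" for n t
        using pd_derivative_at[OF C1[of n], of x i t] unfolding fn_def q has_field_derivative_def
        by (simp add: mult_commute_abs)
      fix e :: real assume "e > 0"
      then obtain M where M: "\<forall>n\<ge>M. \<forall>p x. \<bar>pjet (U n) p x - g p x\<bar> \<le> e" using lim by blast
      have "norm (h * pjet (U n) q y - h * g q y) \<le> e * norm h" if "n \<ge> M" for n h y
      proof -
        have "\<bar>pjet (U n) q y - g q y\<bar> \<le> e" using M that by blast
        then have "\<bar>h\<bar> * \<bar>pjet (U n) q y - g q y\<bar> \<le> \<bar>h\<bar> * e" by (intro mult_left_mono) auto
        then show ?thesis by (simp add: abs_mult mult.commute flip: right_diff_distrib)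
      qed
      then show "\<forall>\<^sub>F n in sequentially. \<forall>t\<in>UNIV. \<forall>h. norm (h * pjet (U n) q (x + t *\<^sub>R axis i 1) - h * g q (x + t *\<^sub>R axis i 1)) \<le> e * norm h"
        unfolding eventually_sequentially by blast
    next
      show "(\<lambda>n. fn n 0) \<longlonglongrightarrow> g p x" using pt by (simp add: fn_def)
    qed auto
    then obtain G where G: "\<And>t. (\<lambda>n. fn n t) \<longlonglongrightarrow> G t" "\<And>t. (G has_derivative (\<lambda>h. h * g q (x + t *\<^sub>R axis i 1))) (at t)"
      by auto
    have "G t = g p (x + t *\<^sub>R axis i 1)" for t
      using LIMSEQ_unique[OF G(1)] pt unfolding fn_def by blast
    then have "G = (\<lambda>t. g p (x + t *\<^sub>R axis i 1))" by blast
    then show ?thesis using G(2)[of 0] unfolding has_field_derivative_def by (simp add: mult_commute_abs)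
  qed
  define v where "v = g (None, None)"
  have "C1_fun v \<and> (\<forall>i. pd i v = g (Some i, None))"
    unfolding v_def by (rule C1_funI[OF cont _ cont], rule der) (auto intro: torus_C2_C1 U)
  moreover have "C1_fun (g (Some i, None)) \<and> (\<forall>j. pd j (g (Some i, None)) = g (Some i, Some j))" for i
    by (rule C1_funI[OF cont _ cont], rule der) (auto intro: torus_C2_C1 U)
  moreover have "periodic v"
    unfolding periodic_def
  proof safe
    fix x z :: "real^'d" assume "\<forall>i. z $ i \<in> \<int>"
    then have "U n (x + z) = U n x" for n using torus_C2_periodic[OF U, of n] by (simp add: periodic_def)
    then show "v (x + z) = v x" using pt[of "(None, None)" "x + z"] pt[of "(None, None)" x] LIMSEQ_unique by (simp add: v_def)
  qed
  ultimately show "torus_C2 (g (None, None))" and "pjet (g (None, None)) p = g p"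
  proof -
    assume *: "C1_fun v \<and> (\<forall>i. pd i v = g (Some i, None))" 
      "\<And>i. C1_fun (g (Some i, None)) \<and> (\<forall>j. pd j (g (Some i, None)) = g (Some i, Some j))" "periodic v"
    show "torus_C2 (g (None, None))" using * by (simp add: torus_C2_def C2_fun_def v_def)
    have "g (None, q) x = g (None, None) x" for q x
      using LIMSEQ_unique[OF pt[of "(None, q)" x]] pt[of "(None, None)" x] by simp
    then have "g (None, q) = g (None, None)" for q by blast
    then show "pjet (g (None, None)) p = g p"
      by (cases "(g (None, None), p)" rule: pjet.cases) (use * in \<open>auto simp: v_def\<close>)
  qed
qed

text \<open>Jets converge pointwise by completeness of the reals. In the Cauchy estimate one index
  is kept and the other sent to infinity at fixed points, in the supremum and in the Hoelder bound
  alike; this makes the convergence uniform and keeps the seminorm.\<close>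

lemma C2a_complete:
  fixes U :: "nat \<Rightarrow> real^'d::finite \<Rightarrow> real"
  assumes U: "\<And>n. C2a \<alpha> (U n)"
    and cau: "\<And>e. e > 0 \<Longrightarrow> \<exists>M. \<forall>m\<ge>M. \<forall>n\<ge>M. norm2a \<alpha> (\<lambda>x. U m x - U n x) < e"
  shows "\<exists>u. C2a \<alpha> u \<and> (\<lambda>n. norm2a \<alpha> (\<lambda>x. U n x - u x)) \<longlonglongrightarrow> 0"
proof -
  have t: "torus_C2 (U n)" for n using C2aD[OF U] by blast
  have jb: "\<bar>pjet (U m) p x - pjet (U n) p x\<bar> \<le> norm2a \<alpha> (\<lambda>x. U m x - U n x)" for m n p x
  proof -
    have "c2bd (\<lambda>x. U m x - U n x) (norm2a \<alpha> (\<lambda>x. U m x - U n x))"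
      using c2abd_norm2a[OF C2a_diff[OF U U]] by (simp add: c2abd_def)
    then have "\<bar>pjet (\<lambda>x. U m x - U n x) p x\<bar> \<le> norm2a \<alpha> (\<lambda>x. U m x - U n x)" unfolding c2bd_def by blast
    then show ?thesis unfolding pjet_diff[OF t t] .
  qed
  have "Cauchy (\<lambda>n. pjet (U n) p x)" for p x
  proof (rule CauchyI)
    fix e :: real assume "e > 0"
    then obtain M where "\<forall>m\<ge>M. \<forall>n\<ge>M. norm2a \<alpha> (\<lambda>x. U m x - U n x) < e" using cau by blast
    then show "\<exists>M. \<forall>m\<ge>M. \<forall>n\<ge>M. norm (pjet (U m) p x - pjet (U n) p x) < e"
      using jb[of _ p x] unfolding real_norm_def by (meson le_less_trans)
  qed
  then have "\<forall>p x. \<exists>l. (\<lambda>n. pjet (U n) p x) \<longlonglongrightarrow> l" using Cauchy_convergent convergent_def by metis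
  then obtain g where g: "\<And>p x. (\<lambda>n. pjet (U n) p x) \<longlonglongrightarrow> g p x" by metis
  have conv: "\<exists>M. \<forall>n\<ge>M. (\<forall>p x. \<bar>pjet (U n) p x - g p x\<bar> \<le> e) \<and>
      (\<forall>i j x y. \<bar>(pjet (U n) (Some i, Some j) x - g (Some i, Some j) x) - (pjet (U n) (Some i, Some j) y - g (Some i, Some j) y)\<bar> \<le> e * dist x y powr \<alpha>)"
    if e: "e > 0" for e
  proof -
    obtain M where M: "\<And>m n. m \<ge> M \<Longrightarrow> n \<ge> M \<Longrightarrow> norm2a \<alpha> (\<lambda>x. U m x - U n x) < e" using cau[OF e] by blast
    have 1: "\<bar>pjet (U n) p x - g p x\<bar> \<le> e" if "n \<ge> M" for n p x
    proof (rule LIMSEQ_le_const2[where X = "\<lambda>m. \<bar>pjet (U n) p x - pjet (U m) p x\<bar>"])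
      show "(\<lambda>m. \<bar>pjet (U n) p x - pjet (U m) p x\<bar>) \<longlonglongrightarrow> \<bar>pjet (U n) p x - g p x\<bar>" by (intro tendsto_intros g)
      have "\<bar>pjet (U n) p x - pjet (U m) p x\<bar> \<le> e" if "m \<ge> M" for m using jb[of n p x m] M[OF \<open>n \<ge> M\<close> that] by linarith
      then show "\<exists>N. \<forall>m\<ge>N. \<bar>pjet (U n) p x - pjet (U m) p x\<bar> \<le> e" by blast
    qed
    have 2: "\<bar>(pjet (U n) (Some i, Some j) x - g (Some i, Some j) x) - (pjet (U n) (Some i, Some j) y - g (Some i, Some j) y)\<bar> \<le> e * dist x y powr \<alpha>"
      if "n \<ge> M" for n i j x y
    proof (rule LIMSEQ_le_const2[where X = "\<lambda>m. \<bar>(pjet (U n) (Some i, Some j) x - pjet (U m) (Some i, Some j) x) - (pjet (U n) (Some i, Some j) y - pjet (U m) (Some i, Some j) y)\<bar>"])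
      show "(\<lambda>m. \<bar>(pjet (U n) (Some i, Some j) x - pjet (U m) (Some i, Some j) x) - (pjet (U n) (Some i, Some j) y - pjet (U m) (Some i, Some j) y)\<bar>)
        \<longlonglongrightarrow> \<bar>(pjet (U n) (Some i, Some j) x - g (Some i, Some j) x) - (pjet (U n) (Some i, Some j) y - g (Some i, Some j) y)\<bar>"
        by (intro tendsto_intros g)
      have "\<bar>(pjet (U n) (Some i, Some j) x - pjet (U m) (Some i, Some j) x) - (pjet (U n) (Some i, Some j) y - pjet (U m) (Some i, Some j) y)\<bar> \<le> e * dist x y powr \<alpha>"
        if "m \<ge> M" for m
      proof -
        have "hbd \<alpha> (pd j (pd i (\<lambda>x. U n x - U m x))) (norm2a \<alpha> (\<lambda>x. U n x - U m x))"
          using c2abd_norm2a[OF C2a_diff[OF U U]] by (simp add: c2abd_def)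
        then have "\<bar>pjet (\<lambda>x. U n x - U m x) (Some i, Some j) x - pjet (\<lambda>x. U n x - U m x) (Some i, Some j) y\<bar>
            \<le> norm2a \<alpha> (\<lambda>x. U n x - U m x) * dist x y powr \<alpha>" by (simp add: hbd_def)
        also have "\<dots> \<le> e * dist x y powr \<alpha>" using M[OF \<open>n \<ge> M\<close> that] by (intro mult_right_mono) auto
        finally show ?thesis unfolding pjet_diff[OF t t] .
      qed
      then show "\<exists>N. \<forall>m\<ge>N. \<bar>(pjet (U n) (Some i, Some j) x - pjet (U m) (Some i, Some j) x) - (pjet (U n) (Some i, Some j) y - pjet (U m) (Some i, Some j) y)\<bar> \<le> e * dist x y powr \<alpha>"
        by blast
    qed
    show ?thesis using 1 2 by blast
  qed
  define u where "u = g (None, None)"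
  have ul: "\<exists>M. \<forall>n\<ge>M. \<forall>p x. \<bar>pjet (U n) p x - g p x\<bar> \<le> e" if "e > 0" for e using conv[OF that] by blast
  have tu: "torus_C2 u" and ju: "\<And>p. pjet u p = g p"
    unfolding u_def by (rule torus_C2_uniform_limit[OF t ul], assumption)+
  have c2: "\<exists>M. \<forall>n\<ge>M. c2abd \<alpha> (\<lambda>x. U n x - u x) e" if "e > 0" for e
  proof -
    obtain M where M: "\<And>n p x. n \<ge> M \<Longrightarrow> \<bar>pjet (U n) p x - g p x\<bar> \<le> e"
       "\<And>n i j x y. n \<ge> M \<Longrightarrow> \<bar>(pjet (U n) (Some i, Some j) x - g (Some i, Some j) x) - (pjet (U n) (Some i, Some j) y - g (Some i, Some j) y)\<bar> \<le> e * dist x y powr \<alpha>"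
      using conv[OF \<open>e > 0\<close>] by blast
    have "c2abd \<alpha> (\<lambda>x. U n x - u x) e" if n: "n \<ge> M" for n
    proof -
      have td: "torus_C2 (\<lambda>x. U n x - u x)" by (rule torus_C2_diff(1)[OF t tu])
      have jd: "pjet (\<lambda>x. U n x - u x) p x = pjet (U n) p x - g p x" for p x
        unfolding pjet_diff[OF t tu] ju ..
      have "c2bd (\<lambda>x. U n x - u x) e" unfolding c2bd_def jd using td M(1)[OF n] by blast
      moreover have "hbd \<alpha> (pjet (\<lambda>x. U n x - u x) (Some i, Some j)) e" for i j
        unfolding hbd_def using M[OF n] periodic_pjet[OF torus_C2_periodic[OF td], of "(Some i, Some j)"]
        by (simp add: jd del: pjet.simps)
      ultimately show ?thesis by (simp add: c2abd_def)
    qed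
    then show ?thesis by blast
  qed
  have "C2a \<alpha> u"
  proof -
    obtain n where "c2abd \<alpha> (\<lambda>x. U n x - u x) 1" using c2[of 1] by auto
    then have "C2a \<alpha> (\<lambda>x. U n x - (U n x - u x))" using C2a_diff[OF U] c2abd_imp_C2a by blast
    then show ?thesis by simp
  qed
  moreover have "(\<lambda>n. norm2a \<alpha> (\<lambda>x. U n x - u x)) \<longlonglongrightarrow> 0"
  proof (rule LIMSEQ_I)
    fix e :: real assume "e > 0"
    define c where "c = 1 + real CARD('d) + 2 * (real CARD('d))\<^sup>2"
    have c: "c > 0" by (simp add: c_def add_pos_nonneg)
    then obtain M where M: "\<forall>n\<ge>M. c2abd \<alpha> (\<lambda>x. U n x - u x) (e / (2 * c))" using c2[of "e / (2 * c)"] \<open>e > 0\<close> by auto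
    have "norm2a \<alpha> (\<lambda>x. U n x - u x) < e \<and> norm2a \<alpha> (\<lambda>x. U n x - u x) \<ge> 0" if "n \<ge> M" for n
    proof -
      have "norm2a \<alpha> (\<lambda>x. U n x - u x) \<le> c * (e / (2 * c))"
        using norm2a_le[of \<alpha> "\<lambda>x. U n x - u x" "e / (2 * c)"] M that unfolding c_def by blast
      also have "\<dots> < e" using c \<open>e > 0\<close> by simp
      finally show ?thesis using norm2a_nonneg[OF C2a_diff[OF U \<open>C2a \<alpha> u\<close>]] by blast
    qed
    then show "\<exists>M. \<forall>n\<ge>M. norm (norm2a \<alpha> (\<lambda>x. U n x - u x) - 0) < e"
      by (metis abs_of_nonneg diff_zero real_norm_def)
  qed
  ultimately show ?thesis by blast
qed

lemma XS_complete_norm: "complete_norm_on (XS \<alpha>) (XN \<alpha>)"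
proof
  show "subspace (XS \<alpha>)"
    unfolding subspace_def XS_def
    by (auto simp: zero_fun_def plus_fun_def scaleR_fun_def C2a_zero C2a_add C2a_cmult)
next
  fix p :: "(real^'d \<Rightarrow> real) \<times> (real^'d \<Rightarrow> real)"
  assume p: "p \<in> XS \<alpha>" "XN \<alpha> p = 0"
  have z: "u = 0" if "C2a \<alpha> u" "norm2a \<alpha> u = 0" for u :: "real^'d \<Rightarrow> real"
  proof
    fix x
    have "\<bar>u x\<bar> \<le> 0" using c2bdD(2)[of u 0 x] c2abd_norm2a[OF that(1)] that(2) by (simp add: c2abd_def)
    then show "u x = 0 x" by simp
  qed
  have "norm2a \<alpha> (fst p) = 0" "norm2a \<alpha> (snd p) = 0"
    using p norm2a_nonneg[of \<alpha> "fst p"] norm2a_nonneg[of \<alpha> "snd p"] by (auto simp: XS_def XN_def)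
  then show "p = 0" using z[of "fst p"] z[of "snd p"] p by (simp add: XS_def prod_eq_iff)
next
  fix p :: "(real^'d \<Rightarrow> real) \<times> (real^'d \<Rightarrow> real)" and c
  assume "p \<in> XS \<alpha>"
  then show "XN \<alpha> (c *\<^sub>R p) = \<bar>c\<bar> * XN \<alpha> p"
    by (simp add: XN_def XS_def scaleR_fun_def norm2a_cmult distrib_left)
next
  fix p q :: "(real^'d \<Rightarrow> real) \<times> (real^'d \<Rightarrow> real)"
  assume "p \<in> XS \<alpha>" "q \<in> XS \<alpha>"
  then show "XN \<alpha> (p + q) \<le> XN \<alpha> p + XN \<alpha> q"
    using norm2a_lincomb[of \<alpha> "fst p" "fst q" 1 1] norm2a_lincomb[of \<alpha> "snd p" "snd q" 1 1]
    by (simp add: XN_def XS_def plus_fun_def)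
next
  fix X :: "nat \<Rightarrow> (real^'d \<Rightarrow> real) \<times> (real^'d \<Rightarrow> real)"
  assume X: "\<And>n. X n \<in> XS \<alpha>" and cau: "\<And>e. e > 0 \<Longrightarrow> \<exists>M. \<forall>m\<ge>M. \<forall>n\<ge>M. XN \<alpha> (X m - X n) < e"
  have C: "C2a \<alpha> (fst (X n))" "C2a \<alpha> (snd (X n))" for n using X by (auto simp: XS_def)
  have nn: "norm2a \<alpha> (\<lambda>x. fst (X m) x - fst (X n) x) \<ge> 0" "norm2a \<alpha> (\<lambda>x. snd (X m) x - snd (X n) x) \<ge> 0" for m n
    using norm2a_nonneg C2a_diff C by blast+
  have N: "XN \<alpha> (X m - X n) = norm2a \<alpha> (\<lambda>x. fst (X m) x - fst (X n) x) + norm2a \<alpha> (\<lambda>x. snd (X m) x - snd (X n) x)" for m n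
    by (simp add: XN_def fun_diff_def)
  have "\<exists>M. \<forall>m\<ge>M. \<forall>n\<ge>M. norm2a \<alpha> (\<lambda>x. fst (X m) x - fst (X n) x) < e" if e0: "e > 0" for e
  proof -
    obtain M where M: "\<forall>m\<ge>M. \<forall>n\<ge>M. XN \<alpha> (X m - X n) < e" using cau[OF e0] by blast
    have "norm2a \<alpha> (\<lambda>x. fst (X m) x - fst (X n) x) < e" if "m \<ge> M" "n \<ge> M" for m n
      using M[rule_format, OF that] nn(2)[of m n] unfolding N by linarith
    then show ?thesis by blast
  qed
  from C2a_complete[of \<alpha> "\<lambda>n. fst (X n)", OF C(1) this]
  obtain a where a: "C2a \<alpha> a" "(\<lambda>n. norm2a \<alpha> (\<lambda>x. fst (X n) x - a x)) \<longlonglongrightarrow> 0" by blast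
  have "\<exists>M. \<forall>m\<ge>M. \<forall>n\<ge>M. norm2a \<alpha> (\<lambda>x. snd (X m) x - snd (X n) x) < e" if e0: "e > 0" for e
  proof -
    obtain M where M: "\<forall>m\<ge>M. \<forall>n\<ge>M. XN \<alpha> (X m - X n) < e" using cau[OF e0] by blast
    have "norm2a \<alpha> (\<lambda>x. snd (X m) x - snd (X n) x) < e" if "m \<ge> M" "n \<ge> M" for m n
      using M[rule_format, OF that] nn(1)[of m n] unfolding N by linarith
    then show ?thesis by blast
  qed
  from C2a_complete[of \<alpha> "\<lambda>n. snd (X n)", OF C(2) this]
  obtain b where b: "C2a \<alpha> b" "(\<lambda>n. norm2a \<alpha> (\<lambda>x. snd (X n) x - b x)) \<longlonglongrightarrow> 0" by blast
  have "(\<lambda>n. XN \<alpha> (X n - (a, b))) \<longlonglongrightarrow> 0"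
    using tendsto_add[OF a(2) b(2)] by (simp add: XN_def fun_diff_def)
  then show "\<exists>l\<in>XS \<alpha>. (\<lambda>n. XN \<alpha> (X n - l)) \<longlonglongrightarrow> 0" using a b by (intro bexI[of _ "(a, b)"]) (auto simp: XS_def)
qed

text \<open>The compact embedding of C^{2,\<alpha>} into C^2 in terms of Cauchy subsequences. No
  limit is named: the compact operator will turn C^2 smallness into C^{2,\<alpha>} smallness, and
  completeness of the latter space provides the limit. The boolean component of the index treats
  both sequences with one subsequence.\<close>

lemma c2abd_compact:
  fixes U M :: "nat \<Rightarrow> real^'d::finite \<Rightarrow> real"
  assumes U: "\<And>n. c2abd \<alpha> (U n) B" and M: "\<And>n. c2abd \<alpha> (M n) B" and \<alpha>: "0 < \<alpha>" "\<alpha> < 1"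
  obtains r where "strict_mono (r :: nat \<Rightarrow> nat)"
    "\<And>e. e > 0 \<Longrightarrow> \<exists>N. \<forall>m\<ge>N. \<forall>n\<ge>N. c2bd (\<lambda>x. U (r m) x - U (r n) x) e \<and> c2bd (\<lambda>x. M (r m) x - M (r n) x) e"
proof -
  define F where "F n q = pjet (if fst q then U n else M n) (snd q)" for n and q :: "bool \<times> 'd option \<times> 'd option"
  define c where "c = (real CARD('d) + 2) * B"
  have W: "c2abd \<alpha> (if b then U n else M n) B" for b n using U M by simp
  have B: "B \<ge> 0" using U[of 0] c2bd_nonneg by (auto simp: c2abd_def)
  have hb: "hbd \<alpha> (pjet w p) c" if "c2abd \<alpha> w B" for w :: "real^'d \<Rightarrow> real" and p
  proof -
    have w: "c2bd w B" and h2: "\<And>i j. hbd \<alpha> (pd j (pd i w)) B" using that by (auto simp: c2abd_def)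
    have "B \<le> c" unfolding c_def using mult_right_mono[OF _ B, of 1 "real CARD('d) + 2"] by simp
    then have "hbd \<alpha> (pd j (pd i w)) c" for i j using h2 hbd_mono by blast
    then show ?thesis by (cases "(w, p)" rule: pjet.cases) (use c2bd_hbd[OF w \<alpha>] in \<open>auto simp: c_def\<close>)
  qed
  have hF: "hbd \<alpha> (F n q) c" for n q unfolding F_def by (rule hb[OF W])
  obtain g r where r: "strict_mono (r :: nat \<Rightarrow> nat)"
    and g: "\<And>e. e > 0 \<Longrightarrow> \<exists>N. \<forall>n\<ge>N. \<forall>p x. \<bar>F (r n) p x - g p x\<bar> < e"
    by (rule arzela_ascoli_periodic[of F c "\<lambda>_. c" "\<lambda>_. \<alpha>"]) (use hF \<alpha> in \<open>auto simp: hbd_def simp del: split_paired_All\<close>)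
  show ?thesis
  proof (rule that[OF r])
    fix e :: real assume "e > 0"
    then obtain N where N: "\<And>n p x. n \<ge> N \<Longrightarrow> \<bar>F (r n) p x - g p x\<bar> < e / 2" using g[of "e / 2"] by (meson half_gt_zero)
    have d: "\<bar>F (r m) q x - F (r n) q x\<bar> \<le> e" if "m \<ge> N" "n \<ge> N" for m n q x
      using N[OF that(1), of q x] N[OF that(2), of q x] by linarith
    have tU: "torus_C2 (U n)" and tM: "torus_C2 (M n)" for n using U M by (auto simp: c2abd_def c2bd_def)
    have "c2bd (\<lambda>x. U (r m) x - U (r n) x) e" if "m \<ge> N" "n \<ge> N" for m n
      unfolding c2bd_def pjet_diff[OF tU tU] using torus_C2_diff(1)[OF tU tU] d[OF that, of "(True, _)"]
      unfolding F_def fst_conv snd_conv if_True by blast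
    moreover have "c2bd (\<lambda>x. M (r m) x - M (r n) x) e" if "m \<ge> N" "n \<ge> N" for m n
      unfolding c2bd_def pjet_diff[OF tM tM] using torus_C2_diff(1)[OF tM tM] d[OF that, of "(False, _)"]
      unfolding F_def fst_conv snd_conv if_False by blast
    ultimately have "c2bd (\<lambda>x. U (r m) x - U (r n) x) e \<and> c2bd (\<lambda>x. M (r m) x - M (r n) x) e" if "m \<ge> N" "n \<ge> N" for m n
      using that by blast
    then show "\<exists>N. \<forall>m\<ge>N. \<forall>n\<ge>N. c2bd (\<lambda>x. U (r m) x - U (r n) x) e \<and> c2bd (\<lambda>x. M (r m) x - M (r n) x) e" by blast
  qed
qed

section \<open>The solution operator of -\<Delta> + \<lambda>\<close>

lemma Tsolve_eqI:
  assumes "lam > 0" "torus_C2 v" "\<And>x. - lap v x + lam * v x = \<xi> x"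
  shows "Tsolve lam \<xi> = v"
  unfolding Tsolve_def
proof (rule the_equality)
  show "torus_C2 v \<and> (\<forall>x. - lap v x + lam * v x = \<xi> x)" using assms by blast
  fix w assume w: "torus_C2 w \<and> (\<forall>x. - lap w x + lam * w x = \<xi> x)"
  show "w = v" by (rule resolvent_unique[of w v lam \<xi>]) (use assms w in auto)
qed

lemma Tsolve_schauder:
  assumes "lam > 0" "0 < \<alpha>" "\<alpha> < 1"
  obtains K where "K > 0" "\<And>(\<xi> :: real^'d::finite \<Rightarrow> real) A. hbd \<alpha> \<xi> A \<Longrightarrow> c2abd \<alpha> (Tsolve lam \<xi>) (K * A)"
    "\<And>(\<xi> :: real^'d::finite \<Rightarrow> real) A x. hbd \<alpha> \<xi> A \<Longrightarrow> - lap (Tsolve lam \<xi>) x + lam * Tsolve lam \<xi> x = \<xi> x"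
proof -
  obtain K where K: "K > 0" "\<forall>(\<xi> :: real^'d::finite \<Rightarrow> real) A. periodic \<xi> \<longrightarrow> (\<forall>x. \<bar>\<xi> x\<bar> \<le> A) \<longrightarrow>
    (\<forall>x y. \<bar>\<xi> x - \<xi> y\<bar> \<le> A * dist x y powr \<alpha>) \<longrightarrow>
    (\<exists>v. torus_C2 v \<and> (\<forall>x. - lap v x + lam * v x = \<xi> x) \<and> (\<forall>x. \<bar>v x\<bar> \<le> K * A) \<and> (\<forall>i x. \<bar>pd i v x\<bar> \<le> K * A) \<and>
      (\<forall>i j x. \<bar>pd j (pd i v) x\<bar> \<le> K * A) \<and>
      (\<forall>i j x y. \<bar>pd j (pd i v) x - pd j (pd i v) y\<bar> \<le> K * A * dist x y powr \<alpha>))"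
    using schauder_existence[OF assms] by blast
  have *: "c2abd \<alpha> (Tsolve lam \<xi>) (K * A) \<and> (\<forall>x. - lap (Tsolve lam \<xi>) x + lam * Tsolve lam \<xi> x = \<xi> x)" if "hbd \<alpha> \<xi> A" for \<xi> :: "real^'d \<Rightarrow> real" and A
  proof -
    have "periodic \<xi>" "\<forall>x. \<bar>\<xi> x\<bar> \<le> A" "\<forall>x y. \<bar>\<xi> x - \<xi> y\<bar> \<le> A * dist x y powr \<alpha>" using that by (auto simp: hbd_def)
    then obtain v where v: "torus_C2 v" "\<And>x. - lap v x + lam * v x = \<xi> x" "\<And>x. \<bar>v x\<bar> \<le> K * A" "\<And>i x. \<bar>pd i v x\<bar> \<le> K * A"
      "\<And>i j x. \<bar>pd j (pd i v) x\<bar> \<le> K * A" "\<And>i j x y. \<bar>pd j (pd i v) x - pd j (pd i v) y\<bar> \<le> K * A * dist x y powr \<alpha>"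
      using K(2) by blast
    have T: "Tsolve lam \<xi> = v" by (rule Tsolve_eqI) (use assms v in auto)
    have "\<bar>pjet v p x\<bar> \<le> K * A" for p x by (cases "(v, p)" rule: pjet.cases) (use v in auto)
    then have "c2bd v (K * A)" unfolding c2bd_def using v(1) by blast
    then have "c2abd \<alpha> v (K * A)"
      unfolding c2abd_def hbd_def using v periodic_pd[OF periodic_pd[OF torus_C2_periodic[OF v(1)]]] by blast
    then show ?thesis using v(2) T by simp
  qed
  show ?thesis by (rule that[OF K(1)]) (use * in blast)+
qed

section \<open>The linearized system\<close>

lemma divg_expand:
  assumes "C1_fun m" "torus_C2 u"
  shows "divg m u x = grad_dot m u x + m x * lap u x"
proof -
  have "pd i (\<lambda>y. m y * pd i u y) x = pd i m x * pd i u x + m x * pd i (pd i u) x" for i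
    using C1_mult[OF assms(1) torus_C2_C1(2)[OF assms(2)], of i] by simp
  then show ?thesis by (simp add: divg_def grad_dot_def lap_def sum.distrib sum_distrib_left)
qed

lemma grad_dot_commute: "grad_dot u v x = grad_dot v u x"
  by (simp add: grad_dot_def mult.commute)

lemma grad_dot_lincomb:
  assumes "C1_fun v" "C1_fun w"
  shows "grad_dot u (\<lambda>x. a * v x + b * w x) x = a * grad_dot u v x + b * grad_dot u w x"
proof -
  have "pd i (\<lambda>x. a * v x + b * w x) x = a * pd i v x + b * pd i w x" for i
    using C1_lincomb[OF assms, of a b] by simp
  then show ?thesis by (simp add: grad_dot_def sum_distrib_left sum.distrib algebra_simps)
qed

lemma hbd_grad_dot:
  fixes u v :: "real^'d::finite \<Rightarrow> real"
  assumes "\<And>i. hbd \<alpha> (pd i u) A" "\<And>i. hbd \<alpha> (pd i v) B"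
  shows "hbd \<alpha> (grad_dot u v) (real CARD('d) * (2 * A * B))"
proof -
  have "hbd \<alpha> (\<lambda>x. \<Sum>i\<in>(UNIV::'d set). pd i u x * pd i v x) (\<Sum>i\<in>(UNIV::'d set). 2 * A * B)"
    by (rule hbd_sum) (auto intro: hbd_mult assms)
  then show ?thesis by (simp add: grad_dot_def[abs_def])
qed

lemma hbd_lap:
  fixes u :: "real^'d::finite \<Rightarrow> real"
  assumes "c2abd \<alpha> u A"
  shows "hbd \<alpha> (lap u) (real CARD('d) * A)"
proof -
  have "hbd \<alpha> (\<lambda>x. \<Sum>i\<in>(UNIV::'d set). pd i (pd i u) x) (\<Sum>i\<in>(UNIV::'d set). A)"
    by (rule hbd_sum) (use assms in \<open>auto simp: c2abd_def\<close>)
  then show ?thesis by (simp add: lap_def[abs_def])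
qed

lemma hbd_divg:
  fixes u m :: "real^'d::finite \<Rightarrow> real"
  assumes m: "c2bd m A" and u: "c2abd \<alpha> u B" and \<alpha>: "0 < \<alpha>" "\<alpha> < 1"
  shows "hbd \<alpha> (divg m u) (4 * real CARD('d) * (real CARD('d) + 2)\<^sup>2 * A * B)"
proof -
  define c where "c = real CARD('d) + 2"
  have A: "A \<ge> 0" "B \<ge> 0" using c2bd_nonneg m u c2abd_c2bd by blast+
  have c: "c \<ge> 1" by (simp add: c_def)
  have e: "divg m u = (\<lambda>x. grad_dot m u x + m x * lap u x)"
    using divg_expand[OF torus_C2_C1(1)] m u by (auto simp: c2abd_def c2bd_def)
  have "hbd \<alpha> (divg m u) (real CARD('d) * (2 * (c * A) * (c * B)) + 2 * (c * A) * (real CARD('d) * B))"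
    unfolding e c_def using c2bd_hbd[OF m \<alpha>] c2bd_hbd[OF c2abd_c2bd[OF u] \<alpha>]
    by (intro hbd_add hbd_grad_dot hbd_mult hbd_lap u)
  moreover have "2 * (c * A) * (real CARD('d) * B) \<le> 2 * (c * A) * (real CARD('d) * (c * B))"
    using A c mult_right_mono[OF c A(2)] by (intro mult_left_mono) auto
  ultimately show ?thesis
    by (elim hbd_mono) (simp add: c_def[symmetric] power2_eq_square algebra_simps)
qed

text \<open>The coefficient \<open>a\<close> stands for f' composed with a density. Keeping it and
  the base point free lets one definition serve the linearization at the solution and at the Newton
  iterates.\<close>

definition lin1 :: "real \<Rightarrow> (real^'d::finite \<Rightarrow> real) \<Rightarrow> (real^'d \<Rightarrow> real) \<Rightarrow> (real^'d \<Rightarrow> real) \<Rightarrow> (real^'d \<Rightarrow> real) \<Rightarrow> real^'d \<Rightarrow> real" where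
  "lin1 lam a u w \<mu> x = - lap w x + lam * w x + grad_dot u w x - a x * \<mu> x"

definition lin2 :: "real \<Rightarrow> (real^'d::finite \<Rightarrow> real) \<Rightarrow> (real^'d \<Rightarrow> real) \<Rightarrow> (real^'d \<Rightarrow> real) \<Rightarrow> (real^'d \<Rightarrow> real) \<Rightarrow> real^'d \<Rightarrow> real" where
  "lin2 lam u m w \<mu> x = - lap \<mu> x + lam * \<mu> x - divg \<mu> u x - divg m w x"

lemma lin1_lincomb:
  assumes "torus_C2 w" "torus_C2 w'"
  shows "lin1 lam a u (\<lambda>x. s * w x + t * w' x) (\<lambda>x. s * \<mu> x + t * \<mu>' x) x = s * lin1 lam a u w \<mu> x + t * lin1 lam a u w' \<mu>' x"
  unfolding lin1_def lap_lincomb[OF assms] grad_dot_lincomb[OF torus_C2_C1(1)[OF assms(1)] torus_C2_C1(1)[OF assms(2)]]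
  by (simp add: algebra_simps)

lemma divg_lincomb_left:
  assumes "C1_fun m" "C1_fun m'" "torus_C2 u"
  shows "divg (\<lambda>x. s * m x + t * m' x) u x = s * divg m u x + t * divg m' u x"
proof -
  have "C1_fun (\<lambda>x. s * m x + t * m' x)" using C1_lincomb[OF assms(1,2)] by blast
  then show ?thesis using assms
    by (simp add: divg_expand grad_dot_commute[of _ u] grad_dot_lincomb distrib_left distrib_right)
qed

lemma divg_lincomb_right:
  assumes "C1_fun m" "torus_C2 u" "torus_C2 u'"
  shows "divg m (\<lambda>x. s * u x + t * u' x) x = s * divg m u x + t * divg m u' x"
  using torus_C2_lincomb(1)[OF assms(2,3)] assms torus_C2_C1(1)
    grad_dot_lincomb[OF torus_C2_C1(1)[OF assms(2)] torus_C2_C1(1)[OF assms(3)], of m s t x]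
  by (simp add: divg_expand lap_lincomb distrib_left algebra_simps)

lemma lin2_lincomb:
  assumes "torus_C2 w" "torus_C2 w'" "torus_C2 \<mu>" "torus_C2 \<mu>'" "torus_C2 u" "C1_fun m"
  shows "lin2 lam u m (\<lambda>x. s * w x + t * w' x) (\<lambda>x. s * \<mu> x + t * \<mu>' x) x = s * lin2 lam u m w \<mu> x + t * lin2 lam u m w' \<mu>' x"
  unfolding lin2_def lap_lincomb[OF assms(3,4)] divg_lincomb_right[OF assms(6,1,2)]
    divg_lincomb_left[OF torus_C2_C1(1)[OF assms(3)] torus_C2_C1(1)[OF assms(4)] assms(5)]
  by (simp add: algebra_simps)

text \<open>Stability enters only as \<open>inj\<close>, injectivity among C^2 pairs; one constant
  \<open>B\<close> bounds all coefficients.\<close>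

locale linear_mfg =
  fixes lam \<alpha> B :: real and u m a :: "real^'d::finite \<Rightarrow> real"
  assumes lam: "lam > 0" and \<alpha>: "0 < \<alpha>" "\<alpha> < 1" and u: "c2abd \<alpha> u B" and m: "c2abd \<alpha> m B" and a: "hbd \<alpha> a B"
    and inj: "\<And>w \<mu>. torus_C2 w \<Longrightarrow> torus_C2 \<mu> \<Longrightarrow> (\<And>x. lin1 lam a u w \<mu> x = 0) \<Longrightarrow> (\<And>x. lin2 lam u m w \<mu> x = 0) \<Longrightarrow> w = (\<lambda>x. 0) \<and> \<mu> = (\<lambda>x. 0)"
begin

text \<open>
  In \<open>k2\<close> the second derivatives of $w$ in $\mathrm{div}(m Dw)$ are replaced by means of the first
  equation; this is what makes the perturbation compact, at the price of the factor $m$ in \<open>lin_k\<close>.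
\<close>

definition k1 where "k1 w \<mu> x = grad_dot u w x - a x * \<mu> x"

definition k2 where "k2 w \<mu> x = - divg \<mu> u x - grad_dot m w x - m x * (k1 w \<mu> x + lam * w x)"

lemma tu: "torus_C2 u" and tm: "torus_C2 m"
  using u m by (auto simp: c2abd_def c2bd_def)

lemma B0: "B \<ge> 0"
  using c2bd_nonneg[OF c2abd_c2bd[OF u]] .

lemma k_lincomb:
  assumes "torus_C2 w" "torus_C2 w'" "torus_C2 \<mu>" "torus_C2 \<mu>'"
  shows "k1 (\<lambda>x. s * w x + t * w' x) (\<lambda>x. s * \<mu> x + t * \<mu>' x) x = s * k1 w \<mu> x + t * k1 w' \<mu>' x"
    and "k2 (\<lambda>x. s * w x + t * w' x) (\<lambda>x. s * \<mu> x + t * \<mu>' x) x = s * k2 w \<mu> x + t * k2 w' \<mu>' x"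
proof -
  note C = torus_C2_C1(1)[OF assms(1)] torus_C2_C1(1)[OF assms(2)] torus_C2_C1(1)[OF assms(3)] torus_C2_C1(1)[OF assms(4)]
  show 1: "k1 (\<lambda>x. s * w x + t * w' x) (\<lambda>x. s * \<mu> x + t * \<mu>' x) x = s * k1 w \<mu> x + t * k1 w' \<mu>' x"
    unfolding k1_def grad_dot_lincomb[OF C(1,2)] by (simp add: algebra_simps)
  show "k2 (\<lambda>x. s * w x + t * w' x) (\<lambda>x. s * \<mu> x + t * \<mu>' x) x = s * k2 w \<mu> x + t * k2 w' \<mu>' x"
    unfolding k2_def 1 grad_dot_lincomb[OF C(1,2)] divg_lincomb_left[OF C(3,4) tu] by (simp add: algebra_simps)
qed

text \<open>Only values and first derivatives of \<open>w\<close> and \<open>\<mu>\<close> occur,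
  the second derivatives being those of \<open>u\<close>. Hence a C^2 bound on the arguments
  controls the C^{0,\<alpha>} size of the result, which leaves room for compactness.\<close>

lemma k_bound: "\<exists>C>0. \<forall>w \<mu> A. c2bd w A \<longrightarrow> c2bd \<mu> A \<longrightarrow> hbd \<alpha> (k1 w \<mu>) (C * A) \<and> hbd \<alpha> (k2 w \<mu>) (C * A)"
proof -
  define d where "d = real CARD('d)"
  define c where "c = d + 2"
  define c1 where "c1 = d * (2 * (c * B) * c) + 2 * B * c"
  define c2 where "c2 = 4 * d * c\<^sup>2 * B + d * (2 * (c * B) * c) + 2 * (c * B) * (c1 + lam * c)"
  have d0: "d \<ge> 0" "c \<ge> 0" by (auto simp: d_def c_def)
  have pos: "c1 \<ge> 0" "c2 \<ge> 0" using B0 d0 lam by (auto simp: c1_def c2_def)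
  have "hbd \<alpha> (k1 w \<mu>) ((c1 + c2 + 1) * A) \<and> hbd \<alpha> (k2 w \<mu>) ((c1 + c2 + 1) * A)" if w: "c2bd w A" and \<mu>: "c2bd \<mu> A" for w \<mu> :: "real^'d \<Rightarrow> real" and A
  proof -
    have A: "A \<ge> 0" by (rule c2bd_nonneg[OF w])
    note hw = c2bd_hbd[OF w \<alpha>, folded d_def, folded c_def]
    note h\<mu> = c2bd_hbd[OF \<mu> \<alpha>, folded d_def, folded c_def]
    note hu = c2bd_hbd[OF c2abd_c2bd[OF u] \<alpha>, folded d_def, folded c_def]
    note hm = c2bd_hbd[OF c2abd_c2bd[OF m] \<alpha>, folded d_def, folded c_def]
    have g: "hbd \<alpha> (grad_dot u w) (d * (2 * (c * B) * (c * A)))" "hbd \<alpha> (grad_dot m w) (d * (2 * (c * B) * (c * A)))"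
      unfolding d_def by (intro hbd_grad_dot hu hw hm)+
    have h1: "hbd \<alpha> (k1 w \<mu>) (d * (2 * (c * B) * (c * A)) + 2 * B * (c * A))"
      unfolding k1_def[abs_def] by (intro hbd_diff g hbd_mult a h\<mu>)
    also have "d * (2 * (c * B) * (c * A)) + 2 * B * (c * A) = c1 * A" by (simp add: c1_def algebra_simps)
    finally have h1: "hbd \<alpha> (k1 w \<mu>) (c1 * A)" .
    have "hbd \<alpha> (\<lambda>x. k1 w \<mu> x + lam * w x) (c1 * A + \<bar>lam\<bar> * (c * A))"
      by (intro hbd_add h1 hbd_cmult hw)
    then have "hbd \<alpha> (k2 w \<mu>) ((4 * d * c\<^sup>2 * A * B + d * (2 * (c * B) * (c * A))) + 2 * (c * B) * (c1 * A + \<bar>lam\<bar> * (c * A)))"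
      unfolding k2_def[abs_def] using hbd_divg[OF \<mu> u \<alpha>, folded d_def, folded c_def]
      by (intro hbd_diff hbd_uminus g hbd_mult hm)
    also have "(4 * d * c\<^sup>2 * A * B + d * (2 * (c * B) * (c * A))) + 2 * (c * B) * (c1 * A + \<bar>lam\<bar> * (c * A)) = c2 * A"
      using lam by (simp add: c2_def algebra_simps)
    finally have h2: "hbd \<alpha> (k2 w \<mu>) (c2 * A)" .
    have "c1 * A \<le> (c1 + c2 + 1) * A" "c2 * A \<le> (c1 + c2 + 1) * A" using pos A by (auto intro!: mult_right_mono)
    then show ?thesis using h1 h2 hbd_mono by blast
  qed
  moreover have "c1 + c2 + 1 > 0" using pos by linarith
  ultimately show ?thesis by blast
qed

text \<open>Solving the first equation for the Laplacian of \<open>w\<close> gives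
  \<open>lam * w + k1 - lin1\<close>. Inserted into the second equation, the part with
  \<open>lin1\<close> remains as a known term.\<close>

lemma lin_k:
  assumes "torus_C2 w" "torus_C2 \<mu>"
  shows "lin1 lam a u w \<mu> x = - lap w x + lam * w x + k1 w \<mu> x"
    and "lin2 lam u m w \<mu> x = - lap \<mu> x + lam * \<mu> x + k2 w \<mu> x + m x * lin1 lam a u w \<mu> x"
  using divg_expand[OF torus_C2_C1(1)[OF tm] assms(1), of x]
  by (simp_all add: lin1_def lin2_def k1_def k2_def algebra_simps)

text \<open>By \<open>lin_k\<close> the system with data \<open>\<xi>\<close>,
  \<open>\<zeta>\<close> is equivalent to \<open>p + Kop p = y\<close>, where the components of
  \<open>y\<close> are the resolvent applied to \<open>\<xi>\<close> and to
  \<open>\<zeta> - m \<xi>\<close>. Surjectivity and the lower bound from Riesz theory become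
  solvability and the a priori estimate.\<close>

lemma invertible:
  obtains C where "C > 0"
    "\<And>\<xi> \<zeta>. C0a \<alpha> \<xi> \<Longrightarrow> C0a \<alpha> \<zeta> \<Longrightarrow> \<exists>w \<mu>. C2a \<alpha> w \<and> C2a \<alpha> \<mu> \<and> (\<forall>x. lin1 lam a u w \<mu> x = \<xi> x) \<and> (\<forall>x. lin2 lam u m w \<mu> x = \<zeta> x)"
    "\<And>w \<mu> A. C2a \<alpha> w \<Longrightarrow> C2a \<alpha> \<mu> \<Longrightarrow> hbd \<alpha> (lin1 lam a u w \<mu>) A \<Longrightarrow> hbd \<alpha> (lin2 lam u m w \<mu>) A \<Longrightarrow> XN \<alpha> (w, \<mu>) \<le> C * A"
proof -
  obtain KT where KT: "KT > 0" "\<And>(\<xi> :: real^'d \<Rightarrow> real) A. hbd \<alpha> \<xi> A \<Longrightarrow> c2abd \<alpha> (Tsolve lam \<xi>) (KT * A)"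
    "\<And>(\<xi> :: real^'d \<Rightarrow> real) A x. hbd \<alpha> \<xi> A \<Longrightarrow> - lap (Tsolve lam \<xi>) x + lam * Tsolve lam \<xi> x = \<xi> x"
    using Tsolve_schauder[OF lam \<alpha>] by metis
  obtain Ck where Ck: "Ck > 0" "\<And>w \<mu> A. c2bd w A \<Longrightarrow> c2bd \<mu> A \<Longrightarrow> hbd \<alpha> (k1 w \<mu>) (Ck * A)"
    "\<And>w \<mu> A. c2bd w A \<Longrightarrow> c2bd \<mu> A \<Longrightarrow> hbd \<alpha> (k2 w \<mu>) (Ck * A)"
    using k_bound by metis
  define cd where "cd = 1 + real CARD('d) + 2 * (real CARD('d))\<^sup>2"
  have cd: "cd > 0" by (simp add: cd_def add_pos_nonneg)
  have TN: "norm2a \<alpha> (Tsolve lam \<xi>) \<le> cd * (KT * A)" if "hbd \<alpha> \<xi> A" for \<xi> :: "real^'d \<Rightarrow> real" and A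
    using norm2a_le[OF KT(2)[OF that]] by (simp add: cd_def)
  have TC: "C2a \<alpha> (Tsolve lam \<xi>)" if "hbd \<alpha> \<xi> A" for \<xi> :: "real^'d \<Rightarrow> real" and A
    using c2abd_imp_C2a[OF KT(2)[OF that]] .
  have Tlin: "Tsolve lam (\<lambda>x. s * \<xi> x + t * \<zeta> x) = (\<lambda>x. s * Tsolve lam \<xi> x + t * Tsolve lam \<zeta> x)"
    if "hbd \<alpha> \<xi> A" "hbd \<alpha> \<zeta> A'" for \<xi> \<zeta> :: "real^'d \<Rightarrow> real" and A A' s t
  proof (rule Tsolve_eqI[OF lam])
    have t: "torus_C2 (Tsolve lam \<xi>)" "torus_C2 (Tsolve lam \<zeta>)" using TC that C2aD by blast+
    show "torus_C2 (\<lambda>x. s * Tsolve lam \<xi> x + t * Tsolve lam \<zeta> x)" by (rule torus_C2_lincomb(1)[OF t])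
    show "- lap (\<lambda>x. s * Tsolve lam \<xi> x + t * Tsolve lam \<zeta> x) x + lam * (s * Tsolve lam \<xi> x + t * Tsolve lam \<zeta> x) = s * \<xi> x + t * \<zeta> x" for x
      unfolding lap_lincomb[OF t] using KT(3)[OF that(1), of x, symmetric] KT(3)[OF that(2), of x, symmetric]
      by (simp only:) (simp add: algebra_simps)
  qed
  define Kop where "Kop p = (Tsolve lam (k1 (fst p) (snd p)), Tsolve lam (k2 (fst p) (snd p)))" for p
  interpret X: complete_norm_on "XS \<alpha> :: ((real^'d \<Rightarrow> real) \<times> (real^'d \<Rightarrow> real)) set" "XN \<alpha>" by (rule XS_complete_norm)
  have Xc: "c2abd \<alpha> (fst p) (XN \<alpha> p)" "c2abd \<alpha> (snd p) (XN \<alpha> p)" "torus_C2 (fst p)" "torus_C2 (snd p)"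
    if "p \<in> XS \<alpha>" for p :: "(real^'d \<Rightarrow> real) \<times> (real^'d \<Rightarrow> real)"
    using XS_bounds[OF that] that C2aD(1) by (auto simp: XS_def)
  have kb: "hbd \<alpha> (k1 (fst p) (snd p)) (Ck * A)" "hbd \<alpha> (k2 (fst p) (snd p)) (Ck * A)"
    if "c2bd (fst p) A" "c2bd (snd p) A" for p A using Ck that by auto
  have kX: "hbd \<alpha> (k1 (fst p) (snd p)) (Ck * XN \<alpha> p)" "hbd \<alpha> (k2 (fst p) (snd p)) (Ck * XN \<alpha> p)"
    if "p \<in> XS \<alpha>" for p using kb[OF c2abd_c2bd c2abd_c2bd] Xc[OF that] by auto
  have Klin: "Kop (s *\<^sub>R p + t *\<^sub>R q) = s *\<^sub>R Kop p + t *\<^sub>R Kop q" if "p \<in> XS \<alpha>" "q \<in> XS \<alpha>" for p q s t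
  proof -
    note T = Xc(3,4)[OF that(1)] Xc(3,4)[OF that(2)]
    have f: "fst (s *\<^sub>R p + t *\<^sub>R q) = (\<lambda>x. s * fst p x + t * fst q x)" "snd (s *\<^sub>R p + t *\<^sub>R q) = (\<lambda>x. s * snd p x + t * snd q x)"
      by (auto simp: plus_fun_def scaleR_fun_def)
    have "k1 (\<lambda>x. s * fst p x + t * fst q x) (\<lambda>x. s * snd p x + t * snd q x) = (\<lambda>x. s * k1 (fst p) (snd p) x + t * k1 (fst q) (snd q) x)"
      "k2 (\<lambda>x. s * fst p x + t * fst q x) (\<lambda>x. s * snd p x + t * snd q x) = (\<lambda>x. s * k2 (fst p) (snd p) x + t * k2 (fst q) (snd q) x)"
      using k_lincomb[OF T(1,3,2,4)] by blast+
    then show ?thesis unfolding Kop_def f using Tlin[OF kX(1)[OF that(1)] kX(1)[OF that(2)], of s t] Tlin[OF kX(2)[OF that(1)] kX(2)[OF that(2)], of s t]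
      by (simp add: plus_fun_def scaleR_fun_def)
  qed
  have KN: "XN \<alpha> (Kop p) \<le> 2 * cd * KT * Ck * A" if "c2bd (fst p) A" "c2bd (snd p) A" for p A
    using TN[OF kb(1)[OF that]] TN[OF kb(2)[OF that]] by (simp add: XN_def Kop_def)
  have KV: "Kop p \<in> XS \<alpha>" if "p \<in> XS \<alpha>" for p
    using TC[OF kX(1)[OF that]] TC[OF kX(2)[OF that]] by (simp add: XS_def Kop_def)
  interpret F: compact_perturbation "XS \<alpha> :: ((real^'d \<Rightarrow> real) \<times> (real^'d \<Rightarrow> real)) set" "XN \<alpha>" Kop "2 * cd * KT * Ck"
  proof
    show "Kop p \<in> XS \<alpha>" if "p \<in> XS \<alpha>" for p by (rule KV[OF that])
    show "Kop (p + q) = Kop p + Kop q" if "p \<in> XS \<alpha>" "q \<in> XS \<alpha>" for p q using Klin[OF that, of 1 1] by simp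
    show "Kop (c *\<^sub>R p) = c *\<^sub>R Kop p" if "p \<in> XS \<alpha>" for p c using Klin[OF that that, of c 0] by simp
    show "XN \<alpha> (Kop p) \<le> 2 * cd * KT * Ck * XN \<alpha> p" if "p \<in> XS \<alpha>" for p
      by (rule KN) (use Xc[OF that] c2abd_c2bd in auto)
  next
    fix X :: "nat \<Rightarrow> (real^'d \<Rightarrow> real) \<times> (real^'d \<Rightarrow> real)" and b
    assume X: "\<And>n. X n \<in> XS \<alpha>" and b: "\<And>n. XN \<alpha> (X n) \<le> b"
    have c: "c2abd \<alpha> (fst (X n)) b" "c2abd \<alpha> (snd (X n)) b" for n using Xc(1,2)[OF X[of n]] b[of n] c2abd_mono by blast+
    obtain r where r: "strict_mono (r :: nat \<Rightarrow> nat)"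
      "\<And>e. e > 0 \<Longrightarrow> \<exists>N. \<forall>m\<ge>N. \<forall>n\<ge>N. c2bd (\<lambda>x. fst (X (r m)) x - fst (X (r n)) x) e \<and> c2bd (\<lambda>x. snd (X (r m)) x - snd (X (r n)) x) e"
      by (rule c2abd_compact[of \<alpha> "\<lambda>n. fst (X n)" b "\<lambda>n. snd (X n)", OF c \<alpha>]) blast
    have "\<exists>M. \<forall>m\<ge>M. \<forall>n\<ge>M. XN \<alpha> (Kop (X (r m)) - Kop (X (r n))) < e" if e: "e > 0" for e
    proof -
      define e' where "e' = e / (2 * (2 * cd * KT * Ck))"
      have "e' > 0" using e cd KT Ck by (simp add: e'_def)
      then obtain N where N: "\<And>m n. m \<ge> N \<Longrightarrow> n \<ge> N \<Longrightarrow> c2bd (\<lambda>x. fst (X (r m)) x - fst (X (r n)) x) e' \<and> c2bd (\<lambda>x. snd (X (r m)) x - snd (X (r n)) x) e'"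
        using r(2) by blast
      have "XN \<alpha> (Kop (X (r m)) - Kop (X (r n))) < e" if "m \<ge> N" "n \<ge> N" for m n
      proof -
        have "Kop (X (r m)) - Kop (X (r n)) = Kop (X (r m) - X (r n))"
          using Klin[OF X X, of 1 "r m" "-1" "r n"] by simp
        moreover have "XN \<alpha> (Kop (X (r m) - X (r n))) \<le> 2 * cd * KT * Ck * e'"
          by (rule KN) (use N[OF that] in \<open>auto simp: fun_diff_def\<close>)
        moreover have "2 * cd * KT * Ck * e' < e" using e cd KT(1) Ck(1) by (simp add: e'_def)
        ultimately show ?thesis by simp
      qed
      then show ?thesis by blast
    qed
    from X.N_complete[of "\<lambda>n. Kop (X (r n))", OF KV[OF X] this]
    show "\<exists>r. strict_mono r \<and> (\<exists>l\<in>XS \<alpha>. (\<lambda>n. XN \<alpha> (Kop (X (r n)) - l)) \<longlonglongrightarrow> 0)" using r(1) by blast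
  next
    fix p :: "(real^'d \<Rightarrow> real) \<times> (real^'d \<Rightarrow> real)"
    assume p: "p \<in> XS \<alpha>" "p + Kop p = 0"
    obtain w \<mu> where wm: "p = (w, \<mu>)" by (cases p)
    note T = Xc(3,4)[OF p(1), unfolded wm fst_conv snd_conv]
    note k = kX[OF p(1), unfolded wm fst_conv snd_conv]
    \<comment> \<open>The negatives are written as linear combinations so that
      \<open>lap_lincomb\<close> applies to them.\<close>
    have z: "Tsolve lam (k1 w \<mu>) = (\<lambda>x. (-1) * w x + 0 * w x)" "Tsolve lam (k2 w \<mu>) = (\<lambda>x. (-1) * \<mu> x + 0 * \<mu> x)"
      using p(2) by (auto simp: wm Kop_def plus_fun_def zero_fun_def fun_eq_iff zero_prod_def add_eq_0_iff2)
    have e1: "- lap w x + lam * w x + k1 w \<mu> x = 0" for x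
      using KT(3)[OF k(1), of x] unfolding z lap_lincomb[OF T(1) T(1)] by simp
    have e2: "- lap \<mu> x + lam * \<mu> x + k2 w \<mu> x = 0" for x
      using KT(3)[OF k(2), of x] unfolding z lap_lincomb[OF T(2) T(2)] by simp
    have l1: "lin1 lam a u w \<mu> x = 0" for x using lin_k(1)[OF T] e1 by simp
    have l2: "lin2 lam u m w \<mu> x = 0" for x using lin_k(2)[OF T] e2 l1 by simp
    show "p = 0" using inj[OF T l1 l2] by (simp add: wm zero_prod_def zero_fun_def)
  qed
  obtain C0 where C0: "C0 > 0" "\<And>p. p \<in> XS \<alpha> \<Longrightarrow> XN \<alpha> p \<le> C0 * XN \<alpha> (F.S p)" using F.bounded_below by blast
  define dc where "dc = (real CARD('d) + 2) * B"
  have hm: "hbd \<alpha> m dc" unfolding dc_def by (rule c2bd_hbd(1)[OF c2abd_c2bd[OF m] \<alpha>])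
  have dc0: "dc \<ge> 0" by (rule hbd_nonneg[OF hm])
  have h2: "hbd \<alpha> (\<lambda>x. \<zeta> x - m x * \<xi> x) ((1 + 2 * dc) * A)" if "hbd \<alpha> \<xi> A" "hbd \<alpha> \<zeta> A" for \<xi> \<zeta> A
  proof -
    have "hbd \<alpha> (\<lambda>x. \<zeta> x - m x * \<xi> x) (A + 2 * dc * A)" by (intro hbd_diff hbd_mult hm that)
    then show ?thesis by (simp add: algebra_simps)
  qed
  show ?thesis
  proof (rule that[of "C0 * (cd * KT * (2 + 2 * dc))"])
    show "0 < C0 * (cd * KT * (2 + 2 * dc))" using C0 cd KT dc0 by simp
  next
    fix \<xi> \<zeta> :: "real^'d \<Rightarrow> real" assume "C0a \<alpha> \<xi>" "C0a \<alpha> \<zeta>"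
    then obtain A1 A2 where "hbd \<alpha> \<xi> A1" "hbd \<alpha> \<zeta> A2" using C0a_iff_hbd[OF \<alpha>(1)] by blast
    then have h: "hbd \<alpha> \<xi> (max A1 A2)" "hbd \<alpha> \<zeta> (max A1 A2)" using hbd_mono by (meson max.cobounded1 max.cobounded2)+
    note h3 = h2[OF h]
    define y where "y = (Tsolve lam \<xi>, Tsolve lam (\<lambda>x. \<zeta> x - m x * \<xi> x))"
    have yX: "y \<in> XS \<alpha>" using TC[OF h(1)] TC[OF h3] by (simp add: y_def XS_def)
    then obtain p where p: "p \<in> XS \<alpha>" "F.S p = y" using F.surjective by blast
    obtain w \<mu> where wm: "p = (w, \<mu>)" by (cases p)
    note T = Xc(3,4)[OF p(1), unfolded wm fst_conv snd_conv]
    note k = kX[OF p(1), unfolded wm fst_conv snd_conv]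
    have t1: "torus_C2 (Tsolve lam (k1 w \<mu>))" "torus_C2 (Tsolve lam (k2 w \<mu>))" using TC k C2aD by blast+
    have s: "Tsolve lam \<xi> = (\<lambda>x. 1 * w x + 1 * Tsolve lam (k1 w \<mu>) x)" "Tsolve lam (\<lambda>x. \<zeta> x - m x * \<xi> x) = (\<lambda>x. 1 * \<mu> x + 1 * Tsolve lam (k2 w \<mu>) x)"
      using p(2) by (auto simp: wm F.S_def Kop_def y_def plus_fun_def)
    have e1: "- lap w x + lam * w x + k1 w \<mu> x = \<xi> x" for x
      using KT(3)[OF h(1), of x] KT(3)[OF k(1), of x] unfolding s lap_lincomb[OF T(1) t1(1)] by (simp add: algebra_simps)
    have e2: "- lap \<mu> x + lam * \<mu> x + k2 w \<mu> x = \<zeta> x - m x * \<xi> x" for x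
      using KT(3)[OF h3, of x] KT(3)[OF k(2), of x] unfolding s lap_lincomb[OF T(2) t1(2)] by (simp add: algebra_simps)
    have l1: "lin1 lam a u w \<mu> x = \<xi> x" for x using lin_k(1)[OF T] e1 by simp
    have l2: "lin2 lam u m w \<mu> x = \<zeta> x" for x using lin_k(2)[OF T, of x] e2[of x] l1[of x] by simp
    show "\<exists>w \<mu>. C2a \<alpha> w \<and> C2a \<alpha> \<mu> \<and> (\<forall>x. lin1 lam a u w \<mu> x = \<xi> x) \<and> (\<forall>x. lin2 lam u m w \<mu> x = \<zeta> x)"
      using l1 l2 p(1) unfolding wm XS_def by auto
  next
    fix w \<mu> A assume w: "C2a \<alpha> w" and \<mu>: "C2a \<alpha> \<mu>" and h: "hbd \<alpha> (lin1 lam a u w \<mu>) A" "hbd \<alpha> (lin2 lam u m w \<mu>) A"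
    have p: "(w, \<mu>) \<in> XS \<alpha>" using w \<mu> by (simp add: XS_def)
    note T = Xc(3,4)[OF p, unfolded fst_conv snd_conv]
    note k = kX[OF p, unfolded fst_conv snd_conv]
    note h3 = h2[OF h]
    have t1: "torus_C2 (Tsolve lam (k1 w \<mu>))" "torus_C2 (Tsolve lam (k2 w \<mu>))" using TC k C2aD by blast+
    have s1: "Tsolve lam (lin1 lam a u w \<mu>) = (\<lambda>x. 1 * w x + 1 * Tsolve lam (k1 w \<mu>) x)"
    proof (rule Tsolve_eqI[OF lam torus_C2_lincomb(1)[OF T(1) t1(1)]])
      show "- lap (\<lambda>x. 1 * w x + 1 * Tsolve lam (k1 w \<mu>) x) x + lam * (1 * w x + 1 * Tsolve lam (k1 w \<mu>) x) = lin1 lam a u w \<mu> x" for x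
        unfolding lap_lincomb[OF T(1) t1(1)] using KT(3)[OF k(1), of x] lin_k(1)[OF T, of x] by (simp add: algebra_simps)
    qed
    have s2: "Tsolve lam (\<lambda>x. lin2 lam u m w \<mu> x - m x * lin1 lam a u w \<mu> x) = (\<lambda>x. 1 * \<mu> x + 1 * Tsolve lam (k2 w \<mu>) x)"
    proof (rule Tsolve_eqI[OF lam torus_C2_lincomb(1)[OF T(2) t1(2)]])
      show "- lap (\<lambda>x. 1 * \<mu> x + 1 * Tsolve lam (k2 w \<mu>) x) x + lam * (1 * \<mu> x + 1 * Tsolve lam (k2 w \<mu>) x) = lin2 lam u m w \<mu> x - m x * lin1 lam a u w \<mu> x" for x
        unfolding lap_lincomb[OF T(2) t1(2)] using KT(3)[OF k(2), of x] lin_k(2)[OF T, of x] by (simp add: algebra_simps)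
    qed
    have "F.S (w, \<mu>) = (Tsolve lam (lin1 lam a u w \<mu>), Tsolve lam (\<lambda>x. lin2 lam u m w \<mu> x - m x * lin1 lam a u w \<mu> x))"
      unfolding s1 s2 F.S_def Kop_def by (simp add: plus_fun_def)
    then have "XN \<alpha> (F.S (w, \<mu>)) \<le> cd * (KT * A) + cd * (KT * ((1 + 2 * dc) * A))"
      using TN[OF h(1)] TN[OF h3] by (simp add: XN_def)
    also have "\<dots> = cd * KT * (2 + 2 * dc) * A" by (simp add: algebra_simps)
    finally have "C0 * XN \<alpha> (F.S (w, \<mu>)) \<le> C0 * (cd * KT * (2 + 2 * dc) * A)" using C0(1) by (intro mult_left_mono) auto
    then show "XN \<alpha> (w, \<mu>) \<le> C0 * (cd * KT * (2 + 2 * dc)) * A" using C0(2)[OF p] by (simp add: mult.assoc)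
  qed
qed

end

section \<open>Newton's method\<close>

text \<open>The mean value inequality for \<open>F r - F' t * r\<close>. It is applied to f, where
  \<open>\<eta>\<close> is a multiple of the error, and to f', where \<open>\<eta>\<close> is the
  oscillation of f''.\<close>

lemma taylor1_bound:
  fixes F F' :: "real \<Rightarrow> real"
  assumes F: "\<And>r. (F has_real_derivative F' r) (at r)"
    and e: "\<And>r. r \<in> closed_segment t s \<Longrightarrow> \<bar>F' r - F' t\<bar> \<le> \<eta>"
  shows "\<bar>F s - F t - F' t * (s - t)\<bar> \<le> \<eta> * \<bar>s - t\<bar>"
proof -
  have "norm ((F s - F' t * s) - (F t - F' t * t)) \<le> \<eta> * norm (s - t)"
  proof (rule field_differentiable_bound[where S = "closed_segment t s" and f' = "\<lambda>r. F' r - F' t"])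
    show "((\<lambda>r. F r - F' t * r) has_real_derivative F' r - F' t) (at r within closed_segment t s)" for r
      by (rule has_field_derivative_at_within) (auto intro!: derivative_eq_intros F)
  qed (use e in auto)
  then show ?thesis by (simp add: algebra_simps)
qed

lemma C1_periodic_hbd:
  fixes b :: "real^'d::finite \<Rightarrow> real"
  assumes b: "C1_fun b" "periodic b" and \<alpha>: "0 < \<alpha>" "\<alpha> < 1"
  shows "\<exists>A. hbd \<alpha> b A"
proof -
  obtain B0 where B0: "\<And>x. \<bar>b x\<bar> \<le> B0" using periodic_bounded[OF b(2) C1_fun_cont[OF b(1)]] by blast
  have "\<forall>i. \<exists>B. \<forall>x. \<bar>pd i b x\<bar> \<le> B" using periodic_bounded periodic_pd[OF b(2)] pd_cont[OF b(1)] by blast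
  then obtain B1 where B1: "\<And>i x. \<bar>pd i b x\<bar> \<le> B1 i" by metis
  have B10: "B1 i \<ge> 0" for i using B1[of i 0] by linarith
  define A where "A = \<bar>B0\<bar> + (\<Sum>i\<in>UNIV. B1 i)"
  have "B1 i \<le> (\<Sum>i\<in>UNIV. B1 i)" for i by (rule member_le_sum) (use B10 in auto)
  then have "\<bar>pd i b x\<bar> \<le> A" for i x using B1[of i x] unfolding A_def by (smt (verit))
  moreover have "\<bar>b x\<bar> \<le> A" for x using B0[of x] sum_nonneg[of UNIV B1] B10 unfolding A_def by fastforce
  ultimately show ?thesis using hbd_of_C1[OF b _ _ \<alpha>] by blast
qed

lemma C2a_hbd:
  fixes v :: "real^'d::finite \<Rightarrow> real"
  assumes "C2a \<alpha> v" "0 < \<alpha>" "\<alpha> < 1"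
  shows "\<exists>A. c2abd \<alpha> v A \<and> (\<forall>i. hbd \<alpha> (pd i v) A)"
proof -
  define A where "A = norm2a \<alpha> v"
  have c: "c2abd \<alpha> v A" unfolding A_def by (rule c2abd_norm2a[OF assms(1)])
  have A: "A \<ge> 0" using c2bd_nonneg[OF c2abd_c2bd[OF c]] .
  have "A \<le> (real CARD('d) + 2) * A" using mult_right_mono[OF _ A, of 1 "real CARD('d) + 2"] by simp
  then have "c2abd \<alpha> v ((real CARD('d) + 2) * A)" using c c2abd_mono by blast
  then show ?thesis using c2bd_hbd(2)[OF c2abd_c2bd[OF c] assms(2,3)] by blast
qed

lemma all_eq_zero_iff:
  fixes a b c :: "'a \<Rightarrow> real"
  assumes "\<And>x. a x - b x = c x"
  shows "(\<forall>x. c x = 0) \<longleftrightarrow> (\<forall>x. a x = b x)"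
  unfolding assms[symmetric] by simp

lemma C0a_add: "\<alpha> > 0 \<Longrightarrow> C0a \<alpha> g \<Longrightarrow> C0a \<alpha> k \<Longrightarrow> C0a \<alpha> (\<lambda>x. g x + k x)"
  using hbd_add unfolding C0a_iff_hbd by blast

lemma C0a_diff: "\<alpha> > 0 \<Longrightarrow> C0a \<alpha> g \<Longrightarrow> C0a \<alpha> k \<Longrightarrow> C0a \<alpha> (\<lambda>x. g x - k x)"
  using hbd_diff unfolding C0a_iff_hbd by blast

lemma C0a_mult: "\<alpha> > 0 \<Longrightarrow> C0a \<alpha> g \<Longrightarrow> C0a \<alpha> k \<Longrightarrow> C0a \<alpha> (\<lambda>x. g x * k x)"
  using hbd_mult unfolding C0a_iff_hbd by blast

lemma C0a_cmult: "\<alpha> > 0 \<Longrightarrow> C0a \<alpha> g \<Longrightarrow> C0a \<alpha> (\<lambda>x. c * g x)"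
  using hbd_cmult unfolding C0a_iff_hbd by blast

lemma C0a_uminus: "\<alpha> > 0 \<Longrightarrow> C0a \<alpha> g \<Longrightarrow> C0a \<alpha> (\<lambda>x. - g x)"
  using hbd_uminus unfolding C0a_iff_hbd by blast

lemma C1_diff:
  assumes "C1_fun u" "C1_fun v"
  shows "C1_fun (\<lambda>x. u x - v x) \<and> (\<forall>i. pd i (\<lambda>x. u x - v x) = (\<lambda>x. pd i u x - pd i v x))"
  using C1_lincomb[OF assms, of 1 "-1"] by simp

lemma grad_dot_diff:
  assumes "C1_fun v" "C1_fun w"
  shows "grad_dot u (\<lambda>x. v x - w x) x = grad_dot u v x - grad_dot u w x"
    "grad_dot (\<lambda>x. v x - w x) u x = grad_dot v u x - grad_dot w u x"
  using grad_dot_lincomb[OF assms, of u 1 "-1" x] grad_dot_commute[of _ u x] by simp_all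

lemma divg_diff_left:
  assumes "C1_fun m" "C1_fun m'" "torus_C2 u"
  shows "divg (\<lambda>x. m x - m' x) u x = divg m u x - divg m' u x"
  using divg_lincomb_left[OF assms, of 1 "-1"] by simp

lemma divg_diff_right:
  assumes "C1_fun m" "torus_C2 u" "torus_C2 u'"
  shows "divg m (\<lambda>x. u x - u' x) x = divg m u x - divg m u' x"
  using divg_lincomb_right[OF assms, of 1 "-1"] by simp

text \<open>Hoelder data guarantee that \<open>Tsolve\<close> returns a solution; with this the
  fixed-point form of a Newton step turns into a differential equation.\<close>

lemma Tsolve_add_zero_iff:
  fixes v \<xi> :: "real^'d::finite \<Rightarrow> real"
  assumes "lam > 0" "0 < \<alpha>" "\<alpha> < 1" "C0a \<alpha> \<xi>" and v: "torus_C2 v"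
  shows "(\<forall>x. v x + Tsolve lam \<xi> x = 0) \<longleftrightarrow> (\<forall>x. - lap v x + lam * v x + \<xi> x = 0)"
proof -
  obtain A where A: "hbd \<alpha> \<xi> A" using assms C0a_iff_hbd by blast
  have lv: "lap (\<lambda>x. (-1) * v x + 0 * v x) x = - lap v x" for x unfolding lap_lincomb[OF v v] by simp
  have tv: "torus_C2 (\<lambda>x. (-1) * v x + 0 * v x)" by (rule torus_C2_lincomb(1)[OF v v])
  show ?thesis
  proof
    assume "\<forall>x. v x + Tsolve lam \<xi> x = 0"
    then have T: "Tsolve lam \<xi> = (\<lambda>x. (-1) * v x + 0 * v x)" by (auto simp: fun_eq_iff add_eq_0_iff2)
    have "- lap (Tsolve lam \<xi>) x + lam * Tsolve lam \<xi> x = \<xi> x" for x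
      using Tsolve_schauder[OF assms(1-3), where ?'d = 'd] A by metis
    then show "\<forall>x. - lap v x + lam * v x + \<xi> x = 0" unfolding T lv by (auto simp: algebra_simps)
  next
    assume e: "\<forall>x. - lap v x + lam * v x + \<xi> x = 0"
    have "Tsolve lam \<xi> = (\<lambda>x. (-1) * v x + 0 * v x)"
      by (rule Tsolve_eqI[OF assms(1) tv]) (use e in \<open>simp add: lv[simplified] algebra_simps add_eq_0_iff2\<close>)
    then show "\<forall>x. v x + Tsolve lam \<xi> x = 0" by simp
  qed
qed

locale mfg_newton =
  fixes lam \<alpha> :: real and f :: "real \<Rightarrow> real" and m0 u m :: "real^'d::finite \<Rightarrow> real"
  assumes lam: "lam > 0" and \<alpha>: "0 < \<alpha>" "\<alpha> < 1" and m0: "C0a \<alpha> m0" and f: "C1b_C2 f"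
    and u: "C2a \<alpha> u" and m: "C2a \<alpha> m" and stable: "stable_sol lam m0 f u m"
begin

abbreviation "f1 \<equiv> deriv f"
abbreviation "f2 \<equiv> deriv (deriv f)"

lemma f_deriv: "(f has_real_derivative f1 s) (at s)" "(f1 has_real_derivative f2 s) (at s)" "continuous_on UNIV f2" "continuous_on UNIV f1"
proof -
  show "(f1 has_real_derivative f2 s) (at s)" for s using f by (auto simp: C1b_C2_def)
  then show "continuous_on UNIV f1" by (meson DERIV_continuous_on has_field_derivative_at_within)
qed (use f in \<open>auto simp: C1b_C2_def\<close>)

lemma tu: "torus_C2 u" and tm: "torus_C2 m"
  using C2aD(1) u m by auto

text \<open>What a Newton step leaves at second order: the squared gradient error and the Taylor
  remainder of f, expanded at \<open>M\<close> and evaluated at \<open>m\<close>. The second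
  equation is bilinear apart from its linear terms, so its counterpart \<open>rho2\<close> is a
  single product of errors.\<close>

definition rho1 where
  "rho1 U M x = (1/2) * grad_dot (\<lambda>x. U x - u x) (\<lambda>x. U x - u x) x - (f (m x) - f (M x) - f1 (M x) * (m x - M x))"

definition rho2 where
  "rho2 U M x = - divg (\<lambda>x. M x - m x) (\<lambda>x. U x - u x) x"

text \<open>An exact identity: the system solved by \<open>(u, m)\<close> is subtracted, and the
  quadratic gradient term is completed to a square. Most of the work is to see that the arguments of
  \<open>Tsolve\<close> are Hoelder continuous, so that the operator can be removed.\<close>

lemma newton_rel_iff:
  assumes C: "C2a \<alpha> U" "C2a \<alpha> M" "C2a \<alpha> U'" "C2a \<alpha> M'"
  shows "newton_rel lam m0 f (U, M) (U', M') \<longleftrightarrow>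
    (\<forall>x. lin1 lam (\<lambda>x. f1 (M x)) U (\<lambda>x. U' x - u x) (\<lambda>x. M' x - m x) x = rho1 U M x) \<and>
    (\<forall>x. lin2 lam U M (\<lambda>x. U' x - u x) (\<lambda>x. M' x - m x) x = rho2 U M x)"
proof -
  define r1 where "r1 x = (1/2) * grad_dot U U x - f (M x) + (grad_dot U (\<lambda>x. U' x - U x) x - f1 (M x) * (M' x - M x))" for x
  define r2 where "r2 x = - divg M U x - lam * m0 x + (- divg (\<lambda>x. M' x - M x) U x - divg M (\<lambda>x. U' x - U x) x)" for x
  have t: "torus_C2 U" "torus_C2 M" "torus_C2 U'" "torus_C2 M'" using C C2aD(1) by auto
  note c = torus_C2_C1(1)[OF t(1)] torus_C2_C1(1)[OF t(2)] torus_C2_C1(1)[OF t(3)] torus_C2_C1(1)[OF t(4)]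
    torus_C2_C1(1)[OF tu] torus_C2_C1(1)[OF tm]
  have dC: "C2a \<alpha> (\<lambda>x. U' x - U x)" "C2a \<alpha> (\<lambda>x. M' x - M x)" using C2a_diff C by auto
  obtain A1 where A1: "c2abd \<alpha> U A1" "\<And>i. hbd \<alpha> (pd i U) A1" using C2a_hbd[OF C(1) \<alpha>] by blast
  obtain A2 where A2: "c2abd \<alpha> M A2" "\<And>i. hbd \<alpha> (pd i M) A2" using C2a_hbd[OF C(2) \<alpha>] by blast
  obtain A3 where A3: "c2abd \<alpha> (\<lambda>x. U' x - U x) A3" "\<And>i. hbd \<alpha> (pd i (\<lambda>x. U' x - U x)) A3" using C2a_hbd[OF dC(1) \<alpha>] by blast
  obtain A4 where A4: "c2abd \<alpha> (\<lambda>x. M' x - M x) A4" "\<And>i. hbd \<alpha> (pd i (\<lambda>x. M' x - M x)) A4" using C2a_hbd[OF dC(2) \<alpha>] by blast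
  have "periodic (\<lambda>x. f (M x))" "periodic (\<lambda>x. f1 (M x))" using torus_C2_periodic[OF t(2)] by (auto simp: periodic_def)
  then obtain A5 A6 where A5: "hbd \<alpha> (\<lambda>x. f (M x)) A5" "hbd \<alpha> (\<lambda>x. f1 (M x)) A6"
    using C1_periodic_hbd[OF _ _ \<alpha>] C1_compose[OF c(2) f_deriv(1) f_deriv(4)] C1_compose[OF c(2) f_deriv(2) f_deriv(3)] by metis
  have g: "C0a \<alpha> (grad_dot U U)" "C0a \<alpha> (grad_dot U (\<lambda>x. U' x - U x))" "C0a \<alpha> (divg M U)"
      "C0a \<alpha> (divg (\<lambda>x. M' x - M x) U)" "C0a \<alpha> (divg M (\<lambda>x. U' x - U x))" "C0a \<alpha> (\<lambda>x. M' x - M x)"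
      "C0a \<alpha> (\<lambda>x. f (M x))" "C0a \<alpha> (\<lambda>x. f1 (M x))"
    using hbd_grad_dot[OF A1(2) A1(2)] hbd_grad_dot[OF A1(2) A3(2)] hbd_divg[OF c2abd_c2bd[OF A2(1)] A1(1) \<alpha>]
      hbd_divg[OF c2abd_c2bd[OF A4(1)] A1(1) \<alpha>] hbd_divg[OF c2abd_c2bd[OF A2(1)] A3(1) \<alpha>]
      c2bd_hbd(1)[OF c2abd_c2bd[OF A4(1)] \<alpha>] A5 unfolding C0a_iff_hbd[OF \<alpha>(1)] by blast+
  have C1: "C0a \<alpha> r1" unfolding r1_def[abs_def]
    by (intro C0a_add C0a_diff C0a_cmult C0a_mult \<alpha>(1) g)
  have C2: "C0a \<alpha> r2" unfolding r2_def[abs_def]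
    by (intro C0a_add C0a_diff C0a_uminus C0a_cmult \<alpha>(1) g m0)
  have sol: "- lap u x + (1/2) * grad_dot u u x + lam * u x = f (m x)" "- lap m x - divg m u x + lam * m x = lam * m0 x" for x
    using stable by (auto simp: stable_sol_def mfg_sol_def)
  have "newton_rel lam m0 f (U, M) (U', M') \<longleftrightarrow> (\<forall>x. U' x + Tsolve lam r1 x = 0) \<and> (\<forall>x. M' x + Tsolve lam r2 x = 0)"
    by (simp add: newton_rel_def Let_def Top_def Gmap_def dGmap_def r1_def[abs_def] r2_def[abs_def])
  also have "\<dots> \<longleftrightarrow> (\<forall>x. - lap U' x + lam * U' x + r1 x = 0) \<and> (\<forall>x. - lap M' x + lam * M' x + r2 x = 0)"
    using Tsolve_add_zero_iff[OF lam \<alpha> C1 t(3)] Tsolve_add_zero_iff[OF lam \<alpha> C2 t(4)] by blast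
  also have "(\<forall>x. - lap U' x + lam * U' x + r1 x = 0) \<longleftrightarrow>
    (\<forall>x. lin1 lam (\<lambda>x. f1 (M x)) U (\<lambda>x. U' x - u x) (\<lambda>x. M' x - m x) x = rho1 U M x)"
  proof -
    have "lin1 lam (\<lambda>x. f1 (M x)) U (\<lambda>x. U' x - u x) (\<lambda>x. M' x - m x) x - rho1 U M x = - lap U' x + lam * U' x + r1 x" for x
    proof -
      have "grad_dot (\<lambda>x. U x - u x) (\<lambda>x. U x - u x) x = grad_dot U U x - 2 * grad_dot U u x + grad_dot u u x"
        unfolding grad_dot_diff(1)[OF c(1,5)] grad_dot_diff(2)[OF c(1,5)] using grad_dot_commute[of u U x] by simp
      then show ?thesis using sol(1)[of x]
        unfolding lin1_def rho1_def r1_def lap_diff[OF t(3) tu] grad_dot_diff(1)[OF c(3,5)] grad_dot_diff(1)[OF c(3,1)]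
        by (simp add: right_diff_distrib diff_divide_distrib add_divide_distrib)
    qed
    then show ?thesis by (rule all_eq_zero_iff)
  qed
  also have "(\<forall>x. - lap M' x + lam * M' x + r2 x = 0) \<longleftrightarrow>
    (\<forall>x. lin2 lam U M (\<lambda>x. U' x - u x) (\<lambda>x. M' x - m x) x = rho2 U M x)"
  proof -
    have "lin2 lam U M (\<lambda>x. U' x - u x) (\<lambda>x. M' x - m x) x - rho2 U M x = - lap M' x + lam * M' x + r2 x" for x
    proof -
      have "C1_fun (\<lambda>x. M x - m x)" using torus_C2_C1(1)[OF torus_C2_diff(1)[OF t(2) tm]] .
      then show ?thesis using sol(2)[of x]
        unfolding lin2_def rho2_def r2_def lap_diff[OF t(4) tm] divg_diff_left[OF c(4,6) t(1)] divg_diff_right[OF c(2) t(3) tu]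
          divg_diff_left[OF c(4,2) t(1)] divg_diff_right[OF c(2) t(3,1)] divg_diff_right[OF \<open>C1_fun (\<lambda>x. M x - m x)\<close> t(1) tu]
          divg_diff_left[OF c(2,6) t(1)] divg_diff_left[OF c(2,6) tu] right_diff_distrib
        by linarith
    qed
    then show ?thesis by (rule all_eq_zero_iff)
  qed
  finally show ?thesis .
qed

section \<open>Size and oscillation of f'' on a neighbourhood of the range of m\<close>

definition B where "B = XN \<alpha> (u, m)"

lemma B_bounds: "c2abd \<alpha> u B" "c2abd \<alpha> m B" "B \<ge> 0"
  using c2abd_mono[OF c2abd_norm2a[OF u], of B] c2abd_mono[OF c2abd_norm2a[OF m], of B]
    norm2a_nonneg[OF u] norm2a_nonneg[OF m] by (auto simp: B_def XN_def)

text \<open>The interval contains the values of \<open>m\<close> and of every \<open>M\<close>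
  within distance 1 of \<open>m\<close>; on it the continuous f'' is bounded by compactness.\<close>

lemma f2_bounded: "\<exists>F2>0. \<forall>s\<in>{-(B+1)..B+1}. \<bar>f2 s\<bar> \<le> F2"
proof -
  have "compact (f2 ` {-(B+1)..B+1})"
    by (rule compact_continuous_image) (use continuous_on_subset[OF f_deriv(3)] in auto)
  from compact_imp_bounded[OF this] obtain F where F: "\<forall>y\<in>f2 ` {-(B+1)..B+1}. norm y \<le> F"
    unfolding bounded_iff by blast
  have "\<forall>s\<in>{-(B+1)..B+1}. \<bar>f2 s\<bar> \<le> \<bar>F\<bar> + 1" using F by force
  then show ?thesis by (intro exI[of _ "\<bar>F\<bar> + 1"]) auto
qed

definition F2 where "F2 = (SOME F2. F2 > 0 \<and> (\<forall>s\<in>{-(B+1)..B+1}. \<bar>f2 s\<bar> \<le> F2))"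

lemma F2: "F2 > 0" "\<And>s. s \<in> {-(B+1)..B+1} \<Longrightarrow> \<bar>f2 s\<bar> \<le> F2"
  using someI_ex[OF f2_bounded] unfolding F2_def by auto

text \<open>A relation between the scale \<open>e\<close> and the oscillation bound
  \<open>\<eta>\<close>, so that \<open>\<eta>\<close> may be a fixed small number in one
  application and a multiple of \<open>e\<close> in another.\<close>

definition modulus where
  "modulus e \<eta> \<longleftrightarrow> (\<forall>s\<in>{-(B+1)..B+1}. \<forall>t\<in>{-(B+1)..B+1}. \<bar>s - t\<bar> \<le> e \<longrightarrow> \<bar>f2 s - f2 t\<bar> \<le> \<eta>)"

lemma modulus_exists:
  assumes "\<eta> > 0" shows "\<exists>\<delta>>0. \<forall>e\<le>\<delta>. modulus e \<eta>"
proof -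
  have "uniformly_continuous_on {-(B+1)..B+1} f2"
    by (rule compact_uniformly_continuous) (use continuous_on_subset[OF f_deriv(3)] in auto)
  then obtain d where d: "d > 0" "\<And>s t. s \<in> {-(B+1)..B+1} \<Longrightarrow> t \<in> {-(B+1)..B+1} \<Longrightarrow> dist s t < d \<Longrightarrow> dist (f2 s) (f2 t) < \<eta>"
    unfolding uniformly_continuous_on_def using assms by metis
  have "modulus e \<eta>" if "e \<le> d / 2" for e
    unfolding modulus_def
  proof safe
    fix s t assume "s \<in> {-(B+1)..B+1}" "t \<in> {-(B+1)..B+1}" "\<bar>s - t\<bar> \<le> e"
    then show "\<bar>f2 s - f2 t\<bar> \<le> \<eta>" using d(2)[of s t] d(1) that by (simp add: dist_real_def)
  qed
  then show ?thesis using d(1) by (intro exI[of _ "d / 2"]) auto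
qed

lemma f1_lipschitz:
  assumes "s \<in> {-(B+1)..B+1}" "t \<in> {-(B+1)..B+1}"
  shows "\<bar>f1 s - f1 t\<bar> \<le> F2 * \<bar>s - t\<bar>"
  using field_differentiable_bound[of "{-(B+1)..B+1}" f1 f2 F2 s t] f_deriv(2) F2(2) assms
  by (simp add: has_field_derivative_at_within)

context
  fixes M e \<eta>
  assumes M: "torus_C2 M" and Me: "c2bd (\<lambda>x. M x - m x) e" and e: "e \<le> 1" and mod: "modulus e \<eta>"
begin

lemma e0: "e \<ge> 0"
  using c2bd_nonneg[OF Me] .

lemma eta0: "\<eta> \<ge> 0"
proof -
  have "0 \<in> {-(B+1)..B+1}" using B_bounds(3) by simp
  from mod[unfolded modulus_def, rule_format, OF this this] have "\<bar>f2 0 - f2 0\<bar> \<le> \<eta>" using e0 by simp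
  then show ?thesis by simp
qed

lemma mM: "\<bar>m x\<bar> \<le> B" "\<bar>M x - m x\<bar> \<le> e" "m x \<in> {-(B+1)..B+1}" "M x \<in> {-(B+1)..B+1}"
  "\<bar>pd i m x\<bar> \<le> B" "\<bar>pd i M x - pd i m x\<bar> \<le> e"
proof -
  show 1: "\<bar>m x\<bar> \<le> B" "\<bar>M x - m x\<bar> \<le> e" "\<bar>pd i m x\<bar> \<le> B"
    using c2bdD(2,3)[OF c2abd_c2bd[OF B_bounds(2)]] c2bdD(2)[OF Me] by auto
  then show "m x \<in> {-(B+1)..B+1}" "M x \<in> {-(B+1)..B+1}" using e by auto
  have "pd i (\<lambda>x. M x - m x) x = pd i M x - pd i m x" using pjet_diff[OF M tm, of "(Some i, None)" x] by simp
  then show "\<bar>pd i M x - pd i m x\<bar> \<le> e" using c2bdD(3)[OF Me, of i x] by simp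
qed

text \<open>The Hoelder seminorm is read off the gradient, split into (f''(M) - f''(m)) DM and
  f''(m) D(M - m): the oscillation of f'' controls the former, the size of M - m the latter.\<close>

lemma f1_difference_hbd: "hbd \<alpha> (\<lambda>x. f1 (M x) - f1 (m x)) ((real CARD('d) + 2) * (\<eta> * (B + 1) + F2 * e))"
proof (rule hbd_of_C1[OF _ _ _ _ \<alpha>])
  note c = torus_C2_C1(1)[OF M] torus_C2_C1(1)[OF tm]
  note d1 = C1_compose[OF c(1) f_deriv(2,3)] and d2 = C1_compose[OF c(2) f_deriv(2,3)]
  note d = C1_lincomb[of "\<lambda>x. f1 (M x)" "\<lambda>x. f1 (m x)" 1 "-1"]
  show "C1_fun (\<lambda>x. f1 (M x) - f1 (m x))" using d d1 d2 by simp
  show "periodic (\<lambda>x. f1 (M x) - f1 (m x))" using torus_C2_periodic[OF M] torus_C2_periodic[OF tm] by (simp add: periodic_def)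
  have nn: "\<eta> * (B + 1) \<ge> 0" "F2 * e \<ge> 0" using eta0 e0 B_bounds(3) F2(1) by auto
  show "\<bar>f1 (M x) - f1 (m x)\<bar> \<le> \<eta> * (B + 1) + F2 * e" for x
  proof -
    have "\<bar>f1 (M x) - f1 (m x)\<bar> \<le> F2 * \<bar>M x - m x\<bar>" using f1_lipschitz mM by blast
    also have "\<dots> \<le> F2 * e" using mM(2) F2(1) by (intro mult_left_mono) auto
    finally show ?thesis using nn by linarith
  qed
  show "\<bar>pd i (\<lambda>x. f1 (M x) - f1 (m x)) x\<bar> \<le> \<eta> * (B + 1) + F2 * e" for i x
  proof -
    have "pd i (\<lambda>x. f1 (M x) - f1 (m x)) x = f2 (M x) * pd i M x - f2 (m x) * pd i m x" using d d1 d2 by simp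
    also have "\<dots> = (f2 (M x) - f2 (m x)) * pd i M x + f2 (m x) * (pd i M x - pd i m x)" by (simp add: algebra_simps)
    finally have eq: "pd i (\<lambda>x. f1 (M x) - f1 (m x)) x = (f2 (M x) - f2 (m x)) * pd i M x + f2 (m x) * (pd i M x - pd i m x)" .
    have 1: "\<bar>f2 (M x) - f2 (m x)\<bar> \<le> \<eta>"
      by (rule mod[unfolded modulus_def, rule_format, OF mM(4,3,2)])
    have 2: "\<bar>pd i M x\<bar> \<le> B + 1" using mM(5,6)[of i x] e by linarith
    have "\<bar>f2 (M x) - f2 (m x)\<bar> * \<bar>pd i M x\<bar> \<le> \<eta> * (B + 1)" by (rule mult_mono[OF 1 2 eta0]) simp
    moreover have "\<bar>f2 (m x)\<bar> * \<bar>pd i M x - pd i m x\<bar> \<le> F2 * e"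
      by (rule mult_mono[OF F2(2)[OF mM(3)] mM(6)]) (use F2(1) in auto)
    ultimately show ?thesis
      unfolding eq using abs_triangle_ineq[of "(f2 (M x) - f2 (m x)) * pd i M x" "f2 (m x) * (pd i M x - pd i m x)"]
      unfolding abs_mult by linarith
  qed
qed

text \<open>
  As $f''$ is merely continuous, the integral form of the remainder need not be Hoelder continuous.
  The seminorm is estimated through the gradient, where only the modulus of continuity of $f''$ enters.
\<close>

lemma taylor_remainder_hbd:
  "hbd \<alpha> (\<lambda>x. f (m x) - f (M x) - f1 (M x) * (m x - M x)) ((real CARD('d) + 2) * ((\<eta> * B + F2 * e) * e))"
proof (rule hbd_of_C1[OF _ _ _ _ \<alpha>])
  note c = torus_C2_C1(1)[OF M] torus_C2_C1(1)[OF tm]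
  have d1: "C1_fun (\<lambda>x. f1 (M x)) \<and> (\<forall>i. pd i (\<lambda>x. f1 (M x)) = (\<lambda>x. f2 (M x) * pd i M x))" by (rule C1_compose[OF c(1) f_deriv(2,3)])
  have d2: "C1_fun (\<lambda>x. f (M x)) \<and> (\<forall>i. pd i (\<lambda>x. f (M x)) = (\<lambda>x. f1 (M x) * pd i M x))" by (rule C1_compose[OF c(1) f_deriv(1,4)])
  have d3: "C1_fun (\<lambda>x. f (m x)) \<and> (\<forall>i. pd i (\<lambda>x. f (m x)) = (\<lambda>x. f1 (m x) * pd i m x))" by (rule C1_compose[OF c(2) f_deriv(1,4)])
  have d4: "C1_fun (\<lambda>x. m x - M x) \<and> (\<forall>i. pd i (\<lambda>x. m x - M x) = (\<lambda>x. pd i m x - pd i M x))"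
    using C1_lincomb[OF c(2,1), of 1 "-1"] by simp
  have d5: "C1_fun (\<lambda>x. f (m x) - f (M x)) \<and> (\<forall>i. pd i (\<lambda>x. f (m x) - f (M x)) = (\<lambda>x. f1 (m x) * pd i m x - f1 (M x) * pd i M x))"
    using C1_lincomb[of "\<lambda>x. f (m x)" "\<lambda>x. f (M x)" 1 "-1"] d2 d3 by simp
  have d6: "C1_fun (\<lambda>x. f1 (M x) * (m x - M x)) \<and> (\<forall>i. pd i (\<lambda>x. f1 (M x) * (m x - M x)) =
      (\<lambda>x. f2 (M x) * pd i M x * (m x - M x) + f1 (M x) * (pd i m x - pd i M x)))"
    using C1_mult[of "\<lambda>x. f1 (M x)" "\<lambda>x. m x - M x"] d1 d4 by simp
  have d7: "C1_fun (\<lambda>x. f (m x) - f (M x) - f1 (M x) * (m x - M x)) \<and> (\<forall>i. pd i (\<lambda>x. f (m x) - f (M x) - f1 (M x) * (m x - M x)) =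
      (\<lambda>x. (f1 (m x) * pd i m x - f1 (M x) * pd i M x) - (f2 (M x) * pd i M x * (m x - M x) + f1 (M x) * (pd i m x - pd i M x))))"
    using C1_diff[of "\<lambda>x. f (m x) - f (M x)" "\<lambda>x. f1 (M x) * (m x - M x)"] d5 d6 by simp
  show "C1_fun (\<lambda>x. f (m x) - f (M x) - f1 (M x) * (m x - M x))" using d7 by blast
  show "periodic (\<lambda>x. f (m x) - f (M x) - f1 (M x) * (m x - M x))"
    using torus_C2_periodic[OF M] torus_C2_periodic[OF tm] by (simp add: periodic_def)
  have nn: "\<eta> * B * e \<ge> 0" using eta0 e0 B_bounds(3) by simp
  have h: "\<bar>m x - M x\<bar> \<le> e" for x using mM(2)[of x] by (simp add: abs_minus_commute)
  have seg: "r \<in> {-(B+1)..B+1}" "\<bar>r - M x\<bar> \<le> \<bar>m x - M x\<bar>" if "r \<in> closed_segment (M x) (m x)" for r x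
    using that mM(3,4)[of x] by (auto simp: closed_segment_eq_real_ivl split: if_splits)
  show "\<bar>f (m x) - f (M x) - f1 (M x) * (m x - M x)\<bar> \<le> (\<eta> * B + F2 * e) * e" for x
  proof -
    have "\<bar>f (m x) - f (M x) - f1 (M x) * (m x - M x)\<bar> \<le> (F2 * e) * \<bar>m x - M x\<bar>"
    proof (rule taylor1_bound[OF f_deriv(1)])
      fix r assume r: "r \<in> closed_segment (M x) (m x)"
      have "\<bar>f1 r - f1 (M x)\<bar> \<le> F2 * \<bar>r - M x\<bar>" using f1_lipschitz seg(1)[OF r] mM(4) by blast
      also have "\<dots> \<le> F2 * e" using seg(2)[OF r] h[of x] F2(1) by (intro mult_left_mono) auto
      finally show "\<bar>f1 r - f1 (M x)\<bar> \<le> F2 * e" .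
    qed
    also have "\<dots> \<le> (F2 * e) * e" using h[of x] F2(1) e0 by (intro mult_left_mono) auto
    finally show ?thesis using nn by (simp add: distrib_right)
  qed
  show "\<bar>pd i (\<lambda>x. f (m x) - f (M x) - f1 (M x) * (m x - M x)) x\<bar> \<le> (\<eta> * B + F2 * e) * e" for i x
  proof -
    have "pd i (\<lambda>x. f (m x) - f (M x) - f1 (M x) * (m x - M x)) x =
      (f1 (m x) * pd i m x - f1 (M x) * pd i M x) - (f2 (M x) * pd i M x * (m x - M x) + f1 (M x) * (pd i m x - pd i M x))"
      using d7 by simp
    \<comment> \<open>Regrouping turns the derivative into a Taylor remainder of f' times the
      derivative of \<open>m\<close>, plus f'' times a product of two errors; each summand then
      carries a factor \<open>e\<close>.\<close>
    also have "\<dots> = (f1 (m x) - f1 (M x) - f2 (M x) * (m x - M x)) * pd i m x + f2 (M x) * ((m x - M x) * (pd i m x - pd i M x))"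
      by (simp add: algebra_simps)
    finally have eq: "pd i (\<lambda>x. f (m x) - f (M x) - f1 (M x) * (m x - M x)) x =
      (f1 (m x) - f1 (M x) - f2 (M x) * (m x - M x)) * pd i m x + f2 (M x) * ((m x - M x) * (pd i m x - pd i M x))" .
    have "\<bar>f1 (m x) - f1 (M x) - f2 (M x) * (m x - M x)\<bar> \<le> \<eta> * \<bar>m x - M x\<bar>"
    proof (rule taylor1_bound[OF f_deriv(2)])
      fix r assume r: "r \<in> closed_segment (M x) (m x)"
      have "\<bar>r - M x\<bar> \<le> e" using seg(2)[OF r] h[of x] by linarith
      then show "\<bar>f2 r - f2 (M x)\<bar> \<le> \<eta>"
        by (rule mod[unfolded modulus_def, rule_format, OF seg(1)[OF r] mM(4)])
    qed
    also have "\<dots> \<le> \<eta> * e" by (rule mult_left_mono[OF h eta0])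
    finally have 1: "\<bar>f1 (m x) - f1 (M x) - f2 (M x) * (m x - M x)\<bar> \<le> \<eta> * e" .
    have "\<bar>pd i m x - pd i M x\<bar> \<le> e" using mM(6)[of i x] by (simp add: abs_minus_commute)
    then have 2: "\<bar>m x - M x\<bar> * \<bar>pd i m x - pd i M x\<bar> \<le> e * e" by (rule mult_mono[OF h]) (use e0 in auto)
    have "\<bar>f1 (m x) - f1 (M x) - f2 (M x) * (m x - M x)\<bar> * \<bar>pd i m x\<bar> \<le> \<eta> * e * B"
      by (rule mult_mono[OF 1 mM(5)]) (use eta0 e0 in auto)
    moreover have "\<bar>f2 (M x)\<bar> * (\<bar>m x - M x\<bar> * \<bar>pd i m x - pd i M x\<bar>) \<le> F2 * (e * e)"
      by (rule mult_mono[OF F2(2)[OF mM(4)] 2]) (use F2(1) in auto)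
    moreover have "(\<eta> * B + F2 * e) * e = \<eta> * e * B + F2 * (e * e)" by (simp add: algebra_simps)
    ultimately show ?thesis
      unfolding eq using abs_triangle_ineq[of "(f1 (m x) - f1 (M x) - f2 (M x) * (m x - M x)) * pd i m x" "f2 (M x) * ((m x - M x) * (pd i m x - pd i M x))"]
      unfolding abs_mult by linarith
  qed
qed

end

text \<open>The linearization depends on its base point only through terms linear in
  \<open>U - u\<close>, \<open>M - m\<close> and f'(M) - f'(m), each paired with \<open>w\<close> or
  \<open>\<mu>\<close>. The constant is chosen generously to cover both components.\<close>

lemma linearization_perturbation:
  fixes w \<mu> U M :: "real^'d \<Rightarrow> real"
  assumes U: "torus_C2 U" "c2abd \<alpha> (\<lambda>x. U x - u x) e" and M: "torus_C2 M" "c2abd \<alpha> (\<lambda>x. M x - m x) e"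
    and th: "hbd \<alpha> (\<lambda>x. f1 (M x) - f1 (m x)) \<theta>" and w: "c2abd \<alpha> w A" and \<mu>: "c2abd \<alpha> \<mu> A"
  defines "\<kappa> \<equiv> 8 * real CARD('d) * (real CARD('d) + 2)\<^sup>2 + 2 * (real CARD('d) + 2)"
  shows "hbd \<alpha> (\<lambda>x. lin1 lam (\<lambda>x. f1 (M x)) U w \<mu> x - lin1 lam (\<lambda>x. f1 (m x)) u w \<mu> x) (\<kappa> * (e + \<theta>) * A)"
    and "hbd \<alpha> (\<lambda>x. lin2 lam U M w \<mu> x - lin2 lam u m w \<mu> x) (\<kappa> * (e + \<theta>) * A)"
proof -
  define d where "d = real CARD('d)"
  define c where "c = d + 2"
  have nn: "e \<ge> 0" "\<theta> \<ge> 0" "A \<ge> 0" "d \<ge> 0" "c \<ge> 0"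
    using c2bd_nonneg[OF c2abd_c2bd[OF U(2)]] hbd_nonneg[OF th] c2bd_nonneg[OF c2abd_c2bd[OF w]] by (auto simp: d_def c_def)
  have k: "\<kappa> = 8 * d * c\<^sup>2 + 2 * c" by (simp add: \<kappa>_def d_def c_def)
  have t: "torus_C2 w" "torus_C2 \<mu>" using w \<mu> by (auto simp: c2abd_def c2bd_def)
  note cs = torus_C2_C1(1)[OF U(1)] torus_C2_C1(1)[OF M(1)] torus_C2_C1(1)[OF tu] torus_C2_C1(1)[OF tm] torus_C2_C1(1)[OF t(2)]
  note hU = c2bd_hbd[OF c2abd_c2bd[OF U(2)] \<alpha>, folded d_def, folded c_def]
  note hw = c2bd_hbd[OF c2abd_c2bd[OF w] \<alpha>, folded d_def, folded c_def]
  note h\<mu> = c2bd_hbd[OF c2abd_c2bd[OF \<mu>] \<alpha>, folded d_def, folded c_def]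
  have 1: "(\<lambda>x. lin1 lam (\<lambda>x. f1 (M x)) U w \<mu> x - lin1 lam (\<lambda>x. f1 (m x)) u w \<mu> x) =
      (\<lambda>x. grad_dot (\<lambda>x. U x - u x) w x - (f1 (M x) - f1 (m x)) * \<mu> x)"
    unfolding lin1_def grad_dot_diff(2)[OF cs(1,3)] by (auto simp: algebra_simps)
  have "hbd \<alpha> (grad_dot (\<lambda>x. U x - u x) w) (d * (2 * (c * e) * (c * A)))"
    unfolding d_def by (rule hbd_grad_dot[OF hU(2) hw(2)])
  from hbd_diff[OF this hbd_mult[OF th h\<mu>(1)]]
  have "hbd \<alpha> (\<lambda>x. grad_dot (\<lambda>x. U x - u x) w x - (f1 (M x) - f1 (m x)) * \<mu> x) (d * (2 * (c * e) * (c * A)) + 2 * \<theta> * (c * A))" .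
  moreover have "d * (2 * (c * e) * (c * A)) + 2 * \<theta> * (c * A) \<le> \<kappa> * (e + \<theta>) * A"
  proof -
    have "\<kappa> * (e + \<theta>) * A - (d * (2 * (c * e) * (c * A)) + 2 * \<theta> * (c * A)) = 6 * d * c\<^sup>2 * e * A + 8 * d * c\<^sup>2 * \<theta> * A + 2 * c * e * A"
      by (simp add: k power2_eq_square algebra_simps)
    also have "\<dots> \<ge> 0" using nn by simp
    finally show ?thesis by simp
  qed
  ultimately show "hbd \<alpha> (\<lambda>x. lin1 lam (\<lambda>x. f1 (M x)) U w \<mu> x - lin1 lam (\<lambda>x. f1 (m x)) u w \<mu> x) (\<kappa> * (e + \<theta>) * A)"
    unfolding 1 using hbd_mono by blast
  have 2: "(\<lambda>x. lin2 lam U M w \<mu> x - lin2 lam u m w \<mu> x) = (\<lambda>x. - divg \<mu> (\<lambda>x. U x - u x) x - divg (\<lambda>x. M x - m x) w x)"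
    unfolding lin2_def divg_diff_right[OF cs(5) U(1) tu] divg_diff_left[OF cs(2,4) t(1)] by auto
  have "hbd \<alpha> (\<lambda>x. - divg \<mu> (\<lambda>x. U x - u x) x - divg (\<lambda>x. M x - m x) w x) (4 * d * c\<^sup>2 * A * e + 4 * d * c\<^sup>2 * e * A)"
    unfolding d_def c_def by (rule hbd_diff[OF hbd_uminus[OF hbd_divg[OF c2abd_c2bd[OF \<mu>] U(2) \<alpha>]] hbd_divg[OF c2abd_c2bd[OF M(2)] w \<alpha>]])
  moreover have "4 * d * c\<^sup>2 * A * e + 4 * d * c\<^sup>2 * e * A \<le> \<kappa> * (e + \<theta>) * A"
  proof -
    have "\<kappa> * (e + \<theta>) * A - (4 * d * c\<^sup>2 * A * e + 4 * d * c\<^sup>2 * e * A) = 8 * d * c\<^sup>2 * \<theta> * A + 2 * c * (e + \<theta>) * A"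
      by (simp add: k power2_eq_square algebra_simps)
    also have "\<dots> \<ge> 0" using nn by simp
    finally show ?thesis by simp
  qed
  ultimately show "hbd \<alpha> (\<lambda>x. lin2 lam U M w \<mu> x - lin2 lam u m w \<mu> x) (\<kappa> * (e + \<theta>) * A)"
    unfolding 2 using hbd_mono by blast
qed

text \<open>Every term has a factor \<open>e\<close> besides a small one: products of errors give
  \<open>e * e\<close>, and the Taylor remainder adds \<open>\<eta> * e\<close>.\<close>

lemma remainder_hbd:
  fixes U M :: "real^'d \<Rightarrow> real"
  assumes U: "torus_C2 U" "c2abd \<alpha> (\<lambda>x. U x - u x) e" and M: "torus_C2 M" "c2abd \<alpha> (\<lambda>x. M x - m x) e"
    and e: "e \<le> 1" and mod: "modulus e \<eta>"
  defines "\<kappa> \<equiv> (real CARD('d) + 2) * (B + F2) + 4 * real CARD('d) * (real CARD('d) + 2)\<^sup>2"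
  shows "hbd \<alpha> (rho1 U M) (\<kappa> * (\<eta> + e) * e)" "hbd \<alpha> (rho2 U M) (\<kappa> * (\<eta> + e) * e)"
proof -
  define d where "d = real CARD('d)"
  define c where "c = d + 2"
  have eta: "\<eta> \<ge> 0" by (rule eta0[OF M(1) c2abd_c2bd[OF M(2)] e mod])
  have nn: "e \<ge> 0" "d \<ge> 0" "c \<ge> 0" "B \<ge> 0" "F2 \<ge> 0"
    using c2bd_nonneg[OF c2abd_c2bd[OF U(2)]] B_bounds(3) F2(1) by (auto simp: d_def c_def)
  have k: "\<kappa> = c * (B + F2) + 4 * d * c\<^sup>2" by (simp add: \<kappa>_def d_def c_def)
  note hU = c2bd_hbd[OF c2abd_c2bd[OF U(2)] \<alpha>, folded d_def, folded c_def]
  have "hbd \<alpha> (grad_dot (\<lambda>x. U x - u x) (\<lambda>x. U x - u x)) (d * (2 * (c * e) * (c * e)))"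
    unfolding d_def by (rule hbd_grad_dot[OF hU(2) hU(2)])
  from hbd_diff[OF hbd_cmult[OF this, of "1/2"] taylor_remainder_hbd[OF M(1) c2abd_c2bd[OF M(2)] e mod, folded d_def, folded c_def]]
  have "hbd \<alpha> (rho1 U M) (\<bar>1/2\<bar> * (d * (2 * (c * e) * (c * e))) + c * ((\<eta> * B + F2 * e) * e))"
    unfolding rho1_def[abs_def] .
  moreover have "\<bar>1/2\<bar> * (d * (2 * (c * e) * (c * e))) + c * ((\<eta> * B + F2 * e) * e) \<le> \<kappa> * (\<eta> + e) * e"
  proof -
    have "\<kappa> * (\<eta> + e) * e - (\<bar>1/2\<bar> * (d * (2 * (c * e) * (c * e))) + c * ((\<eta> * B + F2 * e) * e)) =
       3 * d * c\<^sup>2 * e * e + 4 * d * c\<^sup>2 * \<eta> * e + c * F2 * \<eta> * e + c * B * e * e"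
      by (simp add: k power2_eq_square algebra_simps)
    also have "\<dots> \<ge> 0" using nn eta by simp
    finally show ?thesis by simp
  qed
  ultimately show "hbd \<alpha> (rho1 U M) (\<kappa> * (\<eta> + e) * e)" using hbd_mono by blast
  have "hbd \<alpha> (rho2 U M) (4 * d * c\<^sup>2 * e * e)"
    unfolding rho2_def[abs_def] d_def c_def by (rule hbd_uminus[OF hbd_divg[OF c2abd_c2bd[OF M(2)] U(2) \<alpha>]])
  moreover have "4 * d * c\<^sup>2 * e * e \<le> \<kappa> * (\<eta> + e) * e"
  proof -
    have "\<kappa> * (\<eta> + e) * e - 4 * d * c\<^sup>2 * e * e = 4 * d * c\<^sup>2 * \<eta> * e + c * (B + F2) * (\<eta> + e) * e"
      by (simp add: k power2_eq_square algebra_simps)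
    also have "\<dots> \<ge> 0" using nn eta by simp
    finally show ?thesis by simp
  qed
  ultimately show "hbd \<alpha> (rho2 U M) (\<kappa> * (\<eta> + e) * e)" using hbd_mono by blast
qed

end

text \<open>The rate is the quotient of consecutive errors, set to 0 once the error is 0; this is
  admissible because \<open>half\<close> then forces the next error to be 0 as well. Halving yields
  convergence, and \<open>small\<close> turns convergence into decay of the quotient.\<close>

lemma superlinear_convI:
  fixes e :: "nat \<Rightarrow> real"
  assumes nn: "\<And>k. e k \<ge> 0" and half: "\<And>k. e (Suc k) \<le> 1/2 * e k"
    and small: "\<And>\<epsilon>. \<epsilon> > 0 \<Longrightarrow> \<exists>\<delta>>0. \<forall>k. e k < \<delta> \<longrightarrow> e (Suc k) \<le> \<epsilon> * e k"
  shows "superlinear_conv e"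
proof -
  have "e k \<le> (1/2) ^ k * e 0" for k
  proof (induction k)
    case (Suc k)
    then show ?case using half[of k] by simp
  qed simp
  moreover have "(\<lambda>k. (1/2) ^ k * e 0) \<longlonglongrightarrow> 0 * e 0" by (intro tendsto_intros LIMSEQ_power_zero) auto
  ultimately have e0: "e \<longlonglongrightarrow> 0"
    using nn by (intro tendsto_sandwich[OF _ _ tendsto_const, of 0 e sequentially "\<lambda>k. (1/2) ^ k * e 0"]) auto
  define q where "q k = (if e k = 0 then 0 else e (Suc k) / e k)" for k
  have le: "e (Suc k) \<le> q k * e k" for k using half[of k] nn[of "Suc k"] by (auto simp: q_def)
  have "q \<longlonglongrightarrow> 0"
  proof (rule LIMSEQ_I)
    fix r :: real assume r: "r > 0"
    then obtain \<delta> where d: "\<delta> > 0" "\<And>k. e k < \<delta> \<Longrightarrow> e (Suc k) \<le> r / 2 * e k" using small[of "r / 2"] by auto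
    obtain K where K: "\<And>k. k \<ge> K \<Longrightarrow> norm (e k - 0) < \<delta>" using LIMSEQ_D[OF e0 d(1)] by blast
    have "norm (q k - 0) < r" if "k \<ge> K" for k
    proof (cases "e k = 0")
      case False
      then have pos: "e k > 0" using nn[of k] by simp
      have "e (Suc k) \<le> r / 2 * e k" using d(2)[of k] K[OF that] nn[of k] by simp
      then have "e (Suc k) / e k \<le> r / 2" using pos by (simp add: pos_divide_le_eq)
      moreover have "e (Suc k) / e k \<ge> 0" using nn[of "Suc k"] pos by simp
      ultimately have "0 \<le> q k" "q k \<le> r / 2" using False by (auto simp only: q_def if_False)
      then show ?thesis using r by simp
    qed (use r in \<open>simp add: q_def\<close>)
    then show "\<exists>K. \<forall>k\<ge>K. norm (q k - 0) < r" by blast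
  qed
  then show ?thesis using e0 le unfolding superlinear_conv_def by blast
qed

context mfg_newton
begin

text \<open>Within the radius \<open>\<delta>\<close> the deviation from the linearization at
  \<open>(u, m)\<close>, measured after inverting the latter, has norm at most 1/2. In the a priori
  estimate this half is absorbed, which doubles the constant; in the existence proof it is the
  contraction factor.\<close>

lemma linearization_invertible_near:
  obtains C \<delta> where "C > 0" "\<delta> > 0"
    "\<And>U M \<xi> \<zeta>. (U, M) \<in> XS \<alpha> \<Longrightarrow> XN \<alpha> ((U, M) - (u, m)) < \<delta> \<Longrightarrow> C0a \<alpha> \<xi> \<Longrightarrow> C0a \<alpha> \<zeta> \<Longrightarrow>
      \<exists>w \<mu>. C2a \<alpha> w \<and> C2a \<alpha> \<mu> \<and> (\<forall>x. lin1 lam (\<lambda>x. f1 (M x)) U w \<mu> x = \<xi> x) \<and> (\<forall>x. lin2 lam U M w \<mu> x = \<zeta> x)"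
    "\<And>U M w \<mu> A. (U, M) \<in> XS \<alpha> \<Longrightarrow> XN \<alpha> ((U, M) - (u, m)) < \<delta> \<Longrightarrow> C2a \<alpha> w \<Longrightarrow> C2a \<alpha> \<mu> \<Longrightarrow>
      hbd \<alpha> (lin1 lam (\<lambda>x. f1 (M x)) U w \<mu>) A \<Longrightarrow> hbd \<alpha> (lin2 lam U M w \<mu>) A \<Longrightarrow> XN \<alpha> (w, \<mu>) \<le> C * A"
proof -
  have "periodic (\<lambda>x. f1 (m x))" using torus_C2_periodic[OF tm] by (simp add: periodic_def)
  then obtain Aa where Aa: "hbd \<alpha> (\<lambda>x. f1 (m x)) Aa"
    using C1_periodic_hbd[OF _ _ \<alpha>] C1_compose[OF torus_C2_C1(1)[OF tm] f_deriv(2,3)] by blast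
  interpret L: linear_mfg lam \<alpha> "max B Aa" u m "\<lambda>x. f1 (m x)"
  proof
    show "c2abd \<alpha> u (max B Aa)" "c2abd \<alpha> m (max B Aa)" "hbd \<alpha> (\<lambda>x. f1 (m x)) (max B Aa)"
      using B_bounds Aa c2abd_mono hbd_mono by (meson max.cobounded1 max.cobounded2)+
    fix w \<mu> :: "real^'d \<Rightarrow> real"
    assume t: "torus_C2 w" "torus_C2 \<mu>" and l: "\<And>x. lin1 lam (\<lambda>x. f1 (m x)) u w \<mu> x = 0" "\<And>x. lin2 lam u m w \<mu> x = 0"
    have "\<forall>x. - lap w x + grad_dot u w x + lam * w x = f1 (m x) * \<mu> x" using l(1) by (simp add: lin1_def algebra_simps)
    moreover have "- lap \<mu> x - divg \<mu> u x + lam * \<mu> x = divg m w x" for x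
      using l(2)[of x] unfolding lin2_def by linarith
    ultimately show "w = (\<lambda>x. 0) \<and> \<mu> = (\<lambda>x. 0)" using stable t unfolding stable_sol_def by blast
  qed (use lam \<alpha> in auto)
  obtain C0 where C0: "C0 > 0"
    "\<And>\<xi> \<zeta>. C0a \<alpha> \<xi> \<Longrightarrow> C0a \<alpha> \<zeta> \<Longrightarrow> \<exists>w \<mu>. C2a \<alpha> w \<and> C2a \<alpha> \<mu> \<and> (\<forall>x. lin1 lam (\<lambda>x. f1 (m x)) u w \<mu> x = \<xi> x) \<and> (\<forall>x. lin2 lam u m w \<mu> x = \<zeta> x)"
    "\<And>w \<mu> A. C2a \<alpha> w \<Longrightarrow> C2a \<alpha> \<mu> \<Longrightarrow> hbd \<alpha> (lin1 lam (\<lambda>x. f1 (m x)) u w \<mu>) A \<Longrightarrow> hbd \<alpha> (lin2 lam u m w \<mu>) A \<Longrightarrow> XN \<alpha> (w, \<mu>) \<le> C0 * A"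
    by (rule L.invertible) blast
  define c where "c = real CARD('d) + 2"
  define \<kappa> where "\<kappa> = 8 * real CARD('d) * c\<^sup>2 + 2 * c"
  have c: "c > 0" by (simp add: c_def)
  have \<kappa>: "\<kappa> > 0" using c by (simp add: \<kappa>_def add_nonneg_pos)
  \<comment> \<open>With \<open>e \<le> s\<close> and \<open>\<theta> \<le> s\<close> the
    perturbation satisfies \<open>\<kappa> * (e + \<theta>) \<le> 2 * \<kappa> * s = 1 / (2 *
    C0)\<close>. The choices of \<open>\<eta>\<close> and \<open>\<delta>\<close> let the two parts
    of \<open>\<theta>\<close> contribute at most \<open>s / 2\<close> each.\<close>
  define s where "s = 1 / (4 * \<kappa> * C0)"
  have s: "s > 0" using \<kappa> C0 by (simp add: s_def)
  define \<eta> where "\<eta> = s / (2 * c * (B + 1))"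
  have \<eta>: "\<eta> > 0" using s c B_bounds(3) by (simp add: \<eta>_def)
  obtain \<delta>0 where \<delta>0: "\<delta>0 > 0" "\<And>e. e \<le> \<delta>0 \<Longrightarrow> modulus e \<eta>" using modulus_exists[OF \<eta>] by blast
  define \<delta> where "\<delta> = min (min 1 s) (min \<delta>0 (s / (2 * c * F2)))"
  have \<delta>: "\<delta> > 0" using s \<delta>0 c F2(1) by (simp add: \<delta>_def)
  define D1 where "D1 U M q x = lin1 lam (\<lambda>x. f1 (M x)) U (fst q) (snd q) x - lin1 lam (\<lambda>x. f1 (m x)) u (fst q) (snd q) x" for U M q x
  define D2 where "D2 U M q x = lin2 lam U M (fst q) (snd q) x - lin2 lam u m (fst q) (snd q) x" for U M q x
  have tX: "torus_C2 (fst q)" "torus_C2 (snd q)" if "q \<in> XS \<alpha>" for q :: "(real^'d \<Rightarrow> real) \<times> (real^'d \<Rightarrow> real)"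
    using that C2aD(1) by (auto simp: XS_def)
  interpret X: complete_norm_on "XS \<alpha> :: ((real^'d \<Rightarrow> real) \<times> (real^'d \<Rightarrow> real)) set" "XN \<alpha>" by (rule XS_complete_norm)
  have umX: "(u, m) \<in> XS \<alpha>" using u m by (simp add: XS_def)
  have Dh: "hbd \<alpha> (D1 U M q) (XN \<alpha> q / (2 * C0))" "hbd \<alpha> (D2 U M q) (XN \<alpha> q / (2 * C0))"
    if p: "(U, M) \<in> XS \<alpha>" and pd: "XN \<alpha> ((U, M) - (u, m)) < \<delta>" and q: "q \<in> XS \<alpha>" for U M q
  proof -
    define e where "e = XN \<alpha> ((U, M) - (u, m))"
    have e: "e \<le> 1" "e \<le> s" "e \<le> \<delta>0" "e \<le> s / (2 * c * F2)" using pd by (auto simp: e_def \<delta>_def)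
    have ce: "c2abd \<alpha> (\<lambda>x. U x - u x) e" "c2abd \<alpha> (\<lambda>x. M x - m x) e"
      using XS_bounds[OF X.V_intros(3)[OF p umX]] by (auto simp: e_def fun_diff_def)
    have tp: "torus_C2 U" "torus_C2 M" using tX[OF p] by auto
    define \<theta> where "\<theta> = c * (\<eta> * (B + 1) + F2 * e)"
    have th: "hbd \<alpha> (\<lambda>x. f1 (M x) - f1 (m x)) \<theta>"
      unfolding \<theta>_def c_def by (rule f1_difference_hbd[OF tp(2) c2abd_c2bd[OF ce(2)] e(1) \<delta>0(2)[OF e(3)]])
    have "\<theta> \<le> s"
    proof -
      have "B + 1 > 0" using B_bounds(3) by simp
      then have "c * (\<eta> * (B + 1)) = s / 2" using c by (simp add: \<eta>_def)
      moreover have "c * (F2 * e) \<le> s / 2"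
      proof -
        have "c * (F2 * e) \<le> c * (F2 * (s / (2 * c * F2)))" using e(4) c F2(1) by (intro mult_left_mono) auto
        also have "\<dots> = s / 2" using c F2(1) by simp
        finally show ?thesis .
      qed
      ultimately show ?thesis unfolding \<theta>_def distrib_left by linarith
    qed
    have qn: "XN \<alpha> q \<ge> 0" by (rule X.N_nonneg[OF q])
    have "\<kappa> * (e + \<theta>) \<le> \<kappa> * (2 * s)" using \<open>\<theta> \<le> s\<close> e(2) \<kappa> by (intro mult_left_mono) auto
    also have "\<dots> = 1 / (2 * C0)" using \<kappa> C0 by (simp add: s_def)
    finally have le: "\<kappa> * (e + \<theta>) * XN \<alpha> q \<le> XN \<alpha> q / (2 * C0)" using mult_right_mono[OF _ qn] by fastforce
    note P = linearization_perturbation[OF tp(1) ce(1) tp(2) ce(2) th XS_bounds[OF q], folded c_def, folded \<kappa>_def]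
    show "hbd \<alpha> (D1 U M q) (XN \<alpha> q / (2 * C0))" "hbd \<alpha> (D2 U M q) (XN \<alpha> q / (2 * C0))"
      unfolding D1_def[abs_def] D2_def[abs_def] using hbd_mono[OF P(1) le] hbd_mono[OF P(2) le] by auto
  qed
  show ?thesis
  proof (rule that[of "2 * C0" \<delta>])
    show "0 < 2 * C0" "0 < \<delta>" using C0 \<delta> by auto
  next
    fix U M w \<mu> :: "real^'d \<Rightarrow> real" and A
    assume p: "(U, M) \<in> XS \<alpha>" and pd: "XN \<alpha> ((U, M) - (u, m)) < \<delta>" and C: "C2a \<alpha> w" "C2a \<alpha> \<mu>"
      and h: "hbd \<alpha> (lin1 lam (\<lambda>x. f1 (M x)) U w \<mu>) A" "hbd \<alpha> (lin2 lam U M w \<mu>) A"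
    have q: "(w, \<mu>) \<in> XS \<alpha>" using C by (simp add: XS_def)
    define A' where "A' = A + XN \<alpha> (w, \<mu>) / (2 * C0)"
    have "hbd \<alpha> (lin1 lam (\<lambda>x. f1 (m x)) u w \<mu>) A'" "hbd \<alpha> (lin2 lam u m w \<mu>) A'"
      using hbd_diff[OF h(1) Dh(1)[OF p pd q]] hbd_diff[OF h(2) Dh(2)[OF p pd q]] by (auto simp: D1_def D2_def A'_def)
    then have "XN \<alpha> (w, \<mu>) \<le> C0 * A'" using C0(3)[OF C] by blast
    also have "\<dots> = C0 * A + XN \<alpha> (w, \<mu>) / 2" using C0(1) by (simp add: A'_def distrib_left)
    finally show "XN \<alpha> (w, \<mu>) \<le> 2 * C0 * A" by simp
  next
    fix U M \<xi> \<zeta> :: "real^'d \<Rightarrow> real"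
    assume p: "(U, M) \<in> XS \<alpha>" and pd: "XN \<alpha> ((U, M) - (u, m)) < \<delta>" and C: "C0a \<alpha> \<xi>" "C0a \<alpha> \<zeta>"
    \<comment> \<open>\<open>Q q r\<close> says that \<open>r\<close> solves the system at
      \<open>(u, m)\<close> with the deviation, evaluated at \<open>q\<close>, moved to the
      right-hand side. A fixed point therefore solves the system at \<open>(U, M)\<close>.\<close>
    define Q where "Q q r \<longleftrightarrow> r \<in> XS \<alpha> \<and> (\<forall>x. lin1 lam (\<lambda>x. f1 (m x)) u (fst r) (snd r) x = \<xi> x - D1 U M q x) \<and>
        (\<forall>x. lin2 lam u m (fst r) (snd r) x = \<zeta> x - D2 U M q x)" for q r
    define G where "G q = (SOME r. Q q r)" for q
    have GQ: "Q q (G q)" if q: "q \<in> XS \<alpha>" for q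
    proof -
      have "C0a \<alpha> (\<lambda>x. \<xi> x - D1 U M q x)" "C0a \<alpha> (\<lambda>x. \<zeta> x - D2 U M q x)"
        using Dh[OF p pd q] C C0a_iff_hbd[OF \<alpha>(1)] by (auto intro!: C0a_diff \<alpha>(1))
      from C0(2)[OF this] obtain w \<mu> where "Q q (w, \<mu>)" unfolding Q_def XS_def by auto
      then show ?thesis unfolding G_def by (rule someI)
    qed
    have "\<exists>q\<in>XS \<alpha>. G q = q"
    proof (rule X.contraction_fixpoint[of G "1/2"])
      show "G q \<in> XS \<alpha>" if "q \<in> XS \<alpha>" for q using GQ[OF that] by (simp add: Q_def)
      fix q q' :: "(real^'d \<Rightarrow> real) \<times> (real^'d \<Rightarrow> real)" assume q: "q \<in> XS \<alpha>" "q' \<in> XS \<alpha>"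
      define r where "r = G q"
      define r' where "r' = G q'"
      have r: "Q q r" "Q q' r'" using GQ q by (auto simp: r_def r'_def)
      then have rX: "r \<in> XS \<alpha>" "r' \<in> XS \<alpha>" by (auto simp: Q_def)
      have dX: "q - q' \<in> XS \<alpha>" "r - r' \<in> XS \<alpha>" using X.V_intros q rX by auto
      have fs: "fst (a - b) = (\<lambda>x. 1 * fst a x + (-1) * fst b x)" "snd (a - b) = (\<lambda>x. 1 * snd a x + (-1) * snd b x)"
        for a b :: "(real^'d \<Rightarrow> real) \<times> (real^'d \<Rightarrow> real)" by (auto simp: fun_diff_def)
      have tp: "torus_C2 U" "C1_fun M" using tX[OF p] torus_C2_C1(1) by auto
      have Dd: "D1 U M (q - q') x = D1 U M q x - D1 U M q' x" "D2 U M (q - q') x = D2 U M q x - D2 U M q' x" for x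
        unfolding D1_def D2_def fs lin1_lincomb[OF tX(1)[OF q(1)] tX(1)[OF q(2)]]
          lin2_lincomb[OF tX(1)[OF q(1)] tX(1)[OF q(2)] tX(2)[OF q(1)] tX(2)[OF q(2)] tp]
          lin2_lincomb[OF tX(1)[OF q(1)] tX(1)[OF q(2)] tX(2)[OF q(1)] tX(2)[OF q(2)] tu torus_C2_C1(1)[OF tm]] by auto
      have "lin1 lam (\<lambda>x. f1 (m x)) u (fst (r - r')) (snd (r - r')) = (\<lambda>x. - D1 U M (q - q') x)"
        unfolding Dd fs lin1_lincomb[OF tX(1)[OF rX(1)] tX(1)[OF rX(2)]] using r unfolding Q_def by auto
      moreover have "lin2 lam u m (fst (r - r')) (snd (r - r')) = (\<lambda>x. - D2 U M (q - q') x)"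
        unfolding Dd fs lin2_lincomb[OF tX(1)[OF rX(1)] tX(1)[OF rX(2)] tX(2)[OF rX(1)] tX(2)[OF rX(2)] tu torus_C2_C1(1)[OF tm]]
        using r unfolding Q_def by auto
      ultimately have "XN \<alpha> (fst (r - r'), snd (r - r')) \<le> C0 * (XN \<alpha> (q - q') / (2 * C0))"
        using dX(2) hbd_uminus[OF Dh(1)[OF p pd dX(1)]] hbd_uminus[OF Dh(2)[OF p pd dX(1)]]
        by (intro C0(3)) (auto simp: XS_def)
      then have "XN \<alpha> (r - r') \<le> C0 * (XN \<alpha> (q - q') / (2 * C0))" by (simp only: prod.collapse)
      then show "XN \<alpha> (G q - G q') \<le> 1/2 * XN \<alpha> (q - q')" using C0(1) by (simp add: r_def r'_def)
    qed auto
    then obtain q where q: "q \<in> XS \<alpha>" "Q q q" using GQ by metis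
    then have "C2a \<alpha> (fst q) \<and> C2a \<alpha> (snd q) \<and> (\<forall>x. lin1 lam (\<lambda>x. f1 (M x)) U (fst q) (snd q) x = \<xi> x) \<and> (\<forall>x. lin2 lam U M (fst q) (snd q) x = \<zeta> x)"
      unfolding Q_def D1_def D2_def XS_def by auto
    then show "\<exists>w \<mu>. C2a \<alpha> w \<and> C2a \<alpha> \<mu> \<and> (\<forall>x. lin1 lam (\<lambda>x. f1 (M x)) U w \<mu> x = \<xi> x) \<and> (\<forall>x. lin2 lam U M w \<mu> x = \<zeta> x)" by blast
  qed
qed

text \<open>Existence and estimate are kept apart: the estimate holds for every pair in the space
  that satisfies the Newton relation, as the final claim concerns all Newton sequences. The bound
  \<open>\<eta>\<close> stays free and can be chosen anew in each step.\<close>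

lemma newton_step:
  obtains \<Gamma> \<delta> where "\<Gamma> > 0" "\<delta> > 0"
    "\<And>U M. (U, M) \<in> XS \<alpha> \<Longrightarrow> XN \<alpha> ((U, M) - (u, m)) < \<delta> \<Longrightarrow> \<exists>U' M'. (U', M') \<in> XS \<alpha> \<and> newton_rel lam m0 f (U, M) (U', M')"
    "\<And>U M U' M' \<eta>. (U, M) \<in> XS \<alpha> \<Longrightarrow> XN \<alpha> ((U, M) - (u, m)) < \<delta> \<Longrightarrow> (U', M') \<in> XS \<alpha> \<Longrightarrow> newton_rel lam m0 f (U, M) (U', M') \<Longrightarrow>
      modulus (XN \<alpha> ((U, M) - (u, m))) \<eta> \<Longrightarrow>
      XN \<alpha> ((U', M') - (u, m)) \<le> \<Gamma> * (\<eta> + XN \<alpha> ((U, M) - (u, m))) * XN \<alpha> ((U, M) - (u, m))"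
proof -
  obtain C \<delta> where C: "C > 0" "\<delta> > 0" and
    ex: "\<And>U M \<xi> \<zeta>. (U, M) \<in> XS \<alpha> \<Longrightarrow> XN \<alpha> ((U, M) - (u, m)) < \<delta> \<Longrightarrow> C0a \<alpha> \<xi> \<Longrightarrow> C0a \<alpha> \<zeta> \<Longrightarrow>
      \<exists>w \<mu>. C2a \<alpha> w \<and> C2a \<alpha> \<mu> \<and> (\<forall>x. lin1 lam (\<lambda>x. f1 (M x)) U w \<mu> x = \<xi> x) \<and> (\<forall>x. lin2 lam U M w \<mu> x = \<zeta> x)" and
    bd: "\<And>U M w \<mu> A. (U, M) \<in> XS \<alpha> \<Longrightarrow> XN \<alpha> ((U, M) - (u, m)) < \<delta> \<Longrightarrow> C2a \<alpha> w \<Longrightarrow> C2a \<alpha> \<mu> \<Longrightarrow>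
      hbd \<alpha> (lin1 lam (\<lambda>x. f1 (M x)) U w \<mu>) A \<Longrightarrow> hbd \<alpha> (lin2 lam U M w \<mu>) A \<Longrightarrow> XN \<alpha> (w, \<mu>) \<le> C * A"
    by (rule linearization_invertible_near) blast
  \<comment> \<open>The oscillation bound 1 serves only to see that the remainders are Hoelder
    continuous, as solvability of the step requires.\<close>
  obtain \<delta>1 where \<delta>1: "\<delta>1 > 0" "\<And>e. e \<le> \<delta>1 \<Longrightarrow> modulus e 1" using modulus_exists[of 1] by auto
  define \<kappa> where "\<kappa> = (real CARD('d) + 2) * (B + F2) + 4 * real CARD('d) * (real CARD('d) + 2)\<^sup>2"
  have \<kappa>: "\<kappa> > 0" using B_bounds(3) F2(1) by (simp add: \<kappa>_def add_pos_nonneg)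
  interpret X: complete_norm_on "XS \<alpha> :: ((real^'d \<Rightarrow> real) \<times> (real^'d \<Rightarrow> real)) set" "XN \<alpha>" by (rule XS_complete_norm)
  have umX: "(u, m) \<in> XS \<alpha>" using u m by (simp add: XS_def)
  define \<delta>' where "\<delta>' = min (min \<delta> \<delta>1) 1"
  have rem: "hbd \<alpha> (rho1 U M) (\<kappa> * (\<eta> + e) * e)" "hbd \<alpha> (rho2 U M) (\<kappa> * (\<eta> + e) * e)"
    if p: "(U, M) \<in> XS \<alpha>" and e: "e = XN \<alpha> ((U, M) - (u, m))" "e < \<delta>'" "modulus e \<eta>" for U M e \<eta>
  proof -
    have ce: "c2abd \<alpha> (\<lambda>x. U x - u x) e" "c2abd \<alpha> (\<lambda>x. M x - m x) e"
      using XS_bounds[OF X.V_intros(3)[OF p umX]] by (auto simp: e(1) fun_diff_def)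
    have t: "torus_C2 U" "torus_C2 M" using p C2aD(1) by (auto simp: XS_def)
    have "e \<le> 1" using e by (simp add: \<delta>'_def)
    from remainder_hbd[OF t(1) ce(1) t(2) ce(2) this e(3), folded \<kappa>_def]
    show "hbd \<alpha> (rho1 U M) (\<kappa> * (\<eta> + e) * e)" "hbd \<alpha> (rho2 U M) (\<kappa> * (\<eta> + e) * e)" by auto
  qed
  show ?thesis
  proof (rule that[of "C * \<kappa>" \<delta>'])
    show "C * \<kappa> > 0" "\<delta>' > 0" using C \<kappa> \<delta>1 by (auto simp: \<delta>'_def)
  next
    fix U M assume p: "(U, M) \<in> XS \<alpha>" and pd: "XN \<alpha> ((U, M) - (u, m)) < \<delta>'"
    have "modulus (XN \<alpha> ((U, M) - (u, m))) 1" using \<delta>1(2) pd by (simp add: \<delta>'_def)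
    then have "C0a \<alpha> (rho1 U M)" "C0a \<alpha> (rho2 U M)" using rem[OF p refl pd] C0a_iff_hbd[OF \<alpha>(1)] by blast+
    then obtain w \<mu> where w: "C2a \<alpha> w" "C2a \<alpha> \<mu>" "\<And>x. lin1 lam (\<lambda>x. f1 (M x)) U w \<mu> x = rho1 U M x" "\<And>x. lin2 lam U M w \<mu> x = rho2 U M x"
      using ex[OF p, of "rho1 U M" "rho2 U M"] pd by (auto simp: \<delta>'_def)
    have C': "C2a \<alpha> (\<lambda>x. u x + w x)" "C2a \<alpha> (\<lambda>x. m x + \<mu> x)" using C2a_add u m w by auto
    have "newton_rel lam m0 f (U, M) (\<lambda>x. u x + w x, \<lambda>x. m x + \<mu> x)"
      using newton_rel_iff[OF _ _ C', of U M] p w(3,4) by (simp add: XS_def)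
    then show "\<exists>U' M'. (U', M') \<in> XS \<alpha> \<and> newton_rel lam m0 f (U, M) (U', M')" using C' unfolding XS_def by auto
  next
    fix U M U' M' \<eta> assume p: "(U, M) \<in> XS \<alpha>" and pd: "XN \<alpha> ((U, M) - (u, m)) < \<delta>'" and p': "(U', M') \<in> XS \<alpha>"
      and n: "newton_rel lam m0 f (U, M) (U', M')" and mod: "modulus (XN \<alpha> ((U, M) - (u, m))) \<eta>"
    have Cs: "C2a \<alpha> U" "C2a \<alpha> M" "C2a \<alpha> U'" "C2a \<alpha> M'" using p p' by (auto simp: XS_def)
    have l: "lin1 lam (\<lambda>x. f1 (M x)) U (\<lambda>x. U' x - u x) (\<lambda>x. M' x - m x) = rho1 U M"
      "lin2 lam U M (\<lambda>x. U' x - u x) (\<lambda>x. M' x - m x) = rho2 U M"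
      using n unfolding newton_rel_iff[OF Cs] by blast+
    have "XN \<alpha> ((\<lambda>x. U' x - u x), (\<lambda>x. M' x - m x)) \<le> C * (\<kappa> * (\<eta> + XN \<alpha> ((U, M) - (u, m))) * XN \<alpha> ((U, M) - (u, m)))"
      by (rule bd[OF p]) (use pd rem[OF p refl pd mod] l Cs C2a_diff u m in \<open>auto simp: \<delta>'_def\<close>)
    then show "XN \<alpha> ((U', M') - (u, m)) \<le> C * \<kappa> * (\<eta> + XN \<alpha> ((U, M) - (u, m))) * XN \<alpha> ((U, M) - (u, m))"
      by (simp add: fun_diff_def mult.assoc)
  qed
qed

end

theorem theorem5p9:
  fixes f :: "real \<Rightarrow> real" and lam \<alpha> :: real
    and m0 u m :: "real^'d::finite \<Rightarrow> real"
  assumes "lam > 0" and "0 < \<alpha>" and "\<alpha> < 1"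
    and "C0a \<alpha> m0" and "\<forall>x. m0 x \<ge> 0" and "integral (cbox 0 One) m0 = 1"
    and "C1b_C2 f" and "\<forall>x. deriv f x \<ge> 0"
    and "C2a \<alpha> u" and "C2a \<alpha> m"
    and "stable_sol lam m0 f u m"
  shows "\<exists>\<delta>>0. \<forall>ui mi. C2a \<alpha> ui \<and> C2a \<alpha> mi \<and> dist2a \<alpha> (ui, mi) (u, m) < \<delta> \<longrightarrow>
           (\<exists>U M. U 0 = ui \<and> M 0 = mi \<and> newton_seq \<alpha> lam m0 f U M) \<and>
           (\<forall>U M. U 0 = ui \<and> M 0 = mi \<and> newton_seq \<alpha> lam m0 f U M \<longrightarrow>
              superlinear_conv (\<lambda>k. dist2a \<alpha> (U k, M k) (u, m)) \<and>
              (C21loc f \<longrightarrow> quadratic_conv (\<lambda>k. dist2a \<alpha> (U k, M k) (u, m))))"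
proof -
  interpret mfg_newton lam \<alpha> f m0 u m by standard (use assms in auto)
  obtain \<Gamma> \<delta>0 where \<Gamma>: "\<Gamma> > 0" "\<delta>0 > 0" and
    ex: "\<And>U M. (U, M) \<in> XS \<alpha> \<Longrightarrow> XN \<alpha> ((U, M) - (u, m)) < \<delta>0 \<Longrightarrow> \<exists>U' M'. (U', M') \<in> XS \<alpha> \<and> newton_rel lam m0 f (U, M) (U', M')" and
    bd: "\<And>U M U' M' \<eta>. (U, M) \<in> XS \<alpha> \<Longrightarrow> XN \<alpha> ((U, M) - (u, m)) < \<delta>0 \<Longrightarrow> (U', M') \<in> XS \<alpha> \<Longrightarrow> newton_rel lam m0 f (U, M) (U', M') \<Longrightarrow>
      modulus (XN \<alpha> ((U, M) - (u, m))) \<eta> \<Longrightarrow>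
      XN \<alpha> ((U', M') - (u, m)) \<le> \<Gamma> * (\<eta> + XN \<alpha> ((U, M) - (u, m))) * XN \<alpha> ((U, M) - (u, m))"
    by (rule newton_step) blast
  interpret X: complete_norm_on "XS \<alpha> :: ((real^'d \<Rightarrow> real) \<times> (real^'d \<Rightarrow> real)) set" "XN \<alpha>" by (rule XS_complete_norm)
  have umX: "(u, m) \<in> XS \<alpha>" using assms by (simp add: XS_def)
  have dnn: "dist2a \<alpha> p (u, m) \<ge> 0" if "p \<in> XS \<alpha>" for p
    unfolding dist2a_XN by (rule X.N_nonneg[OF X.V_intros(3)[OF that umX]])
  have small: "\<exists>\<delta>>0. \<forall>U M U' M'. (U, M) \<in> XS \<alpha> \<longrightarrow> dist2a \<alpha> (U, M) (u, m) < \<delta> \<longrightarrow> (U', M') \<in> XS \<alpha> \<longrightarrow> newton_rel lam m0 f (U, M) (U', M') \<longrightarrow>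
      dist2a \<alpha> (U', M') (u, m) \<le> \<epsilon> * dist2a \<alpha> (U, M) (u, m)" if \<epsilon>: "\<epsilon> > 0" for \<epsilon>
  proof -
    \<comment> \<open>Once \<open>e \<le> \<eta>\<close>, the factor
      \<open>\<Gamma> * (\<eta> + e)\<close> of the step estimate is at most
      \<open>\<Gamma> * (2 * \<eta>) = \<epsilon>\<close>.\<close>
    define \<eta> where "\<eta> = \<epsilon> / (2 * \<Gamma>)"
    have \<eta>: "\<eta> > 0" using \<epsilon> \<Gamma> by (simp add: \<eta>_def)
    obtain \<delta>1 where \<delta>1: "\<delta>1 > 0" "\<And>e. e \<le> \<delta>1 \<Longrightarrow> modulus e \<eta>" using modulus_exists[OF \<eta>] by blast
    define \<delta> where "\<delta> = min (min \<delta>0 \<delta>1) \<eta>"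
    have "dist2a \<alpha> (U', M') (u, m) \<le> \<epsilon> * dist2a \<alpha> (U, M) (u, m)"
      if p: "(U, M) \<in> XS \<alpha>" and d: "dist2a \<alpha> (U, M) (u, m) < \<delta>" and p': "(U', M') \<in> XS \<alpha>" and n: "newton_rel lam m0 f (U, M) (U', M')" for U M U' M'
    proof -
      define e where "e = dist2a \<alpha> (U, M) (u, m)"
      have e: "e < \<delta>0" "e \<le> \<delta>1" "e \<le> \<eta>" "e \<ge> 0" using d dnn[OF p] by (auto simp: \<delta>_def e_def)
      have "dist2a \<alpha> (U', M') (u, m) \<le> \<Gamma> * (\<eta> + e) * e"
        using bd[OF p _ p' n, of \<eta>] e(1) \<delta>1(2)[OF e(2)] unfolding e_def dist2a_XN by blast
      also have "\<dots> \<le> \<Gamma> * (2 * \<eta>) * e" using e \<Gamma> by (intro mult_right_mono mult_left_mono) auto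
      also have "\<dots> = \<epsilon> * e" using \<Gamma> by (simp add: \<eta>_def)
      finally show ?thesis unfolding e_def .
    qed
    then show ?thesis using \<Gamma> \<delta>1 \<eta> by (intro exI[of _ \<delta>]) (auto simp: \<delta>_def)
  qed
  obtain \<delta>2 where \<delta>2: "\<delta>2 > 0" and half: "\<And>U M U' M'. (U, M) \<in> XS \<alpha> \<Longrightarrow> dist2a \<alpha> (U, M) (u, m) < \<delta>2 \<Longrightarrow> (U', M') \<in> XS \<alpha> \<Longrightarrow> newton_rel lam m0 f (U, M) (U', M') \<Longrightarrow>
      dist2a \<alpha> (U', M') (u, m) \<le> 1/2 * dist2a \<alpha> (U, M) (u, m)"
    using small[of "1/2"] by auto
  \<comment> \<open>Below \<open>\<delta>0\<close> the step is solvable, below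
    \<open>\<delta>2\<close> it halves the error; so the ball is invariant and the iteration never
    leaves the region of solvability.\<close>
  define \<delta> where "\<delta> = min \<delta>0 \<delta>2"
  have \<delta>: "\<delta> > 0" using \<Gamma> \<delta>2 by (simp add: \<delta>_def)
  have stay: "dist2a \<alpha> (U', M') (u, m) < \<delta>"
    if "(U, M) \<in> XS \<alpha>" "dist2a \<alpha> (U, M) (u, m) < \<delta>" "(U', M') \<in> XS \<alpha>" "newton_rel lam m0 f (U, M) (U', M')" for U M U' M'
  proof -
    have "dist2a \<alpha> (U', M') (u, m) \<le> 1/2 * dist2a \<alpha> (U, M) (u, m)" by (rule half) (use that in \<open>auto simp: \<delta>_def\<close>)
    then show ?thesis using that(2) dnn[OF that(1)] by linarith
  qed
  show ?thesis
  proof (intro exI[of _ \<delta>] conjI \<delta> allI impI)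
    fix ui mi assume i: "C2a \<alpha> ui \<and> C2a \<alpha> mi \<and> dist2a \<alpha> (ui, mi) (u, m) < \<delta>"
    \<comment> \<open>A Newton sequence in the ball exists by dependent choice; the initial value is
      encoded as a condition at \<open>n = 0\<close>.\<close>
    have "\<exists>p :: nat \<Rightarrow> (real^'d \<Rightarrow> real) \<times> (real^'d \<Rightarrow> real). \<forall>n. (p n \<in> XS \<alpha> \<and> dist2a \<alpha> (p n) (u, m) < \<delta> \<and> (n = 0 \<longrightarrow> p n = (ui, mi))) \<and> newton_rel lam m0 f (p n) (p (Suc n))"
    proof (rule dependent_nat_choice)
      show "\<exists>p. p \<in> XS \<alpha> \<and> dist2a \<alpha> p (u, m) < \<delta> \<and> ((0::nat) = 0 \<longrightarrow> p = (ui, mi))" using i by (auto simp: XS_def)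
      fix p and n :: nat assume p: "p \<in> XS \<alpha> \<and> dist2a \<alpha> p (u, m) < \<delta> \<and> (n = 0 \<longrightarrow> p = (ui, mi))"
      obtain U M where UM: "p = (U, M)" by (cases p)
      obtain U' M' where n: "(U', M') \<in> XS \<alpha>" "newton_rel lam m0 f (U, M) (U', M')"
        using ex[of U M] p unfolding UM dist2a_XN \<delta>_def by auto
      have "dist2a \<alpha> (U', M') (u, m) < \<delta>" using stay[of U M U' M'] p n unfolding UM by blast
      then show "\<exists>q. (q \<in> XS \<alpha> \<and> dist2a \<alpha> q (u, m) < \<delta> \<and> (Suc n = 0 \<longrightarrow> q = (ui, mi))) \<and> newton_rel lam m0 f p q"
        using n UM by blast
    qed
    then obtain p where p: "\<And>n. p n \<in> XS \<alpha>" "p 0 = (ui, mi)" "\<And>n. newton_rel lam m0 f (p n) (p (Suc n))" by blast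
    show "\<exists>U M. U 0 = ui \<and> M 0 = mi \<and> newton_seq \<alpha> lam m0 f U M"
      by (rule exI[of _ "\<lambda>n. fst (p n)"], rule exI[of _ "\<lambda>n. snd (p n)"]) (use p in \<open>auto simp: newton_seq_def XS_def\<close>)
  next
    fix ui mi U M assume i: "C2a \<alpha> ui \<and> C2a \<alpha> mi \<and> dist2a \<alpha> (ui, mi) (u, m) < \<delta>" and s: "U 0 = ui \<and> M 0 = mi \<and> newton_seq \<alpha> lam m0 f U M"
    define e where "e k = dist2a \<alpha> (U k, M k) (u, m)" for k
    have X: "(U k, M k) \<in> XS \<alpha>" and n: "newton_rel lam m0 f (U k, M k) (U (Suc k), M (Suc k))" for k
      using s by (auto simp: newton_seq_def XS_def)
    have ed: "e k < \<delta>" for k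
    proof (induction k)
      case 0
      then show ?case using i s by (simp add: e_def)
    next
      case (Suc k)
      then show ?case using stay[OF X _ X n] unfolding e_def by blast
    qed
    have enn: "e k \<ge> 0" for k unfolding e_def by (rule dnn[OF X])
    have ehalf: "e (Suc k) \<le> 1/2 * e k" for k
      unfolding e_def by (rule half[OF X _ X n]) (use ed[of k] in \<open>simp add: e_def \<delta>_def\<close>)
    have sl: "superlinear_conv e"
    proof (rule superlinear_convI[of e, OF enn ehalf])
      fix \<epsilon> :: real assume "\<epsilon> > 0"
      from small[OF this] obtain \<delta>' where "\<delta>' > 0" "\<And>k. e k < \<delta>' \<Longrightarrow> e (Suc k) \<le> \<epsilon> * e k"
        unfolding e_def using X n by blast
      then show "\<exists>\<delta>>0. \<forall>k. e k < \<delta> \<longrightarrow> e (Suc k) \<le> \<epsilon> * e k" by blast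
    qed
    then show "superlinear_conv (\<lambda>k. dist2a \<alpha> (U k, M k) (u, m))" unfolding e_def[abs_def] .
    assume "C21loc f"
    \<comment> \<open>The Lipschitz constant on the bounded interval allows
      \<open>\<eta> = L * e k\<close> at the scale \<open>e k\<close>, so that the factor
      \<open>\<eta> + e k\<close> of the step estimate becomes \<open>(L + 1) * e k\<close>.\<close>
    then obtain L where L: "L-lipschitz_on {-(B+1)..B+1} f2" unfolding C21loc_def using bounded_closed_interval by metis
    have "e (Suc k) \<le> (\<Gamma> * (L + 1)) * (e k)\<^sup>2" for k
    proof -
      have "modulus (e k) (L * e k)"
        unfolding modulus_def
      proof safe
        fix s t assume st: "s \<in> {-(B+1)..B+1}" "t \<in> {-(B+1)..B+1}" "\<bar>s - t\<bar> \<le> e k"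
        have "\<bar>f2 s - f2 t\<bar> \<le> L * \<bar>s - t\<bar>" using lipschitz_onD[OF L st(1,2)] by (simp add: dist_real_def)
        also have "\<dots> \<le> L * e k" using st(3) lipschitz_on_nonneg[OF L] by (intro mult_left_mono) auto
        finally show "\<bar>f2 s - f2 t\<bar> \<le> L * e k" .
      qed
      then have "e (Suc k) \<le> \<Gamma> * (L * e k + e k) * e k"
        using bd[OF X _ X n, of k "L * e k"] ed[of k] unfolding e_def dist2a_XN \<delta>_def by simp
      then show ?thesis by (simp add: power2_eq_square algebra_simps)
    qed
    then show "quadratic_conv (\<lambda>k. dist2a \<alpha> (U k, M k) (u, m))"
      using sl unfolding quadratic_conv_def superlinear_conv_def e_def by blast
  qed
qed

end
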